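(* Let $n=\ell+3\ge4$, $S=\{1,\ldots,n\}$ with its standard dihedral structure $\delta$. Let $f=\prod_{\{i,j\}\in\chi_{S,\delta}}u_{ij}^{\alpha_{ij}}$ with $\alpha_{ij}\in\mathbb{Z}$, and let $D\subset\overline{\mathfrak{M}}_{0,S}\backslash\mathfrak{M}_{0,S}$ be the boundary divisor corresponding to a stable partition $S=S^1\cup S^2$. Then $$2\,\mathrm{ord}_D(f\omega_{S,\delta})=\sum_{\{i,j\}\in\chi_{S,\delta}}\alpha_{ij}\big[\mathbb{I}_D(i,j+1)+\mathbb{I}_D(i+1,j)-\mathbb{I}_D(i,j)-\mathbb{I}_D(i+1,j+1)\big]+(\ell-1)-\sum_{i\in\mathbb{Z}/n\mathbb{Z}}\mathbb{I}_D(i,i+2).$$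
   Context: $\mathfrak{M}_{0,S}=\mathrm{PSL}_2\backslash(\mathbb{P}^1)^n_*$ is the moduli space of $n$ distinct points on $\mathbb{P}^1$ labelled by $S$ and $\overline{\mathfrak{M}}_{0,S}$ its Deligne–Mumford–Knudsen compactification. A partition $S=S^1\cup S^2$ into two disjoint subsets is stable if $|S^1|,|S^2|\ge2$; stable partitions are in bijection with the irreducible boundary divisors $D$ (generic point of $D$: two copies of $\mathbb{P}^1$ meeting at a node, one carrying the points $S^1$ and the other the points $S^2$). $\mathrm{ord}_D$ denotes order of vanishing along $D$ (negative for poles) of a rational function or of a meromorphic top-degree form. For $i,j\in S$ (indices mod $n$), $\mathbb{I}_D(i,j)=1$ if $\{i,j\}\subset S^1$ or $\{i,j\}\subset S^2$, and $\mathbb{I}_D(i,j)=0$ otherwise. $\chi_{S,\delta}$ is the set of unordered pairs $\{i,j\}$ with $i,i+1,j,j+1$ distinct mod $n$, and $u_{ij}=\frac{(z_i-z_{j+1})(z_{i+1}-z_j)}{(z_i-z_j)(z_{i+1}-z_{j+1})}$. The form $\omega_{S,\delta}$ is the canonical $\ell$-form on $\mathfrak{M}_{0,S}$ which, in the cubical coordinates $x_i=u_{2\,i+3}$, $1\le i\le\ell$, is given (up to a non-zero rational multiple) by $$\omega_{S,\delta}=\frac{dx_1\wedge\cdots\wedge dx_\ell}{(1-x_1x_2)(1-x_2x_3)\cdots(1-x_{\ell-1}x_\ell)}$$ (equal to $dx_1$ if $\ell=1$). Equivalently, it is the form on $\mathfrak{M}_{0,S}$ induced by the $\mathrm{PSL}_2$-invariant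 form $\bigwedge_{j=1}^n\frac{dz_j}{z_j-z_{j+2}}$ on $(\mathbb{P}^1)^n_*$ after dividing by an invariant volume form on $\mathrm{PSL}_2$. *)

theory Defs
  imports "HOL-Analysis.Analysis" "Jordan_Normal_Form.Determinant"
begin

text \<open>The complex projective line, as the Riemann sphere; \<open>None\<close> is the point at infinity.\<close>

type_synonym proj_line = "complex option"

definition P1 :: "proj_line topology" where
  "P1 = Alexandroff_compactification euclidean"

fun hcoord1 :: "proj_line \<Rightarrow> complex" where
  "hcoord1 (Some z) = z"
| "hcoord1 None = 1"

fun hcoord2 :: "proj_line \<Rightarrow> complex" where
  "hcoord2 (Some z) = 1"
| "hcoord2 None = 0"

definition proj_pt :: "complex \<Rightarrow> complex \<Rightarrow> proj_line" where
  "proj_pt a b = (if b = 0 then None else Some (a / b))"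

text \<open>For finite points, \<open>pdiff (Some z) (Some w) = z - w\<close>.\<close>

definition pdiff :: "proj_line \<Rightarrow> proj_line \<Rightarrow> complex" where
  "pdiff p q = hcoord1 p * hcoord2 q - hcoord1 q * hcoord2 p"

text \<open>The cross-ratio \<open>(p - r) (q - s) / ((p - s) (q - r))\<close>. As a point of the projective line it
  is meaningful as soon as no three of the four points coincide.\<close>

definition cross_ratio :: "proj_line \<Rightarrow> proj_line \<Rightarrow> proj_line \<Rightarrow> proj_line \<Rightarrow> proj_line" where
  "cross_ratio p q r s = proj_pt (pdiff p r * pdiff q s) (pdiff p s * pdiff q r)"

definition moebius_map :: "complex \<Rightarrow> complex \<Rightarrow> complex \<Rightarrow> complex \<Rightarrow> proj_line \<Rightarrow> proj_line" where
  "moebius_map a b c d p = proj_pt (a * hcoord1 p + b * hcoord2 p) (c * hcoord1 p + d * hcoord2 p)"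

text \<open>The marked points are labelled by \<open>{1..n}\<close>. The space of \<open>PSL\<^sub>2\<close>-orbits of \<open>n\<close> distinct points is
  represented by the cross-ratios of all quadruples of distinct labels, which separate the orbits
  (lemma \<open>cross_ratios_eq_iff\<close> below).\<close>

type_synonym mpoint = "nat \<times> nat \<times> nat \<times> nat \<Rightarrow> proj_line"

definition quads :: "nat \<Rightarrow> (nat \<times> nat \<times> nat \<times> nat) set" where
  "quads n = {(i, j, k, m). {i, j, k, m} \<subseteq> {1..n} \<and> distinct [i, j, k, m]}"

definition cross_ratios :: "nat \<Rightarrow> (nat \<Rightarrow> proj_line) \<Rightarrow> mpoint" where
  "cross_ratios n z = (\<lambda>(i, j, k, m) \<in> quads n. cross_ratio (z i) (z j) (z k) (z m))"

definition M0 :: "nat \<Rightarrow> mpoint set" where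
  "M0 n = cross_ratios n ` {z. inj_on z {1..n}}"

text \<open>The compactification is the closure of \<open>M0 n\<close> in the product of projective lines indexed by
  the quadruples (a factor is the compactification for four labels, and the projections are the
  forgetful maps followed by the cross-ratio).\<close>

definition M0_ambient :: "nat \<Rightarrow> mpoint topology" where
  "M0_ambient n = product_topology (\<lambda>_. P1) (quads n)"

definition M0bar :: "nat \<Rightarrow> mpoint topology" where
  "M0bar n = subtopology (M0_ambient n) (M0_ambient n closure_of M0 n)"

definition stable_partition :: "nat \<Rightarrow> nat set \<Rightarrow> nat set \<Rightarrow> bool" where
  "stable_partition n S1 S2 \<longleftrightarrow>
     S1 \<union> S2 = {1..n} \<and> S1 \<inter> S2 = {} \<and> 2 \<le> card S1 \<and> 2 \<le> card S2"

text \<open>The stable curve with two components, the first carrying the points \<open>a i\<close> for \<open>i \<in> S1\<close> and the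
  node at \<open>s\<close>, the second the points \<open>b i\<close> for \<open>i \<in> S2\<close> and the node at \<open>t\<close>. Seen from one component
  the points of the other one sit at the node. At least one of the two components
  sees no triple coincidence among four given points; when both do (two labels on each side), they
  yield the same cross-ratio, namely 0, 1 or infinity.\<close>

definition nodal_point ::
  "nat \<Rightarrow> nat set \<Rightarrow> (nat \<Rightarrow> proj_line) \<Rightarrow> proj_line \<Rightarrow> (nat \<Rightarrow> proj_line) \<Rightarrow> proj_line \<Rightarrow> mpoint" where
  "nodal_point n S1 a s b t =
    (let z = (\<lambda>i. if i \<in> S1 then a i else s); w = (\<lambda>i. if i \<in> S1 then t else b i)
     in (\<lambda>(i, j, k, m) \<in> quads n.
          if 2 \<le> card ({i, j, k, m} \<inter> S1) then cross_ratio (z i) (z j) (z k) (z m)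
          else cross_ratio (w i) (w j) (w k) (w m)))"

definition open_stratum :: "nat \<Rightarrow> nat set \<Rightarrow> nat set \<Rightarrow> mpoint set" where
  "open_stratum n S1 S2 =
    {nodal_point n S1 a s b t | a s b t.
       inj_on a S1 \<and> s \<notin> a ` S1 \<and> inj_on b S2 \<and> t \<notin> b ` S2}"

definition boundary_divisor :: "nat \<Rightarrow> nat set \<Rightarrow> nat set \<Rightarrow> mpoint set" where
  "boundary_divisor n S1 S2 = M0bar n closure_of open_stratum n S1 S2"

text \<open>Complex \<open>l\<close>-space; its points are extensional functions on \<open>{..<l}\<close>.\<close>

definition Cn :: "nat \<Rightarrow> (nat \<Rightarrow> complex) topology" where
  "Cn l = product_topology (\<lambda>_. euclidean) {..<l}"

definition partial :: "nat \<Rightarrow> ((nat \<Rightarrow> complex) \<Rightarrow> complex) \<Rightarrow> (nat \<Rightarrow> complex) \<Rightarrow> complex" where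
  "partial j F y = deriv (\<lambda>t. F (y(j := t))) (y j)"

text \<open>Holomorphic on an open set \<open>U\<close>: continuous, and holomorphic in each variable separately.\<close>

definition holo :: "nat \<Rightarrow> (nat \<Rightarrow> complex) set \<Rightarrow> ((nat \<Rightarrow> complex) \<Rightarrow> complex) \<Rightarrow> bool" where
  "holo l U F \<longleftrightarrow>
     openin (Cn l) U \<and> continuous_map (subtopology (Cn l) U) euclidean F \<and>
     (\<forall>y\<in>U. \<forall>j<l. (\<lambda>t. F (y(j := t))) field_differentiable (at (y j)))"

fun pinv :: "proj_line \<Rightarrow> proj_line" where
  "pinv None = Some 0"
| "pinv (Some z) = (if z = 0 then None else Some (inverse z))"

definition holo_P1 :: "nat \<Rightarrow> (nat \<Rightarrow> complex) set \<Rightarrow> ((nat \<Rightarrow> complex) \<Rightarrow> proj_line) \<Rightarrow> bool" where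
  "holo_P1 l U F \<longleftrightarrow>
     continuous_map (subtopology (Cn l) U) P1 F \<and>
     holo l {y \<in> U. F y \<noteq> None} (\<lambda>y. the (F y)) \<and>
     holo l {y \<in> U. F y \<noteq> Some 0} (\<lambda>y. the (pinv (F y)))"

text \<open>An affine coordinate of the projective line near \<open>p\<close>.\<close>

definition affine_coord :: "proj_line \<Rightarrow> proj_line \<Rightarrow> complex" where
  "affine_coord p q = (if p = None then the (pinv q) else the q)"

text \<open>Holomorphic local parametrisations of the complex submanifold \<open>M0bar (l + 3)\<close> of a product of
  projective lines: homeomorphisms onto open subsets which are holomorphic immersions into the
  product. The last conjunct is the injectivity of the differential.\<close>

definition chart :: "nat \<Rightarrow> (nat \<Rightarrow> complex) set \<Rightarrow> ((nat \<Rightarrow> complex) \<Rightarrow> mpoint) \<Rightarrow> bool" where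
  "chart l U \<phi> \<longleftrightarrow>
     openin (Cn l) U \<and> openin (M0bar (l + 3)) (\<phi> ` U) \<and>
     homeomorphic_map (subtopology (Cn l) U) (subtopology (M0bar (l + 3)) (\<phi> ` U)) \<phi> \<and>
     (\<forall>Q \<in> quads (l + 3). holo_P1 l U (\<lambda>y. \<phi> y Q)) \<and>
     (\<forall>y\<in>U. \<forall>v.
        (\<forall>Q \<in> quads (l + 3).
           (\<Sum>j<l. v j * partial j (\<lambda>y'. affine_coord (\<phi> y Q) (\<phi> y' Q)) y) = 0) \<longrightarrow>
        (\<forall>j<l. v j = 0))"

text \<open>A chart around a generic point of \<open>D\<close>, in which \<open>D\<close> is given by the vanishing of the coordinate
  with index 0 and which meets no other boundary component.\<close>

definition adapted_chart ::
  "nat \<Rightarrow> mpoint set \<Rightarrow> (nat \<Rightarrow> complex) set \<Rightarrow> ((nat \<Rightarrow> complex) \<Rightarrow> mpoint) \<Rightarrow> bool" where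
  "adapted_chart l D U \<phi> \<longleftrightarrow>
     chart l U \<phi> \<and> (\<exists>y\<in>U. y 0 = 0) \<and>
     (\<forall>y\<in>U. \<phi> y \<in> D \<longleftrightarrow> y 0 = 0) \<and> (\<forall>y\<in>U. y 0 \<noteq> 0 \<longrightarrow> \<phi> y \<in> M0 (l + 3))"

text \<open>The pair \<open>(F, g)\<close> stands for the form \<open>F dg\<^sub>1 \<and> \<dots> \<and> dg\<^sub>l\<close> on \<open>M0 (l + 3)\<close>.\<close>

type_synonym top_form = "(mpoint \<Rightarrow> complex) \<times> (nat \<Rightarrow> mpoint \<Rightarrow> complex)"

definition scale_form :: "(mpoint \<Rightarrow> complex) \<Rightarrow> top_form \<Rightarrow> top_form" where
  "scale_form f \<eta> = (\<lambda>q. f q * fst \<eta> q, snd \<eta>)"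

text \<open>The coefficient of \<open>dy\<^sub>0 \<and> \<dots> \<and> dy\<^bsub>l-1\<^esub>\<close> in the pullback of a form along a chart.\<close>

definition pullback_coeff ::
  "nat \<Rightarrow> ((nat \<Rightarrow> complex) \<Rightarrow> mpoint) \<Rightarrow> top_form \<Rightarrow> (nat \<Rightarrow> complex) \<Rightarrow> complex" where
  "pullback_coeff l \<phi> \<eta> y =
     fst \<eta> (\<phi> y) *
     Determinant.det (mat l l (\<lambda>(i, j). partial j (\<lambda>y'. snd \<eta> (Suc i) (\<phi> y')) y))"

definition has_order_along :: "nat \<Rightarrow> mpoint set \<Rightarrow> top_form \<Rightarrow> int \<Rightarrow> bool" where
  "has_order_along l D \<eta> m \<longleftrightarrow>
     (\<exists>U \<phi> h. adapted_chart l D U \<phi> \<and> holo l U h \<and> (\<forall>y\<in>U. h y \<noteq> 0) \<and>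
        (\<forall>y\<in>U. y 0 \<noteq> 0 \<longrightarrow> pullback_coeff l \<phi> \<eta> y = y 0 powi m * h y))"

definition ord_along :: "nat \<Rightarrow> mpoint set \<Rightarrow> top_form \<Rightarrow> int" where
  "ord_along l D \<eta> = (THE m. has_order_along l D \<eta> m)"

text \<open>\<open>i + 1\<close> modulo \<open>n\<close>, with residues taken in \<open>{1..n}\<close>.\<close>

definition nxt :: "nat \<Rightarrow> nat \<Rightarrow> nat" where
  "nxt n i = i mod n + 1"

text \<open>An unordered pair \<open>{i, j}\<close> is represented by \<open>(i, j)\<close> with \<open>i < j\<close>.\<close>

definition chi :: "nat \<Rightarrow> (nat \<times> nat) set" where
  "chi n = {(i, j). 1 \<le> i \<and> i < j \<and> j \<le> n \<and> distinct [i, nxt n i, j, nxt n j]}"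

text \<open>\<open>(z\<^sub>i - z\<^bsub>j+1\<^esub>) (z\<^bsub>i+1\<^esub> - z\<^sub>j) / ((z\<^sub>i - z\<^sub>j) (z\<^bsub>i+1\<^esub> - z\<^bsub>j+1\<^esub>))\<close>, which is finite and non-zero on \<open>M0 n\<close>.\<close>

definition u_coord :: "nat \<Rightarrow> nat \<Rightarrow> nat \<Rightarrow> mpoint \<Rightarrow> complex" where
  "u_coord n i j q = the (q (i, nxt n i, nxt n j, j))"

definition u_monomial :: "nat \<Rightarrow> (nat \<Rightarrow> nat \<Rightarrow> int) \<Rightarrow> mpoint \<Rightarrow> complex" where
  "u_monomial n \<alpha> q = (\<Prod>(i, j)\<in>chi n. u_coord n i j q powi \<alpha> i j)"

definition cubical :: "nat \<Rightarrow> nat \<Rightarrow> mpoint \<Rightarrow> complex" where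
  "cubical l i = u_coord (l + 3) 2 (i + 3)"

text \<open>The canonical form is only defined up to the non-zero rational factor \<open>c\<close>.\<close>

definition canonical_form :: "nat \<Rightarrow> rat \<Rightarrow> top_form" where
  "canonical_form l c =
     (\<lambda>q. of_rat c / (\<Prod>i\<in>{1..<l}. 1 - cubical l i q * cubical l (i + 1) q), cubical l)"

definition same_side :: "nat set \<Rightarrow> nat set \<Rightarrow> nat \<Rightarrow> nat \<Rightarrow> int" where
  "same_side S1 S2 i j = (if {i, j} \<subseteq> S1 \<or> {i, j} \<subseteq> S2 then 1 else 0)"

lemma pdiff_Some [simp]: "pdiff (Some z) (Some w) = z - w"
  by (simp add: pdiff_def)

lemma pdiff_eq_0_iff: "pdiff p q = 0 \<longleftrightarrow> p = q"
  by (cases p; cases q) (auto simp: pdiff_def)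

lemma hcoord_nonzero: "hcoord1 p \<noteq> 0 \<or> hcoord2 p \<noteq> 0"
  by (cases p) auto

lemma proj_pt_hcoord [simp]: "proj_pt (hcoord1 p) (hcoord2 p) = p"
  by (cases p) (auto simp: proj_pt_def)

lemma proj_pt_scale: "k \<noteq> 0 \<Longrightarrow> proj_pt (k * a) (k * b) = proj_pt a b"
  by (auto simp: proj_pt_def)

lemma hcoord_proj_pt:
  assumes "a \<noteq> 0 \<or> b \<noteq> 0"
  shows "\<exists>k. k \<noteq> 0 \<and> hcoord1 (proj_pt a b) = k * a \<and> hcoord2 (proj_pt a b) = k * b"
proof (cases "b = 0")
  case True
  then show ?thesis using assms by (intro exI[of _ "1 / a"]) (auto simp: proj_pt_def)
next
  case False
  then show ?thesis by (intro exI[of _ "1 / b"]) (auto simp: proj_pt_def)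
qed

lemma matrix_injective:
  fixes a b c d x y :: complex
  assumes "a * d - b * c \<noteq> 0" "x \<noteq> 0 \<or> y \<noteq> 0"
  shows "a * x + b * y \<noteq> 0 \<or> c * x + d * y \<noteq> 0"
proof (rule ccontr)
  assume "\<not> ?thesis"
  then have e: "a * x + b * y = 0" "c * x + d * y = 0" by auto
  have "(a * d - b * c) * x = d * (a * x + b * y) - b * (c * x + d * y)"
    "(a * d - b * c) * y = a * (c * x + d * y) - c * (a * x + b * y)"
    by (simp_all add: algebra_simps)
  then show False using e assms by simp
qed

lemma hcoord_moebius:
  assumes "a * d - b * c \<noteq> 0"
  shows "\<exists>k. k \<noteq> 0 \<and> hcoord1 (moebius_map a b c d p) = k * (a * hcoord1 p + b * hcoord2 p)
           \<and> hcoord2 (moebius_map a b c d p) = k * (c * hcoord1 p + d * hcoord2 p)"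
  unfolding moebius_map_def
  by (rule hcoord_proj_pt) (use matrix_injective[OF assms hcoord_nonzero] in blast)

lemma moebius_comp:
  assumes "a * d - b * c \<noteq> 0"
  shows "moebius_map a' b' c' d' (moebius_map a b c d p) =
         moebius_map (a' * a + b' * c) (a' * b + b' * d) (c' * a + d' * c) (c' * b + d' * d) p"
proof -
  obtain k where k: "k \<noteq> 0" "hcoord1 (moebius_map a b c d p) = k * (a * hcoord1 p + b * hcoord2 p)"
    "hcoord2 (moebius_map a b c d p) = k * (c * hcoord1 p + d * hcoord2 p)"
    using hcoord_moebius[OF assms] by blast
  show ?thesis
    unfolding moebius_map_def[of a' b' c' d'] k(2,3)
    unfolding moebius_map_def
    by (subst proj_pt_scale[OF k(1), symmetric]) (simp add: algebra_simps)
qed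

lemma moebius_scale:
  assumes "k \<noteq> 0"
  shows "moebius_map (k * a) (k * b) (k * c) (k * d) p = moebius_map a b c d p"
  unfolding moebius_map_def
  by (subst (2) proj_pt_scale[OF assms, symmetric]) (simp add: algebra_simps)

lemma moebius_id: "moebius_map 1 0 0 1 p = p"
  by (simp add: moebius_map_def)

lemma moebius_inverse:
  assumes "a * d - b * c \<noteq> 0"
  shows "moebius_map d (- b) (- c) a (moebius_map a b c d p) = p"
proof -
  have "moebius_map d (- b) (- c) a (moebius_map a b c d p) =
        moebius_map ((a * d - b * c) * 1) ((a * d - b * c) * 0) ((a * d - b * c) * 0) ((a * d - b * c) * 1) p"
    by (subst moebius_comp[OF assms]) (simp add: algebra_simps)
  then show ?thesis by (simp only: moebius_scale[OF assms] moebius_id)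
qed

lemma pdiff_moebius:
  assumes "a * d - b * c \<noteq> 0"
  obtains k where "\<And>p. k p \<noteq> 0"
    "\<And>p q. pdiff (moebius_map a b c d p) (moebius_map a b c d q) = k p * k q * (a * d - b * c) * pdiff p q"
proof -
  obtain k where "\<And>p. k p \<noteq> 0 \<and> hcoord1 (moebius_map a b c d p) = k p * (a * hcoord1 p + b * hcoord2 p)
           \<and> hcoord2 (moebius_map a b c d p) = k p * (c * hcoord1 p + d * hcoord2 p)"
    using hcoord_moebius[OF assms] by metis
  then show thesis
    by (intro that[of k]) (auto simp: pdiff_def algebra_simps)
qed

lemma cross_ratio_moebius:
  assumes "a * d - b * c \<noteq> 0"
  defines "g \<equiv> moebius_map a b c d"
  shows "cross_ratio (g p) (g q) (g r) (g s) = cross_ratio p q r s"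
proof -
  obtain k where k: "\<And>p. k p \<noteq> 0"
    "\<And>p q. pdiff (g p) (g q) = k p * k q * (a * d - b * c) * pdiff p q"
    unfolding g_def using pdiff_moebius[OF assms(1)] by metis
  define K where "K = k p * k q * k r * k s * (a * d - b * c)^2"
  have K: "K \<noteq> 0" using k(1) assms(1) by (simp add: K_def)
  show ?thesis
    unfolding cross_ratio_def k(2)
    by (subst (2) proj_pt_scale[OF K, symmetric])
       (simp add: K_def power2_eq_square algebra_simps)
qed

text \<open>The cross-ratio with three distinct fixed arguments, as a Moebius transformation of the fourth.\<close>

lemma cross_ratio_eq_moebius:
  assumes "p \<noteq> q" "p \<noteq> r" "q \<noteq> r"
  obtains a b c d where "a * d - b * c \<noteq> 0" "\<And>s. cross_ratio p q r s = moebius_map a b c d s"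
proof -
  let ?A = "pdiff p r" and ?B = "pdiff q r"
  have "?A * (- hcoord2 q) * (?B * hcoord1 p) - ?A * hcoord1 q * (?B * (- hcoord2 p)) =
        - (?A * ?B * pdiff p q)"
    by (simp add: pdiff_def[of p q] algebra_simps)
  then have "?A * (- hcoord2 q) * (?B * hcoord1 p) - ?A * hcoord1 q * (?B * (- hcoord2 p)) \<noteq> 0"
    using assms by (simp add: pdiff_eq_0_iff)
  moreover have "cross_ratio p q r s =
      moebius_map (?A * (- hcoord2 q)) (?A * hcoord1 q) (?B * (- hcoord2 p)) (?B * hcoord1 p) s" for s
    by (simp add: cross_ratio_def moebius_map_def pdiff_def[of _ s] algebra_simps)
  ultimately show thesis using that by blast
qed

lemma cross_ratio_degenerate:
  assumes "p \<noteq> q" "p \<noteq> r" "q \<noteq> r"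
  shows "cross_ratio p q r p = None" "cross_ratio p q r q = Some 0" "cross_ratio p q r r = Some 1"
  using assms by (auto simp: cross_ratio_def proj_pt_def pdiff_eq_0_iff)

lemma cross_ratios_eq_iff:
  assumes n: "3 \<le> n" and z: "inj_on z {1..n}" and w: "inj_on w {1..n}"
  shows "cross_ratios n z = cross_ratios n w \<longleftrightarrow>
    (\<exists>a b c d. a * d - b * c = 1 \<and> (\<forall>i\<in>{1..n}. w i = moebius_map a b c d (z i)))"
    (is "_ \<longleftrightarrow> ?R")
proof
  assume ?R
  then obtain a b c d where g: "a * d - b * c = 1" "\<forall>i\<in>{1..n}. w i = moebius_map a b c d (z i)"
    by blast
  then have "a * d - b * c \<noteq> 0" by simp
  then show "cross_ratios n z = cross_ratios n w"
    using g(2) by (auto simp: cross_ratios_def quads_def restrict_def cross_ratio_moebius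
        split: prod.splits)
next
  assume eq: "cross_ratios n z = cross_ratios n w"
  have dz: "z 1 \<noteq> z 2" "z 1 \<noteq> z 3" "z 2 \<noteq> z 3" and dw: "w 1 \<noteq> w 2" "w 1 \<noteq> w 3" "w 2 \<noteq> w 3"
    using n inj_on_eq_iff[OF z] inj_on_eq_iff[OF w] by simp_all
  have cr: "cross_ratio (z 1) (z 2) (z 3) (z i) = cross_ratio (w 1) (w 2) (w 3) (w i)"
    if i: "i \<in> {1..n}" for i
  proof (cases "i = 1 \<or> i = 2 \<or> i = 3")
    case True
    then show ?thesis
      using cross_ratio_degenerate[OF dz] cross_ratio_degenerate[OF dw] by metis
  next
    case False
    then have "(1, 2, 3, i) \<in> quads n" using i n by (auto simp: quads_def)
    then show ?thesis using fun_cong[OF eq, of "(1, 2, 3, i)"] by (simp add: cross_ratios_def)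
  qed
  obtain a b c d where g: "a * d - b * c \<noteq> 0"
    "\<And>s. cross_ratio (z 1) (z 2) (z 3) s = moebius_map a b c d s"
    using cross_ratio_eq_moebius[OF dz] by metis
  obtain a' b' c' d' where h: "a' * d' - b' * c' \<noteq> 0"
    "\<And>s. cross_ratio (w 1) (w 2) (w 3) s = moebius_map a' b' c' d' s"
    using cross_ratio_eq_moebius[OF dw] by metis
  define A B C E where "A = d' * a - b' * c" and "B = d' * b - b' * d"
    and "C = a' * c - c' * a" and "E = a' * d - c' * b"
  define k where "k = 1 / csqrt (A * E - B * C)"
  have "A * E - B * C = (a * d - b * c) * (a' * d' - b' * c')"
    by (simp add: A_def B_def C_def E_def algebra_simps)
  then have nz: "A * E - B * C \<noteq> 0" using g(1) h(1) by simp
  then have k: "k \<noteq> 0" by (simp add: k_def)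
  have "k^2 * (A * E - B * C) = 1"
    using nz by (simp add: k_def power_divide)
  then have det1: "(k * A) * (k * E) - (k * B) * (k * C) = 1"
    by (simp add: power2_eq_square algebra_simps)
  have "w i = moebius_map (k * A) (k * B) (k * C) (k * E) (z i)" if "i \<in> {1..n}" for i
  proof -
    have "w i = moebius_map d' (- b') (- c') a' (moebius_map a' b' c' d' (w i))"
      using moebius_inverse[OF h(1)] by simp
    also have "moebius_map a' b' c' d' (w i) = moebius_map a b c d (z i)"
      using cr[OF that] g(2) h(2) by simp
    also have "moebius_map d' (- b') (- c') a' (moebius_map a b c d (z i)) = moebius_map A B C E (z i)"
      by (subst moebius_comp[OF g(1)]) (simp add: A_def B_def C_def E_def algebra_simps)
    finally show ?thesis using moebius_scale[OF k] by simp
  qed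
  then show ?R using det1 by blast
qed

end

theory Submission
  imports Defs "HOL-Complex_Analysis.Cauchy_Integral_Formula"
begin

text \<open>Two of the labels 1, 2, 3 lie on the same side of the partition, say in \<open>S2\<close>. Sending \<open>z\<^sub>1, z\<^sub>2, z\<^sub>3\<close> to
  \<open>0, 1, \<infinity>\<close> in a suitable order therefore makes the points of \<open>S1\<close> collide in the affine line near \<open>D\<close>, and
  the parameter \<open>t\<close> of the collision extends to a chart that contains all of \<open>M0\<close> and all of the open
  stratum of \<open>D\<close>. In it \<open>z\<^sub>i - z\<^sub>j\<close> is a unit times \<open>t\<close> if \<open>i, j \<in> S1\<close> and a unit otherwise, so cross-ratios have
  evident orders; the Jacobian of the cubical coordinates is a product of such differences and
  \<open>t\<^bsup>|S1| - 2\<^esup>\<close>, and altogether \<open>\<omega>\<close> behaves like \<open>t\<^bsup>|S1| - 2\<^esup>\<close> divided by the product of all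
  \<open>z\<^sub>j - z\<^bsub>j+2\<^esub>\<close>. Any other adapted chart meets this one in the open stratum, and there the transition
  map multiplies \<open>t\<close> and the volume form by units.\<close>

section \<open>Holomorphic functions of several variables\<close>

text \<open>\<open>ord_along\<close> is a definite description over all adapted charts, so it is not
  enough that one chart exhibits the order: every other one must give the same integer. As
  \<open>holo\<close> only asks for continuity and holomorphy in each variable, comparing charts
  rests on a chain rule derived from Cauchy estimates. \<open>M0bar\<close> is merely a closure in a
  product of spheres, and statements about it have to be extracted from the ambient product. For
  this reason every coordinate of the smoothing chart is chosen to be a cross-ratio of labels
  (\<open>Q\<close>): the inverse of the chart becomes a projection, continuous on an open subset of
  the product, and immersivity is immediate. Two of the three normalised points must stay away from
  the collision for the chart to reach the divisor, whence the different roles of \<open>b\<close>,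
  \<open>q\<close> and \<open>p\<close>. The factor 2 of the formula reflects that the order counts
  pairs inside \<open>S1\<close>, whereas \<open>same_side\<close> also counts those inside
  \<open>S2\<close>.\<close>

definition box_Cn :: "nat \<Rightarrow> (nat \<Rightarrow> complex) \<Rightarrow> real \<Rightarrow> (nat \<Rightarrow> complex) set" where
  "box_Cn l y r = {w \<in> extensional {..<l}. \<forall>i<l. dist (w i) (y i) < r}"

lemma topspace_Cn: "topspace (Cn l) = extensional {..<l}"
  by (simp add: Cn_def PiE_def)

text \<open>There are finitely many coordinates, so the radii of a basic product neighbourhood have
  a positive minimum. Polydiscs of extensional functions thereby take the place of balls in all
  later estimates.\<close>

lemma openin_Cn_iff:
  "openin (Cn l) U \<longleftrightarrow> U \<subseteq> extensional {..<l} \<and> (\<forall>y\<in>U. \<exists>r>0. box_Cn l y r \<subseteq> U)"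
proof (intro iffI conjI ballI)
  assume U: "openin (Cn l) U"
  then show "U \<subseteq> extensional {..<l}"
    using openin_subset topspace_Cn by blast
  fix y assume "y \<in> U"
  then obtain W where W: "\<And>i. i < l \<Longrightarrow> open (W i)" "y \<in> PiE {..<l} W" "PiE {..<l} W \<subseteq> U"
    using U unfolding Cn_def openin_product_topology_alt by (metis lessThan_iff open_openin)
  have "\<exists>r>0. i < l \<longrightarrow> ball (y i) r \<subseteq> W i" for i
  proof (cases "i < l")
    case True
    then have "y i \<in> W i" using W(2) by auto
    then show ?thesis using W(1)[OF True] open_contains_ball by blast
  qed (auto intro: exI[of _ 1])
  then obtain r where r: "\<And>i. r i > 0" "\<And>i. i < l \<Longrightarrow> ball (y i) (r i) \<subseteq> W i"
    by metis
  define d where "d = Min (insert 1 (r ` {..<l}))"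
  have d: "d > 0" "\<And>i. i < l \<Longrightarrow> d \<le> r i"
    using r(1) by (auto simp: d_def)
  have "box_Cn l y d \<subseteq> PiE {..<l} W"
  proof
    fix w assume w: "w \<in> box_Cn l y d"
    have "w i \<in> W i" if "i < l" for i
      using w that d(2)[OF that] r(2)[OF that] by (force simp: box_Cn_def dist_commute)
    then show "w \<in> PiE {..<l} W"
      using w by (auto simp: box_Cn_def PiE_def)
  qed
  then show "\<exists>r>0. box_Cn l y r \<subseteq> U"
    using d(1) W(3) by blast
next
  assume *: "U \<subseteq> extensional {..<l} \<and> (\<forall>y\<in>U. \<exists>r>0. box_Cn l y r \<subseteq> U)"
  have "\<exists>W. finite {i \<in> {..<l}. W i \<noteq> topspace euclidean} \<and> (\<forall>i\<in>{..<l}. openin euclidean (W i)) \<and>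
          y \<in> PiE {..<l} W \<and> PiE {..<l} W \<subseteq> U" if yU: "y \<in> U" for y
  proof -
    obtain r where r: "r > 0" "box_Cn l y r \<subseteq> U"
      using *[THEN conjunct2, rule_format, OF yU] by auto
    have "PiE {..<l} (\<lambda>i. ball (y i) r) \<subseteq> box_Cn l y r"
      by (auto simp: box_Cn_def PiE_def dist_commute)
    then show ?thesis
      using r * yU by (intro exI[of _ "\<lambda>i. ball (y i) r"]) (auto simp: PiE_def)
  qed
  then show "openin (Cn l) U"
    unfolding Cn_def openin_product_topology_alt by blast
qed

lemma box_Cn_mono: "r \<le> s \<Longrightarrow> box_Cn l y r \<subseteq> box_Cn l y s"
  by (force simp: box_Cn_def)

lemma continuous_map_Cn_E:
  fixes F :: "(nat \<Rightarrow> complex) \<Rightarrow> 'a::metric_space"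
  assumes "openin (Cn l) U" "continuous_map (subtopology (Cn l) U) euclidean F" "y \<in> U" "e > 0"
  obtains r where "r > 0" "box_Cn l y r \<subseteq> U" "\<And>w. w \<in> box_Cn l y r \<Longrightarrow> dist (F w) (F y) < e"
proof -
  have "openin (subtopology (Cn l) U) {w \<in> topspace (subtopology (Cn l) U). F w \<in> ball (F y) e}"
    by (rule openin_continuous_map_preimage[OF assms(2)]) auto
  then have "openin (Cn l) {w \<in> topspace (subtopology (Cn l) U). F w \<in> ball (F y) e}"
    using assms(1) openin_trans_full by blast
  moreover have "y \<in> {w \<in> topspace (subtopology (Cn l) U). F w \<in> ball (F y) e}"
    using assms openin_subset[OF assms(1)] by auto
  ultimately obtain r where r: "r > 0"
    "box_Cn l y r \<subseteq> {w \<in> topspace (subtopology (Cn l) U). F w \<in> ball (F y) e}"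
    by (meson openin_Cn_iff)
  then show thesis
    by (intro that[of r]) (auto simp: dist_commute)
qed

lemma extensional_fun_upd: "y \<in> extensional {..<l} \<Longrightarrow> j < l \<Longrightarrow> y(j := t) \<in> extensional {..<l}"
  by (auto simp: extensional_def)

lemma box_Cn_fun_upd:
  "w \<in> box_Cn l y r \<Longrightarrow> j < l \<Longrightarrow> dist t (u::complex) < r \<Longrightarrow> w(j := t) \<in> box_Cn l (y(j := u)) r"
  by (auto simp: box_Cn_def extensional_fun_upd)

lemma box_Cn_fun_upd':
  "w \<in> box_Cn l y r \<Longrightarrow> j < l \<Longrightarrow> dist t (y j) < r \<Longrightarrow> w(j := t) \<in> box_Cn l y r"
  by (auto simp: box_Cn_def extensional_fun_upd)

lemma box_Cn_self: "y \<in> extensional {..<l} \<Longrightarrow> r > 0 \<Longrightarrow> y \<in> box_Cn l y r"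
  by (auto simp: box_Cn_def)

lemma holo_open: "holo l U F \<Longrightarrow> openin (Cn l) U"
  by (simp add: holo_def)

lemma holo_subset_ext: "holo l U F \<Longrightarrow> U \<subseteq> extensional {..<l}"
  using holo_open openin_Cn_iff by blast

lemma holo_has_partial:
  assumes "holo l U F" "y(j := t) \<in> U" "j < l"
  shows "((\<lambda>s. F (y(j := s))) has_field_derivative partial j F (y(j := t))) (at t)"
proof -
  have "(\<lambda>s. F ((y(j := t))(j := s))) field_differentiable at ((y(j := t)) j)"
    using assms unfolding holo_def by blast
  then show ?thesis
    by (simp add: partial_def field_differentiable_derivI)
qed

text \<open>Compactness of the disc makes the dependence on the other coordinates uniform.\<close>

lemma uniform_near_disc:
  assumes F: "holo l U F" and j: "j < l" and sub: "\<And>\<zeta>. \<zeta> \<in> K \<Longrightarrow> y(j := \<zeta>) \<in> U"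
    and K: "compact K" and e: "e > 0"
  obtains d where "d > 0"
    "\<And>w \<zeta>. w \<in> box_Cn l y d \<Longrightarrow> \<zeta> \<in> K \<Longrightarrow> dist (F (w(j := \<zeta>))) (F (y(j := \<zeta>))) < e"
proof -
  have "\<exists>r>0. \<forall>w\<in>box_Cn l (y(j := \<zeta>)) r. dist (F w) (F (y(j := \<zeta>))) < e / 2" if "\<zeta> \<in> K" for \<zeta>
    using continuous_map_Cn_E[of l U F "y(j := \<zeta>)" "e / 2"] F sub[OF that] e
    unfolding holo_def by (metis half_gt_zero)
  then obtain r where r: "\<And>\<zeta>. \<zeta> \<in> K \<Longrightarrow> r \<zeta> > 0"
    "\<And>\<zeta> w. \<zeta> \<in> K \<Longrightarrow> w \<in> box_Cn l (y(j := \<zeta>)) (r \<zeta>) \<Longrightarrow> dist (F w) (F (y(j := \<zeta>))) < e / 2"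
    by metis
  have "K \<subseteq> (\<Union>\<zeta>\<in>K. ball \<zeta> (r \<zeta>))"
    using r(1) by force
  then obtain C where C: "C \<subseteq> K" "finite C" "K \<subseteq> (\<Union>\<zeta>\<in>C. ball \<zeta> (r \<zeta>))"
    using compactE_image[OF K, of K "\<lambda>\<zeta>. ball \<zeta> (r \<zeta>)"] by auto
  define d where "d = Min (insert 1 (r ` C))"
  have d: "d > 0" "\<And>\<zeta>. \<zeta> \<in> C \<Longrightarrow> d \<le> r \<zeta>"
    using C r(1) by (auto simp: d_def)
  show thesis
  proof (rule that[OF d(1)])
    fix w \<zeta> assume w: "w \<in> box_Cn l y d" and \<zeta>: "\<zeta> \<in> K"
    then obtain x where x: "x \<in> C" "dist \<zeta> x < r x"
      using C(3) by (auto simp: dist_commute)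
    have y: "y \<in> extensional {..<l}"
    proof -
      have "y(j := \<zeta>) \<in> extensional {..<l}"
        using sub[OF \<zeta>] holo_subset_ext[OF F] by blast
      then show ?thesis using j by (auto simp: extensional_def fun_upd_def split: if_splits)
    qed
    have "w(j := \<zeta>) \<in> box_Cn l (y(j := x)) (r x)"
      using w box_Cn_mono[OF d(2)[OF x(1)]] by (intro box_Cn_fun_upd x j) auto
    moreover have "y(j := \<zeta>) \<in> box_Cn l (y(j := x)) (r x)"
      using r(1) C(1) x by (intro box_Cn_fun_upd x j box_Cn_self y) auto
    ultimately have "dist (F (w(j := \<zeta>))) (F (y(j := x))) < e / 2"
      "dist (F (y(j := \<zeta>))) (F (y(j := x))) < e / 2"
      using r(2) C(1) x(1) by auto
    then show "dist (F (w(j := \<zeta>))) (F (y(j := \<zeta>))) < e"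
      using dist_triangle2[of "F (w(j := \<zeta>))" "F (y(j := \<zeta>))" "F (y(j := x))"] by linarith
  qed
qed

text \<open>The increment splits into the change of the one-variable derivative along direction
  \<open>j\<close> and the derivative of the difference of two slices. That difference is uniformly
  small on a disc, so Cauchy's inequality bounds its derivative.\<close>

lemma partial_continuous:
  assumes F: "holo l U F" and y: "y \<in> U" and j: "j < l" and e: "e > 0"
  obtains d where "d > 0" "box_Cn l y d \<subseteq> U"
    "\<And>w. w \<in> box_Cn l y d \<Longrightarrow> dist (partial j F w) (partial j F y) < e"
proof -
  obtain r0 where r0: "r0 > 0" "box_Cn l y r0 \<subseteq> U"
    using holo_open[OF F] y openin_Cn_iff by blast
  \<comment> \<open>If \<open>w j\<close> is within \<open>r\<close> of \<open>y j\<close>, the disc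
    of radius \<open>r\<close> about \<open>w j\<close> lies in the disc of radius
    \<open>2 * r\<close> about \<open>y j\<close>, still inside radius \<open>r0\<close>.\<close>
  define r where "r = r0 / 3"
  have r: "r > 0" "2 * r < r0" using r0 by (auto simp: r_def)
  have yext: "y \<in> extensional {..<l}" using y holo_subset_ext[OF F] by blast
  have inU: "w(j := \<zeta>) \<in> U" if "w \<in> box_Cn l y r0" "\<zeta> \<in> ball (y j) r0" for w \<zeta>
    using box_Cn_fun_upd'[OF that(1) j, of \<zeta>] that(2) r0(2) by (auto simp: dist_commute)
  have hol: "(\<lambda>\<zeta>. F (w(j := \<zeta>))) holomorphic_on ball (y j) r0" if "w \<in> box_Cn l y r0" for w
    using holo_has_partial[OF F inU[OF that] j]
    by (intro holomorphic_onI) (meson field_differentiable_at_within field_differentiable_def)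
  have yb: "y \<in> box_Cn l y r0" using yext r0(1) box_Cn_self by blast
  have "continuous_on (ball (y j) r0) (deriv (\<lambda>\<zeta>. F (y(j := \<zeta>))))"
    by (intro holomorphic_on_imp_continuous_on holomorphic_deriv hol yb) auto
  then have "isCont (deriv (\<lambda>\<zeta>. F (y(j := \<zeta>)))) (y j)"
    using r0(1) by (simp add: continuous_on_eq_continuous_at)
  then obtain d1 where d1: "d1 > 0"
    "\<And>\<zeta>. dist \<zeta> (y j) < d1 \<Longrightarrow> dist (deriv (\<lambda>\<zeta>. F (y(j := \<zeta>))) \<zeta>) (deriv (\<lambda>\<zeta>. F (y(j := \<zeta>))) (y j)) < e / 2"
    using e unfolding continuous_at_eps_delta by (metis half_gt_zero)
  \<comment> \<open>On a circle of radius \<open>r\<close> this bound becomes \<open>e / 4\<close>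
    for the derivative, which leaves room for the other error \<open>e / 2\<close>.\<close>
  have er: "e * r / 4 > 0" using e r by simp
  have "y(j := \<zeta>) \<in> U" if "\<zeta> \<in> cball (y j) (2 * r)" for \<zeta>
    using that r by (intro inU[OF yb]) auto
  from uniform_near_disc[OF F j this compact_cball er]
  obtain d2 where d2: "d2 > 0"
    "\<And>w \<zeta>. w \<in> box_Cn l y d2 \<Longrightarrow> \<zeta> \<in> cball (y j) (2 * r) \<Longrightarrow> dist (F (w(j := \<zeta>))) (F (y(j := \<zeta>))) < e * r / 4"
    by metis
  define d where "d = min (min d1 d2) r"
  have d: "d > 0" "d \<le> d1" "d \<le> d2" "d \<le> r" using d1 d2 r by (auto simp: d_def)
  show thesis
  proof (rule that[OF d(1)])
    show "box_Cn l y d \<subseteq> U"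
      using box_Cn_mono[of d r0 l y] d r r0 by auto
    fix w assume w: "w \<in> box_Cn l y d"
    have w0: "w \<in> box_Cn l y r0" and w2: "w \<in> box_Cn l y d2"
      using w box_Cn_mono[of d r0 l y] box_Cn_mono[of d d2 l y] d r by auto
    have wj: "dist (w j) (y j) < d" using w j by (auto simp: box_Cn_def)
    let ?g = "\<lambda>\<zeta>. F (w(j := \<zeta>)) - F (y(j := \<zeta>))"
    have sub: "cball (w j) r \<subseteq> cball (y j) (2 * r)" "cball (w j) r \<subseteq> ball (y j) r0"
    proof -
      show "cball (w j) r \<subseteq> cball (y j) (2 * r)"
      proof
        fix x assume "x \<in> cball (w j) r"
        then show "x \<in> cball (y j) (2 * r)"
          using wj d(4) dist_triangle[of "y j" x "w j"] by (simp add: dist_commute)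
      qed
      then show "cball (w j) r \<subseteq> ball (y j) r0" using r(2) by force
    qed
    have holg: "?g holomorphic_on ball (y j) r0"
      by (intro holomorphic_intros hol w0 yb)
    have "norm ((deriv ^^ 1) ?g (w j)) \<le> fact 1 * (e * r / 4) / r ^ 1"
    proof (rule Cauchy_inequality)
      show "?g holomorphic_on ball (w j) r"
        using holg sub(2) by (meson ball_subset_cball holomorphic_on_subset subset_trans)
      show "continuous_on (cball (w j) r) ?g"
        using holg sub(2) holomorphic_on_imp_continuous_on continuous_on_subset by blast
      show "norm (F (w(j := x)) - F (y(j := x))) \<le> e * r / 4" if "norm (w j - x) = r" for x
        using d2(2)[OF w2, of x] sub(1) that by (force simp: dist_norm)
    qed (use r in auto)
    then have 1: "norm (deriv ?g (w j)) \<le> e / 4"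
      using r(1) by simp
    have wjb: "w j \<in> ball (y j) r0" using wj d r by (simp add: dist_commute)
    have fd: "(\<lambda>\<zeta>. F (v(j := \<zeta>))) field_differentiable at (w j)" if "v \<in> box_Cn l y r0" for v
      using hol[OF that] wjb holomorphic_on_imp_differentiable_at open_ball by blast
    have 2: "deriv ?g (w j) = partial j F w - deriv (\<lambda>\<zeta>. F (y(j := \<zeta>))) (w j)"
      unfolding partial_def using fd[OF w0] fd[OF yb] by simp
    have 3: "dist (deriv (\<lambda>\<zeta>. F (y(j := \<zeta>))) (w j)) (partial j F y) < e / 2"
      unfolding partial_def using d1(2) wj d by auto
    show "dist (partial j F w) (partial j F y) < e"
      using 1 2 3 dist_triangle[of "partial j F w" "partial j F y" "deriv (\<lambda>\<zeta>. F (y(j := \<zeta>))) (w j)"] e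
      by (simp add: dist_norm)
  qed
qed

text \<open>The mean value inequality for a slice minus its linear part, whose derivative is small
  on a disc. The bound is uniform in \<open>w\<close>, since the chain rule moves one coordinate
  after the preceding ones have already moved.\<close>

lemma partial_slope:
  assumes F: "holo l U F" and y: "y \<in> U" and j: "j < l" and e: "e > 0"
  obtains d where "d > 0"
    "\<And>w u. w \<in> box_Cn l y d \<Longrightarrow> dist u (y j) < d \<Longrightarrow>
       norm (F (w(j := u)) - F w - partial j F y * (u - w j)) \<le> e * norm (u - w j)"
proof -
  obtain d where d: "d > 0" "box_Cn l y d \<subseteq> U"
    "\<And>w. w \<in> box_Cn l y d \<Longrightarrow> dist (partial j F w) (partial j F y) < e"
    using partial_continuous[OF assms] by metis
  show thesis
  proof (rule that[OF d(1)])
    fix w u assume w: "w \<in> box_Cn l y d" and u: "dist u (y j) < d"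
    let ?f = "\<lambda>\<zeta>. F (w(j := \<zeta>)) - partial j F y * \<zeta>"
    have inb: "w(j := z) \<in> box_Cn l y d" if "z \<in> ball (y j) d" for z
      using box_Cn_fun_upd'[OF w j] that by (simp add: dist_commute)
    have "norm (?f u - ?f (w j)) \<le> e * norm (u - w j)"
    proof (rule field_differentiable_bound)
      show "(?f has_field_derivative partial j F (w(j := z)) - partial j F y) (at z within ball (y j) d)"
        if "z \<in> ball (y j) d" for z
        by (rule DERIV_subset[where s = UNIV])
          (use holo_has_partial[OF F, of w j z] inb[OF that] d(2) j in
            \<open>auto intro!: derivative_eq_intros\<close>)
      show "norm (partial j F (w(j := z)) - partial j F y) \<le> e" if "z \<in> ball (y j) d" for z
        using d(3)[OF inb[OF that]] by (simp add: dist_norm)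
    qed (use u w j in \<open>auto simp: dist_commute box_Cn_def\<close>)
    then show "norm (F (w(j := u)) - F w - partial j F y * (u - w j)) \<le> e * norm (u - w j)"
      by (simp add: algebra_simps)
  qed
qed

text \<open>The increment is telescoped, changing one coordinate at a time.\<close>

lemma holo_chain_rule:
  assumes F: "holo l U F" and U: "\<gamma> s0 \<in> U" and ext: "\<And>s. \<gamma> s \<in> extensional {..<l}"
    and der: "\<And>i. i < l \<Longrightarrow> ((\<lambda>s. \<gamma> s i) has_field_derivative \<gamma>' i) (at s0)"
  shows "((\<lambda>s. F (\<gamma> s)) has_field_derivative (\<Sum>i<l. partial i F (\<gamma> s0) * \<gamma>' i)) (at s0)"
proof -
  define m where "m k s = (\<lambda>i. if i < k then \<gamma> s i else \<gamma> s0 i)" for k :: nat and s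
  have m0: "m 0 s = \<gamma> s0" for s by (simp add: m_def)
  have ml: "m l s = \<gamma> s" for s
    using ext[of s] ext[of s0] by (auto simp: m_def extensional_def)
  have mSuc: "m (Suc k) s = (m k s)(k := \<gamma> s k)" for k s
    by (auto simp: m_def)
  have tele: "F (\<gamma> s) = F (\<gamma> s0) + (\<Sum>k<l. F (m (Suc k) s) - F (m k s))" for s
    using sum_lessThan_telescope[of "\<lambda>k. F (m k s)" l] by (simp add: m0 ml)
  have ms0: "m k s0 = \<gamma> s0" for k by (auto simp: m_def)
  have cont: "isCont (\<lambda>s. \<gamma> s i) s0" if "i < l" for i
    using der[OF that] DERIV_isCont by blast
  have near: "\<forall>\<^sub>F s in nhds s0. (\<forall>i<l. dist (\<gamma> s i) (\<gamma> s0 i) < d)" if "d > 0" for d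
  proof -
    have "\<forall>\<^sub>F s in nhds s0. \<forall>i\<in>{..<l}. dist (\<gamma> s i) (\<gamma> s0 i) < d"
    proof (intro eventually_ball_finite ballI)
      fix i assume "i \<in> {..<l}"
      then have "((\<lambda>s. \<gamma> s i) \<longlongrightarrow> \<gamma> s0 i) (nhds s0)"
        using cont[of i] tendsto_at_iff_tendsto_nhds[of "\<lambda>s. \<gamma> s i" s0] by (simp add: isCont_def)
      then show "\<forall>\<^sub>F s in nhds s0. dist (\<gamma> s i) (\<gamma> s0 i) < d"
        using that by (rule tendstoD)
    qed simp
    then show ?thesis by (simp add: Ball_def)
  qed
  have one: "((\<lambda>s. F (m (Suc k) s) - F (m k s)) has_field_derivative partial k F (\<gamma> s0) * \<gamma>' k) (at s0)"
    if k: "k < l" for k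
  proof -
    obtain g where g: "\<And>z. \<gamma> z k - \<gamma> s0 k = g z * (z - s0)" "isCont g s0" "g s0 = \<gamma>' k"
      using der[OF k] unfolding CARAT_DERIV by blast
    define c where "c = partial k F (\<gamma> s0)"
    define D where "D s = F (m (Suc k) s) - F (m k s)" for s
    \<comment> \<open>A difference quotient in Caratheodory form. The coordinate may return to its
      initial value at some \<open>s\<close> other than \<open>s0\<close>; there the quotient is
      filled in with its limit \<open>c\<close>, which is harmless because \<open>D s\<close>
      vanishes too.\<close>
    define A where "A s = (if \<gamma> s k = \<gamma> s0 k then c else D s / (\<gamma> s k - \<gamma> s0 k))" for s
    have mk: "m k s k = \<gamma> s0 k" for s by (simp add: m_def)
    have D: "D s = A s * (\<gamma> s k - \<gamma> s0 k)" for s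
    proof (cases "\<gamma> s k = \<gamma> s0 k")
      case True
      then have "m (Suc k) s = m k s" unfolding mSuc using mk[of s] by (metis fun_upd_triv)
      then show ?thesis using True by (simp add: D_def)
    qed (simp add: A_def)
    have "isCont A s0"
      unfolding isCont_def tendsto_at_iff_tendsto_nhds
    proof (rule tendstoI)
      fix e :: real assume e: "e > 0"
      obtain d where d: "d > 0"
        "\<And>w u. w \<in> box_Cn l (\<gamma> s0) d \<Longrightarrow> dist u (\<gamma> s0 k) < d \<Longrightarrow>
           norm (F (w(k := u)) - F w - c * (u - w k)) \<le> e / 2 * norm (u - w k)"
        using partial_slope[OF F U k, of "e / 2"] e unfolding c_def by (metis half_gt_zero)
      show "\<forall>\<^sub>F s in nhds s0. dist (A s) (A s0) < e"
        using near[OF d(1)]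
      proof eventually_elim
        case (elim s)
        have "m k s \<in> box_Cn l (\<gamma> s0) d"
          using elim ext[of s] ext[of s0] d(1) by (auto simp: box_Cn_def m_def extensional_def)
        then have b: "norm (D s - c * (\<gamma> s k - \<gamma> s0 k)) \<le> e / 2 * norm (\<gamma> s k - \<gamma> s0 k)"
          using d(2)[of "m k s" "\<gamma> s k"] elim k by (simp add: D_def mSuc mk)
        show ?case
        proof (cases "\<gamma> s k = \<gamma> s0 k")
          case False
          have "norm (A s - c) * norm (\<gamma> s k - \<gamma> s0 k) \<le> e / 2 * norm (\<gamma> s k - \<gamma> s0 k)"
            using b by (simp add: D norm_mult[symmetric] algebra_simps)
          then have "norm (A s - c) \<le> e / 2"
            using False by (simp add: mult_le_cancel_right)
          then show ?thesis using e by (simp add: A_def dist_norm)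
        qed (use e in \<open>simp add: A_def\<close>)
      qed
    qed
    then have "isCont (\<lambda>s. A s * g s) s0" using g(2) by (intro continuous_intros)
    moreover have "D z - D s0 = A z * g z * (z - s0)" for z
      by (simp add: D g(1))
    moreover have "A s0 * g s0 = c * \<gamma>' k" by (simp add: A_def g(3))
    ultimately show ?thesis
      unfolding CARAT_DERIV D_def c_def by (intro exI[of _ "\<lambda>s. A s * g s"]) auto
  qed
  have "((\<lambda>s. F (\<gamma> s0) + (\<Sum>k<l. F (m (Suc k) s) - F (m k s))) has_field_derivative
      0 + (\<Sum>i<l. partial i F (\<gamma> s0) * \<gamma>' i)) (at s0)"
    by (intro DERIV_add DERIV_const DERIV_sum one) simp
  moreover have "(\<lambda>s. F (\<gamma> s0) + (\<Sum>k<l. F (m (Suc k) s) - F (m k s))) = (\<lambda>s. F (\<gamma> s))"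
    by (rule HOL.ext, rule sym, rule tele)
  ultimately show ?thesis by simp
qed

section \<open>Closure properties of holomorphic functions\<close>

lemma holo_mono: "holo l U F \<Longrightarrow> openin (Cn l) V \<Longrightarrow> V \<subseteq> U \<Longrightarrow> holo l V F"
  unfolding holo_def
  by (metis continuous_map_from_subtopology_mono in_mono)

lemma holo_cong_on:
  assumes "holo l U F" "\<And>y. y \<in> U \<Longrightarrow> F y = G y"
  shows "holo l U G"
  unfolding holo_def
proof (intro conjI ballI allI impI)
  show o: "openin (Cn l) U" using assms holo_open by blast
  show "continuous_map (subtopology (Cn l) U) euclidean G"
    using assms unfolding holo_def by (auto intro: continuous_map_eq)
  fix y j assume y: "y \<in> U" "j < l"
  then obtain r where r: "r > 0" "box_Cn l y r \<subseteq> U" using o openin_Cn_iff by blast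
  have yb: "y \<in> box_Cn l y r"
    using holo_subset_ext[OF assms(1)] y r box_Cn_self by blast
  have "F (y(j := t)) = G (y(j := t))" if "t \<in> ball (y j) r" for t
    using assms(2) r(2) box_Cn_fun_upd'[OF yb y(2), of t] that by (auto simp: dist_commute)
  moreover have "(\<lambda>t. F (y(j := t))) field_differentiable at (y j)"
    using assms(1) y unfolding holo_def by blast
  ultimately show "(\<lambda>t. G (y(j := t))) field_differentiable at (y j)"
    using r(1) unfolding field_differentiable_def
    by (meson has_field_derivative_transform_within_open centre_in_ball open_ball)
qed

lemma holo_const [intro]: "openin (Cn l) U \<Longrightarrow> holo l U (\<lambda>y. c)"
  by (auto simp: holo_def)

lemma holo_coord [intro]:
  assumes "openin (Cn l) U" "i < l"
  shows "holo l U (\<lambda>y. y i)"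
  unfolding holo_def
proof (intro conjI ballI allI impI)
  show "continuous_map (subtopology (Cn l) U) euclidean (\<lambda>y. y i)"
    using assms unfolding Cn_def
    by (intro continuous_map_from_subtopology) (auto intro: continuous_map_product_projection)
  show "(\<lambda>t. (y(j := t)) i) field_differentiable at (y j)" for y j
    by (cases "i = j") auto
qed (use assms in auto)

lemma holo_add [intro]: "holo l U F \<Longrightarrow> holo l U G \<Longrightarrow> holo l U (\<lambda>y. F y + G y)"
  unfolding holo_def by (auto intro!: continuous_map_add field_differentiable_add)

lemma holo_diff [intro]: "holo l U F \<Longrightarrow> holo l U G \<Longrightarrow> holo l U (\<lambda>y. F y - G y)"
  unfolding holo_def by (auto intro!: continuous_map_diff field_differentiable_diff)

lemma holo_mult [intro]: "holo l U F \<Longrightarrow> holo l U G \<Longrightarrow> holo l U (\<lambda>y. F y * G y)"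
  unfolding holo_def by (auto intro!: field_differentiable_mult simp: continuous_map_atin tendsto_mult)

lemma holo_inverse [intro]:
  assumes "holo l U F" "\<And>y. y \<in> U \<Longrightarrow> F y \<noteq> 0"
  shows "holo l U (\<lambda>y. inverse (F y))"
  unfolding holo_def
proof (intro conjI ballI allI impI)
  show "openin (Cn l) U" using assms holo_open by blast
  show "continuous_map (subtopology (Cn l) U) euclidean (\<lambda>y. inverse (F y))"
    using assms by (auto simp: holo_def continuous_map_atin tendsto_inverse)
  show "(\<lambda>t. inverse (F (y(j := t)))) field_differentiable at (y j)" if "y \<in> U" "j < l" for y j
    using assms that unfolding holo_def by (intro field_differentiable_inverse) auto
qed

lemma holo_divide [intro]:
  "holo l U F \<Longrightarrow> holo l U G \<Longrightarrow> (\<And>y. y \<in> U \<Longrightarrow> G y \<noteq> 0) \<Longrightarrow> holo l U (\<lambda>y. F y / G y)"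
  unfolding divide_inverse by (intro holo_mult holo_inverse)

lemma holo_power [intro]: "holo l U F \<Longrightarrow> holo l U (\<lambda>y. F y ^ k)"
  by (induction k) (auto intro: holo_open)

lemma holo_prod:
  assumes "openin (Cn l) U" "\<And>i. i \<in> I \<Longrightarrow> holo l U (F i)"
  shows "holo l U (\<lambda>y. \<Prod>i\<in>I. F i y)"
  using assms(2) by (induction I rule: infinite_finite_induct) (auto intro: assms(1))

lemma openin_holo_nonzero:
  assumes "holo l U F"
  shows "openin (Cn l) {y \<in> U. F y \<noteq> 0}"
proof -
  have U: "openin (Cn l) U" using assms holo_open by blast
  have "openin (subtopology (Cn l) U) {y \<in> topspace (subtopology (Cn l) U). F y \<in> - {0}}"
    by (rule openin_continuous_map_preimage[of _ euclidean]) (use assms in \<open>auto simp: holo_def\<close>)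
  then have "openin (Cn l) {y \<in> topspace (subtopology (Cn l) U). F y \<in> - {0}}"
    using U openin_trans_full by blast
  moreover have "{y \<in> topspace (subtopology (Cn l) U). F y \<in> - {0}} = {y \<in> U. F y \<noteq> 0}"
    using openin_subset[OF U] by auto
  ultimately show ?thesis by simp
qed

section \<open>Independence of the order from the chart\<close>

lemma topspace_P1 [simp]: "topspace P1 = UNIV"
  by (auto simp: P1_def) (metis notin_range_Some)

lemma openin_P1_iff:
  "openin P1 W \<longleftrightarrow> (\<exists>U. open U \<and> W = Some ` U) \<or> (\<exists>K. compact K \<and> W = insert None (Some ` (- K)))"
  unfolding P1_def openin_Alexandroff_compactification
  by (auto simp: compact_imp_closed Compl_eq_Diff_UNIV)

lemma Hausdorff_space_P1: "Hausdorff_space P1"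
  unfolding P1_def
  by (simp add: Hausdorff_space_Alexandroff_compactification locally_compact_space_euclidean)

lemma continuous_map_the_P1:
  assumes F: "continuous_map X P1 F" and nN: "\<And>x. x \<in> topspace X \<Longrightarrow> F x \<noteq> None"
  shows "continuous_map X euclidean (\<lambda>x. the (F x))"
  unfolding continuous_map_def
proof (intro conjI allI impI)
  fix U :: "complex set" assume "openin euclidean U"
  then have "openin P1 (Some ` U)" by (auto simp: openin_P1_iff)
  then have "openin X {x \<in> topspace X. F x \<in> Some ` U}"
    using F openin_continuous_map_preimage by blast
  moreover have "{x \<in> topspace X. F x \<in> Some ` U} = {x \<in> topspace X. the (F x) \<in> U}"
    using nN by force
  ultimately show "openin X {x \<in> topspace X. the (F x) \<in> U}" by simp
qed auto

lemma openin_P1_not_None: "openin P1 {p. p \<noteq> None}"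
  unfolding openin_P1_iff by (intro disjI1 exI[of _ UNIV]) (auto simp: image_iff)

lemma continuous_map_proj_pt:
  assumes N: "continuous_map X euclidean N" and D: "continuous_map X euclidean D"
    and nz: "\<And>x. x \<in> topspace X \<Longrightarrow> N x \<noteq> 0 \<or> D x \<noteq> 0"
  shows "continuous_map X P1 (\<lambda>x. proj_pt (N x) (D x))"
  unfolding continuous_map_def
proof (intro conjI allI impI)
  fix W assume "openin P1 W"
  define X' where "X' = subtopology X {x \<in> topspace X. D x \<noteq> 0}"
  have oD: "openin X {x \<in> topspace X. D x \<noteq> 0}"
    using openin_continuous_map_preimage[OF D, of "- {0}"] by auto
  have q: "continuous_map X' euclidean (\<lambda>x. N x / D x)"
  proof -
    have "continuous_map X' euclidean N" "continuous_map X' euclidean D"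
      using N D unfolding X'_def by (auto intro: continuous_map_from_subtopology)
    moreover have "D x \<noteq> 0" if "x \<in> topspace X'" for x using that by (simp add: X'_def)
    ultimately show ?thesis by (auto simp: continuous_map_atin intro!: tendsto_divide)
  qed
  have pre: "openin X {x \<in> topspace X. D x \<noteq> 0 \<and> N x / D x \<in> U}" if "open U" for U
  proof -
    have "openin X' {x \<in> topspace X'. N x / D x \<in> U}"
      using openin_continuous_map_preimage[OF q] that by auto
    then have "openin X {x \<in> topspace X'. N x / D x \<in> U}"
      unfolding X'_def using oD openin_trans_full by blast
    moreover have "{x \<in> topspace X'. N x / D x \<in> U} = {x \<in> topspace X. D x \<noteq> 0 \<and> N x / D x \<in> U}"
      by (auto simp: X'_def)
    ultimately show ?thesis by simp
  qed
  from \<open>openin P1 W\<close> consider U where "open U" "W = Some ` U"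
    | K where "compact K" "W = insert None (Some ` (- K))"
    unfolding openin_P1_iff by blast
  then show "openin X {x \<in> topspace X. proj_pt (N x) (D x) \<in> W}"
  proof cases
    case 1
    then have "{x \<in> topspace X. proj_pt (N x) (D x) \<in> W} = {x \<in> topspace X. D x \<noteq> 0 \<and> N x / D x \<in> U}"
      by (auto simp: proj_pt_def)
    then show ?thesis using pre[OF 1(1)] by simp
  next
    case 2
    obtain B where B: "B > 0" "\<And>z. z \<in> K \<Longrightarrow> norm z \<le> B"
      using compact_imp_bounded[OF 2(1)] unfolding bounded_pos by blast
    \<comment> \<open>A division-free way to say that the quotient is large: it holds at the zeros
      of \<open>D\<close>, where \<open>N\<close> is non-zero, and elsewhere forces the quotient out
      of \<open>K\<close>. Together with the finite values outside \<open>K\<close> it gives the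
      whole preimage.\<close>
    have "openin X {x \<in> topspace X. norm (N x) - B * norm (D x) \<in> {0<..}}"
      by (rule openin_continuous_map_preimage[of _ euclideanreal])
        (use N D in \<open>auto simp: continuous_map_atin intro!: tendsto_intros\<close>)
    moreover have "openin X {x \<in> topspace X. D x \<noteq> 0 \<and> N x / D x \<in> - K}"
      using 2(1) by (intro pre) (auto simp: compact_imp_closed open_Compl)
    ultimately have "openin X ({x \<in> topspace X. norm (N x) - B * norm (D x) \<in> {0<..}} \<union>
        {x \<in> topspace X. D x \<noteq> 0 \<and> N x / D x \<in> - K})"
      by (rule openin_Un)
    moreover have "{x \<in> topspace X. norm (N x) - B * norm (D x) \<in> {0<..}} \<union>
        {x \<in> topspace X. D x \<noteq> 0 \<and> N x / D x \<in> - K} = {x \<in> topspace X. proj_pt (N x) (D x) \<in> W}"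
    proof (rule Set.set_eqI)
      fix x
      show "x \<in> {x \<in> topspace X. norm (N x) - B * norm (D x) \<in> {0<..}} \<union>
          {x \<in> topspace X. D x \<noteq> 0 \<and> N x / D x \<in> - K} \<longleftrightarrow>
        x \<in> {x \<in> topspace X. proj_pt (N x) (D x) \<in> W}"
      proof (cases "x \<in> topspace X \<and> D x \<noteq> 0")
        case True
        then have "N x / D x \<notin> K" if "norm (N x) > B * norm (D x)"
          using that B(2)[of "N x / D x"] by (auto simp: norm_divide divide_le_eq)
        then show ?thesis using True 2(2) by (auto simp: proj_pt_def)
      next
        case False
        then show ?thesis using 2(2) nz[of x] by (auto simp: proj_pt_def)
      qed
    qed
    ultimately show ?thesis by simp
  qed
qed auto

lemma holo_P1_proj_pt:
  assumes N: "holo l U N" and D: "holo l U D" and nz: "\<And>y. y \<in> U \<Longrightarrow> N y \<noteq> 0 \<or> D y \<noteq> 0"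
  shows "holo_P1 l U (\<lambda>y. proj_pt (N y) (D y))"
  unfolding holo_P1_def
proof (intro conjI)
  show "continuous_map (subtopology (Cn l) U) P1 (\<lambda>y. proj_pt (N y) (D y))"
    using assms by (intro continuous_map_proj_pt) (auto simp: holo_def)
  have *: "{y \<in> U. proj_pt (N y) (D y) \<noteq> None} = {y \<in> U. D y \<noteq> 0}"
    "{y \<in> U. proj_pt (N y) (D y) \<noteq> Some 0} = {y \<in> U. N y \<noteq> 0}"
    using nz by (auto simp: proj_pt_def)
  have oD: "openin (Cn l) {y \<in> U. D y \<noteq> 0}" and oN: "openin (Cn l) {y \<in> U. N y \<noteq> 0}"
    using openin_holo_nonzero N D by auto
  have "holo l {y \<in> U. D y \<noteq> 0} (\<lambda>y. N y / D y)"
    using holo_mono[OF N oD] holo_mono[OF D oD] by (intro holo_divide) auto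
  then show "holo l {y \<in> U. proj_pt (N y) (D y) \<noteq> None} (\<lambda>y. the (proj_pt (N y) (D y)))"
    unfolding * by (rule holo_cong_on) (simp add: proj_pt_def)
  have "holo l {y \<in> U. N y \<noteq> 0} (\<lambda>y. D y / N y)"
    using holo_mono[OF N oN] holo_mono[OF D oN] by (intro holo_divide) auto
  then show "holo l {y \<in> U. proj_pt (N y) (D y) \<noteq> Some 0} (\<lambda>y. the (pinv (proj_pt (N y) (D y))))"
    unfolding * by (rule holo_cong_on) (auto simp: proj_pt_def)
qed

section \<open>Partial derivatives and top forms under a change of coordinates\<close>

lemma partial_cong:
  assumes U: "openin (Cn l) U" "y \<in> U" "j < l" and eq: "\<And>w. w \<in> U \<Longrightarrow> F w = G w"
  shows "partial j F y = partial j G y"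
proof -
  obtain r where r: "r > 0" "box_Cn l y r \<subseteq> U" using U openin_Cn_iff by blast
  have yb: "y \<in> box_Cn l y r"
    using U r openin_Cn_iff box_Cn_self by blast
  have "\<forall>\<^sub>F t in nhds (y j). F (y(j := t)) = G (y(j := t))"
    unfolding eventually_nhds_metric
    using r eq box_Cn_fun_upd'[OF yb U(3)] by blast
  then show ?thesis unfolding partial_def by (intro deriv_cong_ev) auto
qed

text \<open>Stated with the existence of the derivative, because the continuity of the composite
  along a coordinate line is also drawn from it.\<close>

lemma partial_chain:
  assumes \<tau>: "\<And>i. i < l \<Longrightarrow> holo l U (\<lambda>y. \<tau> y i)" and ext: "\<And>y. \<tau> y \<in> extensional {..<l}"
    and F: "holo l W F" and y: "y \<in> U" "\<tau> y \<in> W" and j: "j < l"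
  shows "((\<lambda>t. F (\<tau> (y(j := t)))) has_field_derivative
           (\<Sum>i<l. partial i F (\<tau> y) * partial j (\<lambda>y'. \<tau> y' i) y)) (at (y j))"
proof -
  have d: "((\<lambda>t. \<tau> (y(j := t)) i) has_field_derivative partial j (\<lambda>y'. \<tau> y' i) y) (at (y j))" if "i < l" for i
    using holo_has_partial[OF \<tau>[OF that], of y j "y j"] y j by simp
  show ?thesis
    using holo_chain_rule[OF F, of "\<lambda>t. \<tau> (y(j := t))" "y j", OF _ ext d] y by simp
qed

lemma partial_compose:
  assumes \<tau>: "\<And>i. i < l \<Longrightarrow> holo l U (\<lambda>y. \<tau> y i)" and ext: "\<And>y. \<tau> y \<in> extensional {..<l}"
    and F: "holo l W F" and y: "y \<in> U" "\<tau> y \<in> W" and j: "j < l"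
  shows "partial j (\<lambda>y'. F (\<tau> y')) y = (\<Sum>i<l. partial i F (\<tau> y) * partial j (\<lambda>y'. \<tau> y' i) y)"
  unfolding partial_def[of j "\<lambda>y'. F (\<tau> y')"]
  by (rule DERIV_imp_deriv, rule partial_chain) (use assms in auto)

text \<open>Lets the Jacobian of a transition map converge along a line transverse to the
  divisor.\<close>

lemma isCont_partial_line:
  assumes F: "holo l U F" and y: "y \<in> U" and j: "j < l" and k: "k < l"
  shows "isCont (\<lambda>t. partial k F (y(j := t))) (y j)"
  unfolding continuous_at_eps_delta
proof (intro allI impI)
  fix e :: real assume e: "e > 0"
  obtain d where d: "d > 0" "box_Cn l y d \<subseteq> U"
    "\<And>w. w \<in> box_Cn l y d \<Longrightarrow> dist (partial k F w) (partial k F y) < e"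
    using partial_continuous[OF F y k e] by metis
  have "y \<in> box_Cn l y d" using holo_subset_ext[OF F] y d box_Cn_self by blast
  then have "y(j := t) \<in> box_Cn l y d" if "dist t (y j) < d" for t
    using box_Cn_fun_upd' j that by blast
  then show "\<exists>d>0. \<forall>x'. dist x' (y j) < d \<longrightarrow>
      dist (partial k F (y(j := x'))) (partial k F (y(j := y j))) < e"
    using d by (intro exI[of _ d]) auto
qed

lemma tendsto_det:
  fixes f :: "'b \<Rightarrow> nat \<Rightarrow> nat \<Rightarrow> complex"
  assumes "\<And>i j. i < l \<Longrightarrow> j < l \<Longrightarrow> ((\<lambda>s. f s i j) \<longlongrightarrow> g i j) A"
  shows "((\<lambda>s. Determinant.det (Matrix.mat l l (\<lambda>(i, j). f s i j))) \<longlongrightarrow>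
           Determinant.det (Matrix.mat l l (\<lambda>(i, j). g i j))) A"
proof -
  have eq: "Determinant.det (Matrix.mat l l (\<lambda>(i, j). h i j)) =
     (\<Sum> p \<in> {p. p permutes {0 ..< l}}. signof p * (\<Prod> i = 0 ..< l. h i (p i)))" for h :: "nat \<Rightarrow> nat \<Rightarrow> complex"
    by (subst det_def'[of _ l])
      (auto intro!: sum.cong prod.cong dest: permutes_in_image)
  show ?thesis
    unfolding eq
    by (intro tendsto_sum tendsto_mult tendsto_const tendsto_prod assms)
      (auto dest: permutes_in_image)
qed

lemma det_zero_row:
  fixes A :: "complex mat"
  assumes A: "A \<in> carrier_mat l l" and "i < l" "\<And>j. j < l \<Longrightarrow> A $$ (i, j) = 0"
  shows "Determinant.det A = 0"
  unfolding det_def'[OF A]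
proof (intro sum.neutral ballI)
  fix p assume "p \<in> {p. p permutes {0..<l}}"
  then have "p i < l" using assms(2) permutes_in_image[of p "{0..<l}" i] by auto
  then have "(\<Prod>i = 0..<l. A $$ (i, p i)) = 0"
    using assms by (intro prod_zero bexI[of _ i]) auto
  then show "signof p * (\<Prod>i = 0..<l. A $$ (i, p i)) = 0" by simp
qed

text \<open>A positive exponent forces the limit 0; a negative one reduces to this case by taking
  inverses, as the limit is non-zero.\<close>

lemma powi_limit_nonzero:
  assumes lim: "((\<lambda>s::complex. s powi k) \<longlongrightarrow> L) (at 0)" and L: "L \<noteq> 0"
  shows "k = 0"
proof -
  have pos: False if "((\<lambda>s::complex. s powi j) \<longlongrightarrow> M) (at 0)" "M \<noteq> 0" "j > 0" for j M
  proof -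
    have "((\<lambda>s::complex. s ^ nat j) \<longlongrightarrow> 0 ^ nat j) (at 0)"
      by (intro tendsto_intros)
    then have "((\<lambda>s::complex. s powi j) \<longlongrightarrow> 0) (at 0)"
      using that(3) by (simp add: power_int_def zero_power)
    then show False using that tendsto_unique[of "at (0::complex)"] by force
  qed
  have "((\<lambda>s::complex. inverse (s powi k)) \<longlongrightarrow> inverse L) (at 0)"
    using lim L by (rule tendsto_inverse)
  then have "((\<lambda>s::complex. s powi (- k)) \<longlongrightarrow> inverse L) (at 0)"
    by (simp add: power_int_minus)
  then show ?thesis
    using pos[of k L] pos[of "- k" "inverse L"] lim L by (cases k "0 :: int" rule: linorder_cases) auto
qed

text \<open>The chain rule factors the matrix of partial derivatives, and determinants multiply.
  Holomorphy of the functions in the form is asked on \<open>W\<close> only, since they may have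
  poles along the divisor; \<open>W\<close> will be the part of the chart off it.\<close>

lemma pullback_change_of_chart:
  assumes \<tau>: "\<And>i. i < l \<Longrightarrow> holo l U (\<lambda>y. \<tau> y i)" and ext: "\<And>y. \<tau> y \<in> extensional {..<l}"
    and eq: "\<And>y. y \<in> U \<Longrightarrow> \<phi> y = \<psi> (\<tau> y)"
    and g: "\<And>i. i < l \<Longrightarrow> holo l W (\<lambda>w. snd \<eta> (Suc i) (\<psi> w))"
    and y: "y \<in> U" "\<tau> y \<in> W" and U: "openin (Cn l) U"
  shows "pullback_coeff l \<phi> \<eta> y = pullback_coeff l \<psi> \<eta> (\<tau> y) *
    Determinant.det (Matrix.mat l l (\<lambda>(i, j). partial j (\<lambda>y'. \<tau> y' i) y))"
proof -
  let ?A = "Matrix.mat l l (\<lambda>(i, j). partial j (\<lambda>w. snd \<eta> (Suc i) (\<psi> w)) (\<tau> y))"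
  let ?T = "Matrix.mat l l (\<lambda>(i, j). partial j (\<lambda>y'. \<tau> y' i) y)"
  have "partial j (\<lambda>y'. snd \<eta> (Suc i) (\<phi> y')) y =
      (\<Sum>k<l. partial k (\<lambda>w. snd \<eta> (Suc i) (\<psi> w)) (\<tau> y) * partial j (\<lambda>y'. \<tau> y' k) y)"
    if "i < l" "j < l" for i j
  proof -
    have "partial j (\<lambda>y'. snd \<eta> (Suc i) (\<phi> y')) y = partial j (\<lambda>y'. snd \<eta> (Suc i) (\<psi> (\<tau> y'))) y"
      by (rule partial_cong[OF U y(1) that(2)]) (simp add: eq)
    also have "\<dots> = (\<Sum>k<l. partial k (\<lambda>w. snd \<eta> (Suc i) (\<psi> w)) (\<tau> y) * partial j (\<lambda>y'. \<tau> y' k) y)"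
      by (rule partial_compose[OF \<tau> ext g[OF that(1)] y that(2)])
    finally show ?thesis .
  qed
  then have "Matrix.mat l l (\<lambda>(i, j). partial j (\<lambda>y'. snd \<eta> (Suc i) (\<phi> y')) y) = ?A * ?T"
    by (intro eq_matI) (auto simp: scalar_prod_def atLeast0LessThan)
  then show ?thesis
    using det_mult[of ?A l ?T] by (simp add: pullback_coeff_def eq[OF y(1)])
qed

text \<open>Both expressions of the form are restricted to a line transverse to the divisor at a
  common point. They differ by the Jacobian of the transition, by units, and by a power of the ratio
  of the two defining coordinates. All of these have non-zero limits, hence so does
  \<open>s powi (m' - m)\<close>.\<close>

lemma order_unique:
  assumes l: "0 < l"
    and \<psi>: "adapted_chart l D V \<psi>" and H: "holo l V H" "\<And>y. y \<in> V \<Longrightarrow> H y \<noteq> 0"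
    and pb\<psi>: "\<And>y. y \<in> V \<Longrightarrow> y 0 \<noteq> 0 \<Longrightarrow> pullback_coeff l \<psi> \<eta> y = y 0 powi m * H y"
    and Q: "\<And>j. j < l \<Longrightarrow> Q j \<in> quads (l + 3)"
    and coords: "\<And>j y. j < l \<Longrightarrow> y \<in> V \<Longrightarrow> \<psi> y (Q j) = Some (y j)"
    and g: "\<And>i. i < l \<Longrightarrow> holo l {y \<in> V. y 0 \<noteq> 0} (\<lambda>w. snd \<eta> (Suc i) (\<psi> w))"
    and \<phi>: "adapted_chart l D U \<phi>" and h: "holo l U h" "\<And>y. y \<in> U \<Longrightarrow> h y \<noteq> 0"
    and pb\<phi>: "\<And>y. y \<in> U \<Longrightarrow> y 0 \<noteq> 0 \<Longrightarrow> pullback_coeff l \<phi> \<eta> y = y 0 powi m' * h y"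
    and meet: "q \<in> D" "q \<in> \<phi> ` U" "q \<in> \<psi> ` V"
  shows "m' = m"
proof -
  have chart\<phi>: "chart l U \<phi>" and chart\<psi>: "chart l V \<psi>"
    using \<phi> \<psi> unfolding adapted_chart_def by auto
  have oU: "openin (Cn l) U" and oV: "openin (Cn l) V"
    using chart\<phi> chart\<psi> unfolding chart_def by auto
  have o\<psi>V: "openin (M0bar (l + 3)) (\<psi> ` V)" using chart\<psi> unfolding chart_def by auto
  have extV: "V \<subseteq> extensional {..<l}" using oV openin_Cn_iff by blast
  have extU: "U \<subseteq> extensional {..<l}" using oU openin_Cn_iff by blast
  have D\<phi>: "\<phi> y \<in> D \<longleftrightarrow> y 0 = 0" if "y \<in> U" for y using \<phi> that unfolding adapted_chart_def by simp
  have D\<psi>: "\<psi> y \<in> D \<longleftrightarrow> y 0 = 0" if "y \<in> V" for y using \<psi> that unfolding adapted_chart_def by simp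
  obtain a where a: "a \<in> U" "\<phi> a = q" "a 0 = 0" using meet(1,2) D\<phi> by auto
  obtain v where v: "v \<in> V" "\<psi> v = q" "v 0 = 0" using meet(1,3) D\<psi> by auto
  define U' where "U' = {y \<in> U. \<phi> y \<in> \<psi> ` V}"
  \<comment> \<open>The coordinates of \<open>\<psi>\<close> are components of the point itself, so
    the transition map reads them off at the quadruples \<open>Q j\<close>; it is holomorphic
    because the components of \<open>\<phi>\<close> are.\<close>
  define \<tau> where "\<tau> y = (\<lambda>j\<in>{..<l}. the (\<phi> y (Q j)))" for y
  have \<tau>ext: "\<tau> y \<in> extensional {..<l}" for y by (simp add: \<tau>_def)
  have aU': "a \<in> U'" using a(1,2) meet(3) by (simp add: U'_def)
  have oU': "openin (Cn l) U'"
  proof -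
    have "continuous_map (subtopology (Cn l) U) (M0bar (l + 3)) \<phi>"
    proof -
      have "homeomorphic_map (subtopology (Cn l) U) (subtopology (M0bar (l + 3)) (\<phi> ` U)) \<phi>"
        using chart\<phi> by (simp add: chart_def)
      then show ?thesis
        using homeomorphic_imp_continuous_map continuous_map_in_subtopology by metis
    qed
    then have "openin (subtopology (Cn l) U) {y \<in> topspace (subtopology (Cn l) U). \<phi> y \<in> \<psi> ` V}"
      using o\<psi>V openin_continuous_map_preimage by blast
    then have "openin (Cn l) {y \<in> topspace (subtopology (Cn l) U). \<phi> y \<in> \<psi> ` V}"
      using oU openin_trans_full by blast
    moreover have "{y \<in> topspace (subtopology (Cn l) U). \<phi> y \<in> \<psi> ` V} = U'"
      using openin_subset[OF oU] by (auto simp: U'_def)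
    ultimately show ?thesis by simp
  qed
  have \<tau>\<psi>: "\<tau> y = w" if "\<phi> y = \<psi> w" "w \<in> V" for y w
  proof
    show "\<tau> y x = w x" for x
      using that coords[of x w] extV by (cases "x < l") (auto simp: \<tau>_def extensional_def)
  qed
  have \<tau>V: "\<tau> y \<in> V" and \<phi>\<tau>: "\<phi> y = \<psi> (\<tau> y)" if "y \<in> U'" for y
    using that \<tau>\<psi>[of y] by (auto simp: U'_def)
  have \<tau>a: "\<tau> a = v" using \<tau>\<psi> a v by simp
  have \<tau>hol: "holo l U' (\<lambda>y. \<tau> y i)" if i: "i < l" for i
  proof -
    have "holo l {y \<in> U. \<phi> y (Q i) \<noteq> None} (\<lambda>y. the (\<phi> y (Q i)))"
      using chart\<phi> Q[OF i] unfolding chart_def holo_P1_def by blast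
    moreover have "U' \<subseteq> {y \<in> U. \<phi> y (Q i) \<noteq> None}"
      using coords[OF i] by (auto simp: U'_def)
    ultimately have "holo l U' (\<lambda>y. the (\<phi> y (Q i)))"
      using oU' holo_mono by blast
    then show ?thesis by (rule holo_cong_on) (simp add: \<tau>_def i)
  qed
  have \<tau>0: "\<tau> y 0 = 0 \<longleftrightarrow> y 0 = 0" if y: "y \<in> U'" for y
    using \<tau>V[OF y] \<phi>\<tau>[OF y] D\<phi>[of y] D\<psi>[of "\<tau> y"] y by (simp add: U'_def)
  define T where "T y = Matrix.mat l l (\<lambda>(i, j). partial j (\<lambda>y'. \<tau> y' i) y)" for y
  have T: "T y \<in> carrier_mat l l" for y by (simp add: T_def)
  \<comment> \<open>the immersion property of the second chart makes the Jacobian of the transition invertible\<close>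
  have detT: "Determinant.det (T a) \<noteq> 0"
  proof
    assume "Determinant.det (T a) = 0"
    then obtain x where x: "x \<in> carrier_vec l" "x \<noteq> 0\<^sub>v l" "T a *\<^sub>v x = 0\<^sub>v l"
      using det_0_iff_vec_prod_zero[OF T] by blast
    have Tx: "(\<Sum>k<l. x $ k * partial k (\<lambda>y'. \<tau> y' i) a) = 0" if "i < l" for i
    proof -
      have "(T a *\<^sub>v x) $ i = 0" using x(3) that by simp
      then show ?thesis
        using that x(1) by (simp add: T_def scalar_prod_def atLeast0LessThan mult.commute)
    qed
    have "(\<Sum>k<l. x $ k * partial k (\<lambda>y'. affine_coord (\<phi> a R) (\<phi> y' R)) a) = 0"
      if R: "R \<in> quads (l + 3)" for R
    proof -
      define G where "G w = affine_coord (\<phi> a R) (\<psi> w R)" for w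
      \<comment> \<open>The domain of the affine coordinate chosen at \<open>\<phi> a R\<close>:
        around infinity the value 0 has to be avoided, otherwise the value infinity.\<close>
      define W where "W = (if \<phi> a R = None then {w \<in> V. \<psi> w R \<noteq> Some 0} else {w \<in> V. \<psi> w R \<noteq> None})"
      have G: "holo l W G"
        using chart\<psi> R unfolding chart_def holo_P1_def G_def W_def affine_coord_def by auto
      have W: "\<tau> a \<in> W" using v a by (auto simp: W_def \<tau>a)
      have "partial k (\<lambda>y'. affine_coord (\<phi> a R) (\<phi> y' R)) a =
          (\<Sum>i<l. partial i G (\<tau> a) * partial k (\<lambda>y'. \<tau> y' i) a)" if k: "k < l" for k
      proof -
        have "partial k (\<lambda>y'. affine_coord (\<phi> a R) (\<phi> y' R)) a = partial k (\<lambda>y'. G (\<tau> y')) a"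
          by (rule partial_cong[OF oU' aU' k]) (simp add: G_def \<phi>\<tau>)
        also have "\<dots> = (\<Sum>i<l. partial i G (\<tau> a) * partial k (\<lambda>y'. \<tau> y' i) a)"
          by (rule partial_compose[OF \<tau>hol \<tau>ext G aU' W k])
        finally show ?thesis .
      qed
      then have "(\<Sum>k<l. x $ k * partial k (\<lambda>y'. affine_coord (\<phi> a R) (\<phi> y' R)) a) =
          (\<Sum>k<l. \<Sum>i<l. x $ k * (partial i G (\<tau> a) * partial k (\<lambda>y'. \<tau> y' i) a))"
        by (simp add: sum_distrib_left)
      also have "\<dots> = (\<Sum>i<l. partial i G (\<tau> a) * (\<Sum>k<l. x $ k * partial k (\<lambda>y'. \<tau> y' i) a))"
        by (subst sum.swap) (simp add: sum_distrib_left mult.left_commute)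
      also have "\<dots> = 0" using Tx by simp
      finally show ?thesis .
    qed
    then have "\<forall>k<l. x $ k = 0"
      using chart\<phi> a(1) unfolding chart_def by blast
    then show False using x(1,2) by (auto intro: eq_vecI)
  qed
  \<comment> \<open>The transition preserves the divisor, so its component 0 vanishes along
    \<open>y 0 = 0\<close> and has zero tangential derivatives there. Row 0 of the invertible matrix
    \<open>T a\<close> then leaves only column 0, which makes \<open>c\<close> non-zero.\<close>
  have row: "partial k (\<lambda>y'. \<tau> y' 0) a = 0" if k: "0 < k" "k < l" for k
  proof -
    obtain r where r: "r > 0" "box_Cn l a r \<subseteq> U'"
      using oU' aU' openin_Cn_iff by blast
    have ab: "a \<in> box_Cn l a r" using a(1) extU r(1) box_Cn_self by blast
    have "\<forall>\<^sub>F t in nhds (a k). \<tau> (a(k := t)) 0 = (\<lambda>t. 0) t"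
      unfolding eventually_nhds_metric
    proof (intro exI[of _ r] conjI allI impI)
      fix t assume "dist t (a k) < r"
      then have "a(k := t) \<in> U'" using box_Cn_fun_upd'[OF ab k(2)] r(2) by blast
      then show "\<tau> (a(k := t)) 0 = 0" using \<tau>0 k a(3) by simp
    qed (rule r)
    then have "deriv (\<lambda>t. \<tau> (a(k := t)) 0) (a k) = deriv (\<lambda>t. 0) (a k)"
      by (rule deriv_cong_ev) simp
    then show ?thesis by (simp add: partial_def)
  qed
  define c where "c = partial 0 (\<lambda>y'. \<tau> y' 0) a"
  have c: "c \<noteq> 0"
  proof
    assume "c = 0"
    then have "T a $$ (0, j) = 0" if "j < l" for j
      using row[of j] that l by (cases "j = 0") (auto simp: T_def c_def)
    then show False using det_zero_row[OF T l] detT by blast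
  qed
  define L where "L s = a(0 := s)" for s
  have L0: "L 0 = a" using a(3) by (auto simp: L_def)
  have Ls: "L s 0 = s" for s by (simp add: L_def)
  have evU': "\<forall>\<^sub>F s in at 0. L s \<in> U'"
  proof -
    obtain r where r: "r > 0" "box_Cn l a r \<subseteq> U'"
      using oU' aU' openin_Cn_iff by blast
    have ab: "a \<in> box_Cn l a r" using a(1) extU r(1) box_Cn_self by blast
    show ?thesis
      unfolding eventually_at L_def
      using box_Cn_fun_upd'[OF ab l] r a(3) by (intro exI[of _ r]) auto
  qed
  have cont: "isCont (\<lambda>s. F (L s)) 0" if "holo l U' F" for F
    using holo_has_partial[OF that, of a 0 0] aU' a(3) l DERIV_isCont
    unfolding L_def by (metis fun_upd_triv)
  have limh: "((\<lambda>s. h (L s)) \<longlongrightarrow> h a) (at 0)"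
    using cont[OF holo_mono[OF h(1) oU']] L0 by (auto simp: isCont_def U'_def)
  have limH: "((\<lambda>s. H (\<tau> (L s))) \<longlongrightarrow> H v) (at 0)"
  proof -
    have "isCont (\<lambda>t. H (\<tau> (a(0 := t)))) (a 0)"
      using partial_chain[OF \<tau>hol \<tau>ext H(1) aU' _ l] v(1) \<tau>a DERIV_isCont by blast
    then show ?thesis
      using L0 a(3) \<tau>a unfolding isCont_def L_def by simp
  qed
  have limT: "((\<lambda>s. Determinant.det (T (L s))) \<longlongrightarrow> Determinant.det (T a)) (at 0)"
    unfolding T_def
  proof (rule tendsto_det)
    fix i j assume "i < l" "j < l"
    then have "isCont (\<lambda>t. partial j (\<lambda>y'. \<tau> y' i) (a(0 := t))) (a 0)"
      using isCont_partial_line[OF \<tau>hol aU' l] by blast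
    then show "((\<lambda>s. partial j (\<lambda>y'. \<tau> y' i) (L s)) \<longlongrightarrow> partial j (\<lambda>y'. \<tau> y' i) a) (at 0)"
      using L0 a(3) unfolding isCont_def L_def by simp
  qed
  have lim\<tau>: "((\<lambda>s. \<tau> (L s) 0 / s) \<longlongrightarrow> c) (at 0)"
  proof -
    have "((\<lambda>s. \<tau> (a(0 := s)) 0) has_field_derivative c) (at (a 0))"
      using holo_has_partial[OF \<tau>hol[OF l], of a 0 "a 0"] aU' l by (simp add: c_def)
    then show ?thesis
      using \<tau>0[OF aU'] a(3) L0 unfolding has_field_derivative_iff L_def by simp
  qed
  have "((\<lambda>s. (\<tau> (L s) 0 / s) powi m * H (\<tau> (L s)) * Determinant.det (T (L s)) / h (L s))
      \<longlongrightarrow> c powi m * H v * Determinant.det (T a) / h a) (at 0)"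
    using h(2)[OF a(1)] c by (intro tendsto_intros lim\<tau> limH limT limh) auto
  moreover have "\<forall>\<^sub>F s in at 0. (\<tau> (L s) 0 / s) powi m * H (\<tau> (L s)) * Determinant.det (T (L s)) / h (L s)
      = s powi (m' - m)"
    using evU' eventually_neq_at_within[of 0]
  proof eventually_elim
    case (elim s)
    then have y: "L s \<in> U'" and s: "s \<noteq> 0" by auto
    have w: "\<tau> (L s) \<in> {y \<in> V. y 0 \<noteq> 0}" using \<tau>V[OF y] \<tau>0[OF y] s Ls by auto
    have "pullback_coeff l \<phi> \<eta> (L s) = pullback_coeff l \<psi> \<eta> (\<tau> (L s)) * Determinant.det (T (L s))"
      unfolding T_def by (rule pullback_change_of_chart[OF \<tau>hol \<tau>ext \<phi>\<tau> g y w oU'])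
    then have "s powi m' * h (L s) = \<tau> (L s) 0 powi m * H (\<tau> (L s)) * Determinant.det (T (L s))"
      using pb\<phi>[of "L s"] pb\<psi>[of "\<tau> (L s)"] y w s Ls by (auto simp: U'_def)
    moreover have "h (L s) \<noteq> 0" using h(2) y by (auto simp: U'_def)
    ultimately have "\<tau> (L s) 0 powi m * H (\<tau> (L s)) * Determinant.det (T (L s)) / h (L s) = s powi m'"
      by (simp add: field_simps)
    then show ?case
      using s by (simp add: power_int_divide_distrib power_int_diff field_simps)
  qed
  ultimately have "((\<lambda>s. s powi (m' - m)) \<longlongrightarrow> c powi m * H v * Determinant.det (T a) / h a) (at 0)"
    by (rule Lim_transform_eventually)
  then have "m' - m = 0"
    by (rule powi_limit_nonzero) (use c H(2)[OF v(1)] detT h(2)[OF a(1)] in auto)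
  then show ?thesis by simp
qed

section \<open>The smoothing chart along a boundary divisor\<close>

lemma cross_ratio_swap: "cross_ratio p q r s = cross_ratio q p s r"
  by (simp add: cross_ratio_def mult.commute)

text \<open>Exchanging the points within both pairs preserves the cross-ratio and turns its third
  argument into the fourth, for which the Moebius form is known.\<close>

lemma cross_ratio_third_moebius:
  assumes "p \<noteq> b" "p \<noteq> q" "b \<noteq> q"
  obtains A B C E where "A * E - B * C \<noteq> 0" "\<And>x. cross_ratio p b x q = moebius_map A B C E x"
    "moebius_map A B C E p = Some 0" "moebius_map A B C E b = None" "moebius_map A B C E q = Some 1"
proof -
  obtain A B C E where *: "A * E - B * C \<noteq> 0" "\<And>x. cross_ratio b p q x = moebius_map A B C E x"
    using cross_ratio_eq_moebius[of b p q] assms by metis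
  then show thesis
    using cross_ratio_degenerate[of b p q] assms
    by (intro that[of A E B C]) (auto simp: cross_ratio_swap[of p])
qed

lemma moebius_eq_iff:
  assumes "a * d - b * c \<noteq> 0"
  shows "moebius_map a b c d x = moebius_map a b c d y \<longleftrightarrow> x = y"
  using moebius_inverse[OF assms] by metis

lemma nodal_point_cong:
  assumes "\<And>i. i \<in> {1..n} \<Longrightarrow> i \<in> S \<Longrightarrow> a i = a' i" "\<And>i. i \<in> {1..n} \<Longrightarrow> i \<notin> S \<Longrightarrow> b i = b' i"
  shows "nodal_point n S a s b t = nodal_point n S a' s b' t"
proof -
  have "(if i \<in> S then a i else s) = (if i \<in> S then a' i else s)"
    "(if i \<in> S then t else b i) = (if i \<in> S then t else b' i)" if "i \<in> {1..n}" for i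
    using assms[OF that] by auto
  then show ?thesis
    unfolding nodal_point_def Let_def by (intro restrict_ext) (auto simp: quads_def)
qed

text \<open>Each component of a nodal curve has its own group of automorphisms, so the two can be
  normalised independently.\<close>

lemma nodal_point_moebius:
  assumes "A * E - B * C \<noteq> 0" "A' * E' - B' * C' \<noteq> 0"
  defines "g \<equiv> moebius_map A B C E" and "h \<equiv> moebius_map A' B' C' E'"
  shows "nodal_point n S (\<lambda>i. g (a i)) (g s) (\<lambda>i. h (b i)) (h t) = nodal_point n S a s b t"
proof -
  have "(if i \<in> S then g (a i) else g s) = g (if i \<in> S then a i else s)"
    "(if i \<in> S then h t else h (b i)) = h (if i \<in> S then t else b i)" for i
    by auto
  then show ?thesis
    unfolding nodal_point_def Let_def g_def h_def
    using cross_ratio_moebius[OF assms(1)] cross_ratio_moebius[OF assms(2)] by (simp only:)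
qed

text \<open>Two of the labels 1, 2, 3 lie in \<open>S2\<close>. With \<open>{b, p, q} = {1, 2, 3}\<close> and \<open>b\<close>, \<open>q\<close> in \<open>S2\<close>, normalise
  \<open>z\<^sub>b = \<infinity>\<close>, \<open>z\<^sub>p = 0\<close>, \<open>z\<^sub>q = 1\<close>: all points labelled by \<open>S1\<close> then collide with \<open>z\<^bsub>a1\<^esub>\<close>,
  at the speed given by coordinate 0, which is attached to \<open>a2\<close>.\<close>

locale gauge =
  fixes l n :: nat and S1 S2 :: "nat set" and b p q a1 a2 :: nat and \<sigma> :: "nat \<Rightarrow> nat"
  assumes n: "n = l + 3" and l: "0 < l"
    and S: "S1 \<union> S2 = {1..n}" "S1 \<inter> S2 = {}"
    and bpq: "{b, p, q} = {1, 2, 3}" "b \<noteq> p" "b \<noteq> q" "p \<noteq> q"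
    and bS: "b \<in> S2" and qS: "q \<in> S2"
    and a1: "a1 \<in> S1" and a2: "a2 \<in> S1" and a12: "a1 \<noteq> a2" and pa1: "p \<in> S1 \<Longrightarrow> a1 = p"
    and \<sigma>: "bij_betw \<sigma> {..<l} {4..n}" and \<sigma>0: "\<sigma> 0 = a2"
begin

section \<open>The family of marked points over the smoothing chart\<close>

definition coord :: "(nat \<Rightarrow> complex) \<Rightarrow> nat \<Rightarrow> complex" where
  "coord y k = y (inv_into {..<l} \<sigma> k)"

text \<open>The place where the points of \<open>S1\<close> collide, seen from the component of
  \<open>S2\<close>. If \<open>a1 = p\<close> it is pinned at 0 by the normalisation; otherwise the
  coordinate of \<open>a1\<close> is free to describe it.\<close>

definition node :: "(nat \<Rightarrow> complex) \<Rightarrow> complex" where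
  "node y = (if a1 = p then 0 else coord y a1)"

text \<open>Positions on the component of \<open>S1\<close>, normalised by \<open>a1\<close> at 0,
  \<open>a2\<close> at 1 and the node at infinity.\<close>

definition ecoord :: "(nat \<Rightarrow> complex) \<Rightarrow> nat \<Rightarrow> complex" where
  "ecoord y k = (if k = a1 then 0 else if k = a2 then 1 else coord y k)"

text \<open>The factor \<open>1 - node y\<close> is the difference between \<open>z\<^sub>q\<close>
  and the node. With it, \<open>y 0\<close> is exactly the cross-ratio of \<open>a1\<close>,
  \<open>b\<close>, \<open>a2\<close>, \<open>q\<close> and not just a multiple of it.\<close>

definition fin :: "(nat \<Rightarrow> complex) \<Rightarrow> nat \<Rightarrow> complex" where
  "fin y k = (if k \<in> S1 then node y + y 0 * (1 - node y) * ecoord y k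
     else if k = p then 0 else if k = q then 1 else coord y k)"

definition pt :: "(nat \<Rightarrow> complex) \<Rightarrow> nat \<Rightarrow> proj_line" where
  "pt y k = (if k = b then None else Some (fin y k))"

definition P :: "(nat \<Rightarrow> complex) \<Rightarrow> nat \<Rightarrow> nat \<Rightarrow> complex" where
  "P y i j = pdiff (pt y i) (pt y j)"

text \<open>The difference of two points with the collision factor \<open>y 0\<close> divided out,
  so that it stays meaningful on the divisor.\<close>

definition R :: "(nat \<Rightarrow> complex) \<Rightarrow> nat \<Rightarrow> nat \<Rightarrow> complex" where
  "R y i j = (if i \<in> S1 \<and> j \<in> S1 then (1 - node y) * (ecoord y i - ecoord y j) else P y i j)"

text \<open>Off \<open>y 0 = 0\<close> these conditions say that the marked points are distinct. On
  it they say so for each component including its node: pairs inside \<open>S1\<close> are compared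
  through \<open>ecoord\<close>, and a mixed pair compares the node with a point of
  \<open>S2\<close>.\<close>

definition V :: "(nat \<Rightarrow> complex) set" where
  "V = {y \<in> extensional {..<l}. \<forall>i\<in>{1..n}. \<forall>j\<in>{1..n}. i \<noteq> j \<longrightarrow> R y i j \<noteq> 0}"

definition in1 :: "nat \<Rightarrow> nat" where
  "in1 k = (if k \<in> S1 then 1 else 0)"

text \<open>The exponent is a truncated difference: of \<open>num y i j k m\<close> and \<open>num y i j m k\<close>, only the one with
  more pairs inside \<open>S1\<close> keeps a power of \<open>y 0\<close>, so that they never vanish together on \<open>V\<close>.\<close>

definition num :: "(nat \<Rightarrow> complex) \<Rightarrow> nat \<Rightarrow> nat \<Rightarrow> nat \<Rightarrow> nat \<Rightarrow> complex" where
  "num y i j k m = y 0 ^ (in1 i * in1 k + in1 j * in1 m - (in1 i * in1 m + in1 j * in1 k)) * R y i k * R y j m"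

definition \<psi> :: "(nat \<Rightarrow> complex) \<Rightarrow> mpoint" where
  "\<psi> y = (\<lambda>(i, j, k, m)\<in>quads n. proj_pt (num y i j k m) (num y i j m k))"

text \<open>The quadruples whose cross-ratios are the coordinates: the collision parameter, a
  position on the component of \<open>S1\<close>, or one on that of \<open>S2\<close>. The last case
  includes \<open>a1\<close> when it differs from \<open>p\<close>; the position is then that of the
  node.\<close>

definition Q :: "nat \<Rightarrow> nat \<times> nat \<times> nat \<times> nat" where
  "Q j = (let k = \<sigma> j in if k = a2 then (a1, b, a2, q)
     else if k \<in> S1 \<and> k \<noteq> a1 then (a1, b, k, a2) else (p, b, k, q))"

lemma labels123: "b \<in> {1,2,3}" "p \<in> {1,2,3}" "q \<in> {1,2,3}"
  using bpq(1) by blast+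

lemma a2_range: "a2 \<in> {4..n}"
  using \<sigma> \<sigma>0 l by (auto simp: bij_betw_def)

lemma labels: "b \<in> {1..n}" "p \<in> {1..n}" "q \<in> {1..n}" "a1 \<in> {1..n}" "a2 \<in> {1..n}"
  "b \<notin> S1" "q \<notin> S1" "a1 \<noteq> b" "a1 \<noteq> q" "a2 \<noteq> b" "a2 \<noteq> q" "a2 \<noteq> p"
proof -
  show "a2 \<noteq> p" using a2_range labels123(2) by force
  show "b \<in> {1..n}" "q \<in> {1..n}" "a1 \<in> {1..n}" "a2 \<in> {1..n}"
    unfolding S(1)[symmetric] using bS qS a1 a2 by blast+
  show "b \<notin> S1" "q \<notin> S1" using S(2) bS qS by blast+
  then show "a1 \<noteq> b" "a1 \<noteq> q" "a2 \<noteq> b" "a2 \<noteq> q" using a1 a2 by blast+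
  show "p \<in> {1..n}" using labels123(2) n by force
qed

lemma special_iff: "k \<in> {1..n} \<Longrightarrow> k \<notin> {4..n} \<longleftrightarrow> k = b \<or> k = p \<or> k = q"
proof -
  have "k \<in> {b, p, q} \<longleftrightarrow> k \<in> {1, 2, 3}" using bpq(1) by simp
  then show "k \<in> {1..n} \<Longrightarrow> ?thesis" by auto
qed

lemma \<sigma>_range: "j < l \<Longrightarrow> \<sigma> j \<in> {4..n}"
  using \<sigma> by (auto simp: bij_betw_def)

lemma \<sigma>_eq_iff: "i < l \<Longrightarrow> j < l \<Longrightarrow> \<sigma> i = \<sigma> j \<longleftrightarrow> i = j"
  using \<sigma> by (auto simp: bij_betw_def inj_on_eq_iff)

lemma \<sigma>_ne: "j < l \<Longrightarrow> \<sigma> j \<noteq> b" "j < l \<Longrightarrow> \<sigma> j \<noteq> p" "j < l \<Longrightarrow> \<sigma> j \<noteq> q"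
  using \<sigma>_range[of j] special_iff[of "\<sigma> j"] by auto

lemma \<sigma>_surj: "k \<in> {4..n} \<Longrightarrow> \<exists>j<l. \<sigma> j = k"
  using \<sigma> unfolding bij_betw_def by (metis imageE lessThan_iff)

lemma coord_\<sigma>: "j < l \<Longrightarrow> coord y (\<sigma> j) = y j"
  using \<sigma> by (auto simp: coord_def bij_betw_def inv_into_f_f)

lemma ne: "p \<noteq> b" "q \<noteq> b" "q \<noteq> p"
  using bpq by auto

lemma pt_special: "pt y b = None" "pt y p = Some 0" "pt y q = Some 1"
proof -
  show "pt y b = None" "pt y q = Some 1" by (simp_all add: pt_def fin_def ne labels)
  have "node y = 0" "ecoord y p = 0" if "p \<in> S1"
    unfolding node_def ecoord_def using pa1[OF that] by simp_all
  then show "pt y p = Some 0" by (simp add: ne pt_def fin_def)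
qed

lemma fin_S1: "k \<in> S1 \<Longrightarrow> fin y k = node y + y 0 * (1 - node y) * ecoord y k"
  by (simp add: fin_def)

lemma fin_coord: "k \<notin> S1 \<Longrightarrow> k \<in> {4..n} \<Longrightarrow> fin y k = coord y k"
  using special_iff[of k] by (simp add: fin_def)

lemma P_fin: "i \<noteq> b \<Longrightarrow> j \<noteq> b \<Longrightarrow> P y i j = fin y i - fin y j"
  by (simp add: P_def pt_def)

lemma P_b: "j \<noteq> b \<Longrightarrow> P y b j = 1" "j \<noteq> b \<Longrightarrow> P y j b = - 1"
  by (simp_all add: P_def pt_def pdiff_def)

lemma S1_ne_b: "k \<in> S1 \<Longrightarrow> k \<noteq> b"
  using labels by auto

lemma P_eq_R: "P y i j = y 0 ^ (in1 i * in1 j) * R y i j"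
proof (cases "i \<in> S1 \<and> j \<in> S1")
  case True
  then show ?thesis
    by (simp add: R_def in1_def P_fin S1_ne_b fin_S1 algebra_simps)
qed (auto simp: R_def in1_def)

lemma V_nz: "y \<in> V \<Longrightarrow> i \<in> {1..n} \<Longrightarrow> j \<in> {1..n} \<Longrightarrow> i \<noteq> j \<Longrightarrow> R y i j \<noteq> 0"
  by (auto simp: V_def)

lemma P_nz: "y \<in> V \<Longrightarrow> y 0 \<noteq> 0 \<Longrightarrow> i \<in> {1..n} \<Longrightarrow> j \<in> {1..n} \<Longrightarrow> i \<noteq> j \<Longrightarrow> P y i j \<noteq> 0"
  using V_nz by (simp add: P_eq_R)

lemma fin_p: "fin y p = 0" and fin_q: "fin y q = 1" and fin_a1: "fin y a1 = node y"
  using pt_special[of y] ne a1 by (simp_all add: pt_def fin_S1 ecoord_def)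

lemma node_ne_1: "y \<in> V \<Longrightarrow> node y \<noteq> 1"
  using V_nz[of y a1 q] labels by (auto simp: R_def P_fin ne fin_a1 fin_q)

lemma \<psi>_quad: "(i, j, k, m) \<in> quads n \<Longrightarrow> \<psi> y (i, j, k, m) = proj_pt (num y i j k m) (num y i j m k)"
  by (simp add: \<psi>_def)

lemma quadsD: "(i, j, k, m) \<in> quads n \<Longrightarrow> i \<in> {1..n} \<and> j \<in> {1..n} \<and> k \<in> {1..n} \<and> m \<in> {1..n} \<and>
   i \<noteq> j \<and> i \<noteq> k \<and> i \<noteq> m \<and> j \<noteq> k \<and> j \<noteq> m \<and> k \<noteq> m"
  by (auto simp: quads_def)

text \<open>The two products in the cross-ratio carry the powers \<open>?e\<close> and
  \<open>?f\<close> of \<open>y 0\<close>; cancelling the smaller one leaves the truncated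
  differences in \<open>num\<close>.\<close>

lemma \<psi>_cross_ratio:
  assumes "y 0 \<noteq> 0" "(i, j, k, m) \<in> quads n"
  shows "\<psi> y (i, j, k, m) = cross_ratio (pt y i) (pt y j) (pt y k) (pt y m)"
proof -
  let ?e = "in1 i * in1 k + in1 j * in1 m" and ?f = "in1 i * in1 m + in1 j * in1 k"
  have pw: "y 0 ^ min ?e ?f * y 0 ^ (?e - ?f) = y 0 ^ ?e" "y 0 ^ min ?e ?f * y 0 ^ (?f - ?e) = y 0 ^ ?f"
    by (simp_all add: power_add[symmetric] min_def)
  have "P y i k * P y j m = y 0 ^ ?e * R y i k * R y j m"
    by (simp add: P_eq_R power_add)
  also have "\<dots> = y 0 ^ min ?e ?f * num y i j k m"
    unfolding num_def pw(1)[symmetric] by (simp only: mult.assoc)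
  finally have 1: "P y i k * P y j m = y 0 ^ min ?e ?f * num y i j k m" .
  have "P y i m * P y j k = y 0 ^ ?f * R y i m * R y j k"
    by (simp add: P_eq_R power_add)
  also have "\<dots> = y 0 ^ min ?e ?f * num y i j m k"
    unfolding num_def pw(2)[symmetric] by (simp only: mult.assoc)
  finally have 2: "P y i m * P y j k = y 0 ^ min ?e ?f * num y i j m k" .
  show ?thesis
    using assms unfolding cross_ratio_def P_def[symmetric] 1 2
    by (simp add: \<psi>_quad proj_pt_scale)
qed

lemma \<psi>_eq_cross_ratios:
  assumes "y 0 \<noteq> 0"
  shows "\<psi> y = cross_ratios n (pt y)"
proof (rule HOL.ext, clarify)
  show "\<psi> y (i, j, k, m) = cross_ratios n (pt y) (i, j, k, m)" for i j k m
  proof (cases "(i, j, k, m) \<in> quads n")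
    case True
    then show ?thesis using \<psi>_cross_ratio[of y, OF assms True] by (simp add: cross_ratios_def)
  qed (simp add: \<psi>_def cross_ratios_def)
qed

lemma inj_on_pt: "y \<in> V \<Longrightarrow> y 0 \<noteq> 0 \<Longrightarrow> inj_on (pt y) {1..n}"
  using P_nz unfolding P_def pdiff_eq_0_iff by (meson inj_onI)

lemma \<psi>_M0: "y \<in> V \<Longrightarrow> y 0 \<noteq> 0 \<Longrightarrow> \<psi> y \<in> M0 n"
  unfolding M0_def using \<psi>_eq_cross_ratios inj_on_pt by blast

lemma Q_quads:
  assumes "j < l"
  shows "Q j \<in> quads n"
proof -
  have "\<sigma> j \<in> {1..n}" using \<sigma>_range[OF assms] by simp
  then show ?thesis
    by (simp add: Q_def Let_def quads_def labels(1-5)[simplified] labels(6-12) ne \<sigma>_ne[OF assms] a12 labels(8-12)[THEN not_sym] ne[THEN not_sym] \<sigma>_ne[OF assms, THEN not_sym] a12[symmetric])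
qed

text \<open>With \<open>b\<close> at infinity each of these cross-ratios is a quotient of two
  differences. The computation with \<open>num\<close> remains valid at \<open>y 0 = 0\<close>, so
  the coordinates are recovered on the divisor as well.\<close>

lemma \<psi>_Q:
  assumes j: "j < l" and y: "y \<in> V"
  shows "\<psi> y (Q j) = Some (y j)"
proof -
  have n1: "1 - node y \<noteq> 0" using node_ne_1[OF y] by simp
  let ?k = "\<sigma> j"
  have k: "?k \<noteq> b" "?k \<noteq> p" "?k \<noteq> q" using \<sigma>_ne j by auto
  consider "?k = a2" | "?k \<noteq> a2" "?k \<in> S1" "?k \<noteq> a1" | "?k \<noteq> a2" "?k = a1" | "?k \<notin> S1"
    by blast
  then show ?thesis
  proof cases
    case 1
    then have "j = 0" using \<sigma>0 \<sigma>_eq_iff[OF j l] by simp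
    moreover have "(a1, b, a2, q) \<in> quads n" using Q_quads[OF j] 1 by (simp add: Q_def)
    moreover have "num y a1 b a2 q = y 0 * (node y - 1)" "num y a1 b q a2 = node y - 1"
      by (simp_all add: num_def in1_def R_def P_fin P_b fin_q fin_a1 ecoord_def a1 a2 a12 a12[symmetric] labels ne)
    ultimately show ?thesis
      using 1 n1 by (simp add: Q_def \<psi>_quad proj_pt_def)
  next
    case 2
    then have "(a1, b, ?k, a2) \<in> quads n" using Q_quads[OF j] by (simp add: Q_def)
    moreover have "num y a1 b ?k a2 = (node y - 1) * y j" "num y a1 b a2 ?k = node y - 1"
      using 2 by (simp_all add: left_diff_distrib num_def in1_def R_def P_b ecoord_def coord_\<sigma> j a1 a2 a12 a12[symmetric] labels ne k)
    ultimately show ?thesis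
      using 2 n1 by (simp add: Q_def \<psi>_quad proj_pt_def)
  next
    case 3
    then have "(p, b, ?k, q) \<in> quads n" using Q_quads[OF j] by (simp add: Q_def)
    moreover have "p \<notin> S1" using pa1 3 k by auto
    moreover have "fin y ?k = y j" using 3 k coord_\<sigma>[OF j] by (simp add: fin_a1 node_def)
    ultimately have "(p, b, ?k, q) \<in> quads n" "num y p b ?k q = - y j" "num y p b q ?k = - 1"
      by (simp_all add: num_def in1_def R_def P_fin P_b fin_q fin_p labels ne k)
    then show ?thesis
      using 3 a12 by (simp add: Q_def \<psi>_quad proj_pt_def)
  next
    case 4
    then have "(p, b, ?k, q) \<in> quads n" using Q_quads[OF j] a1 a2 by (auto simp: Q_def Let_def split: if_splits)
    moreover have "fin y ?k = y j" using 4 k coord_\<sigma>[OF j] by (simp add: fin_def)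
    ultimately have "(p, b, ?k, q) \<in> quads n" "num y p b ?k q = - y j" "num y p b q ?k = - 1"
      using 4 by (simp_all add: num_def in1_def R_def P_fin P_b fin_q fin_p labels ne k)
    then show ?thesis
      using 4 a1 a2 by (auto simp: Q_def Let_def \<psi>_quad proj_pt_def)
  qed
qed

text \<open>With three or four labels in \<open>S1\<close> the factors \<open>1 - node y\<close> and
  the differences from the node cancel, leaving the component of \<open>S1\<close>. With two, a
  surviving power of \<open>y 0\<close> or a cancellation gives 0, infinity or 1, as on a nodal
  curve. With fewer, only the component of \<open>S2\<close> is visible.\<close>

lemma \<psi>_nodal:
  assumes y: "y \<in> V" and y0: "y 0 = 0"
  shows "\<psi> y = nodal_point n S1 (\<lambda>k. Some (ecoord y k)) None (pt y) (Some (node y))"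
proof (rule HOL.ext, clarify)
  fix i j k m
  define zz where "zz k = (if k \<in> S1 then Some (ecoord y k) else None)" for k
  define ww where "ww k = (if k \<in> S1 then Some (node y) else pt y k)" for k
  have R1: "R y i j = (1 - node y) * pdiff (zz i) (zz j)" if "i \<in> S1" "j \<in> S1" for i j
    using that by (simp add: R_def zz_def)
  have ptww: "pt y i = ww i" for i
    using y0 by (simp add: ww_def pt_def fin_S1 S1_ne_b)
  have R2: "R y i j = pdiff (ww i) (ww j)" if "i \<notin> S1 \<or> j \<notin> S1" for i j
    using that by (auto simp: R_def P_def ptww)
  have zz: "pdiff (zz i) (zz j) = - 1" "pdiff (zz j) (zz i) = 1" if "i \<in> S1" "j \<notin> S1" for i j
    using that by (auto simp: zz_def pdiff_def)
  have zz0: "pdiff (zz i) (zz j) = 0" if "i \<notin> S1" "j \<notin> S1" for i j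
    using that by (auto simp: zz_def pdiff_def)
  have ww: "ww i = Some (node y)" if "i \<in> S1" for i
    using that by (auto simp: ww_def)
  have n1: "1 - node y \<noteq> 0" using node_ne_1[OF y] by simp
  show "\<psi> y (i, j, k, m) = nodal_point n S1 (\<lambda>k. Some (ecoord y k)) None (pt y) (Some (node y)) (i, j, k, m)"
  proof (cases "(i, j, k, m) \<in> quads n")
    case False
    then show ?thesis by (simp add: \<psi>_def nodal_point_def)
  next
    case True
    note d = quadsD[OF True]
    have nz: "R y i k \<noteq> 0" "R y i m \<noteq> 0" "R y j k \<noteq> 0" "R y j m \<noteq> 0"
      using V_nz[OF y] d by auto
    have card: "2 \<le> card ({i, j, k, m} \<inter> S1) \<longleftrightarrow> 2 \<le> in1 i + in1 j + in1 k + in1 m"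
      using d by (auto simp: in1_def card_insert_if)
    have "proj_pt (num y i j k m) (num y i j m k) =
      (if 2 \<le> in1 i + in1 j + in1 k + in1 m then cross_ratio (zz i) (zz j) (zz k) (zz m)
          else cross_ratio (ww i) (ww j) (ww k) (ww m))"
      using nz y0 n1
      by (cases "i \<in> S1"; cases "j \<in> S1"; cases "k \<in> S1"; cases "m \<in> S1")
        (simp_all add: cross_ratio_def num_def in1_def R1 R2 zz zz0 ww proj_pt_def)
    then show ?thesis
      using True by (simp add: \<psi>_quad card nodal_point_def zz_def ww_def)
  qed
qed

end

lemma cross_ratios_cong:
  "(\<And>i. i \<in> {1..n} \<Longrightarrow> z i = w i) \<Longrightarrow> cross_ratios n z = cross_ratios n w"
  unfolding cross_ratios_def by (intro restrict_ext) (auto simp: quads_def)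

lemma cross_ratios_moebius:
  "a * d - b * c \<noteq> 0 \<Longrightarrow> cross_ratios n (\<lambda>i. moebius_map a b c d (z i)) = cross_ratios n z"
  unfolding cross_ratios_def by (intro restrict_ext) (auto simp: cross_ratio_moebius)

context gauge
begin

section \<open>The smoothing chart covers \<open>M0\<close> and the open stratum\<close>

definition from_labels :: "(nat \<Rightarrow> complex) \<Rightarrow> nat \<Rightarrow> complex" where
  "from_labels f = (\<lambda>j\<in>{..<l}. f (\<sigma> j))"

lemma from_labels_ext: "from_labels f \<in> extensional {..<l}"
  by (simp add: from_labels_def)

lemma coord_from_labels: "k \<in> {4..n} \<Longrightarrow> coord (from_labels f) k = f k"
  using \<sigma>_surj[of k] coord_\<sigma> by (auto simp: from_labels_def)

lemma from_labels_0: "from_labels f 0 = f a2"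
  using l \<sigma>0 by (simp add: from_labels_def)

lemma a1_range: "a1 \<noteq> p \<Longrightarrow> a1 \<in> {4..n}"
  using special_iff[OF labels(4)] labels by auto

lemma S1_range: "k \<in> S1 \<Longrightarrow> k \<noteq> a1 \<Longrightarrow> k \<in> {4..n}"
proof -
  assume k: "k \<in> S1" "k \<noteq> a1"
  then have "k \<in> {1..n}" using S by auto
  moreover have "k \<noteq> b" "k \<noteq> p" "k \<noteq> q" using k labels pa1 by auto
  ultimately show ?thesis using special_iff by blast
qed

lemma M0_in_image:
  assumes "r \<in> M0 n"
  obtains y where "y \<in> V" "y 0 \<noteq> 0" "\<psi> y = r"
proof -
  obtain z where z: "inj_on z {1..n}" "r = cross_ratios n z"
    using assms by (auto simp: M0_def)
  have "z p \<noteq> z b" "z p \<noteq> z q" "z b \<noteq> z q"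
    using z(1) labels bpq by (metis inj_onD)+
  then obtain A B C E where AE: "A * E - B * C \<noteq> 0"
    and m: "moebius_map A B C E (z p) = Some 0" "moebius_map A B C E (z b) = None"
      "moebius_map A B C E (z q) = Some 1"
    by (metis cross_ratio_third_moebius)
  define x where "x k = moebius_map A B C E (z k)" for k
  have x_inj: "x i = x j \<longleftrightarrow> i = j" if "i \<in> {1..n}" "j \<in> {1..n}" for i j
    using that z(1) unfolding x_def moebius_eq_iff[OF AE] by (simp add: inj_on_eq_iff)
  define \<xi> where "\<xi> k = the (x k)" for k
  have x\<xi>: "x k = Some (\<xi> k)" if "k \<in> {1..n}" "k \<noteq> b" for k
    using x_inj[OF that(1) labels(1)] that(2) m(2) by (auto simp: \<xi>_def x_def)
  have \<xi>_inj: "\<xi> i = \<xi> j \<longleftrightarrow> i = j" if "i \<in> {1..n}" "j \<in> {1..n}" "i \<noteq> b" "j \<noteq> b" for i j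
    using x\<xi> x_inj that by (metis option.inject)
  have \<xi>pq: "\<xi> p = 0" "\<xi> q = 1" using m by (simp_all add: \<xi>_def x_def)
  \<comment> \<open>Obtained by solving \<open>fin\<close> for the coordinates; each value is the
    cross-ratio of the corresponding quadruple \<open>Q j\<close>.\<close>
  define y where "y = from_labels (\<lambda>k. if k = a2 then (\<xi> a2 - \<xi> a1) / (1 - \<xi> a1)
    else if k \<in> S1 \<and> k \<noteq> a1 then (\<xi> k - \<xi> a1) / (\<xi> a2 - \<xi> a1) else \<xi> k)"
  have nz: "1 - \<xi> a1 \<noteq> 0" "\<xi> a2 - \<xi> a1 \<noteq> 0"
    using \<xi>_inj[OF labels(3,4) ne(2) labels(8)] \<xi>_inj[OF labels(4,5) labels(8,10)] labels(9) a12 \<xi>pq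
    by auto
  have node: "node y = \<xi> a1"
    unfolding node_def y_def using a1_range \<xi>pq a12 by (auto simp: coord_from_labels)
  have y0: "y 0 = (\<xi> a2 - \<xi> a1) / (1 - \<xi> a1)"
    by (simp add: y_def from_labels_0)
  have fin: "fin y k = \<xi> k" if k: "k \<in> {1..n}" "k \<noteq> b" for k
  proof (cases "k \<in> S1")
    case True
    then have "fin y k = \<xi> a1 + (\<xi> a2 - \<xi> a1) * ecoord y k"
      using nz by (simp add: fin_S1 node y0)
    moreover have "(\<xi> a2 - \<xi> a1) * ecoord y k = \<xi> k - \<xi> a1"
      using True S1_range[OF True] nz by (auto simp: ecoord_def y_def coord_from_labels)
    ultimately show ?thesis by simp
  next
    case False
    then show ?thesis
    proof (cases "k \<in> {4..n}")
      case True
      then show ?thesis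
        using False a1 a2 by (auto simp: fin_coord y_def coord_from_labels)
    next
      case False
      then have "k = p \<or> k = q" using special_iff[OF k(1)] k(2) by blast
      then show ?thesis using \<xi>pq fin_p fin_q by auto
    qed
  qed
  have pt: "pt y k = x k" if "k \<in> {1..n}" for k
    using x\<xi>[OF that] fin[OF that] m(2) by (auto simp: pt_def x_def)
  have "R y i j \<noteq> 0" if "i \<in> {1..n}" "j \<in> {1..n}" "i \<noteq> j" for i j
  proof -
    have "P y i j \<noteq> 0" unfolding P_def pdiff_eq_0_iff using pt x_inj that by simp
    then show ?thesis by (simp add: P_eq_R)
  qed
  then have V: "y \<in> V" unfolding V_def y_def using from_labels_ext by blast
  have y0nz: "y 0 \<noteq> 0" using y0 nz by simp
  have "\<psi> y = cross_ratios n x"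
    unfolding \<psi>_eq_cross_ratios[of y, OF y0nz] using pt by (rule cross_ratios_cong)
  also have "\<dots> = r" unfolding x_def z(2) by (rule cross_ratios_moebius[OF AE])
  finally show thesis using that V y0nz by blast
qed

text \<open>A nodal curve is normalised on both components: at \<open>p\<close>, \<open>b\<close>,
  \<open>q\<close> on one, where the labels of \<open>S1\<close> are represented by the node, and at
  \<open>a1\<close>, \<open>a2\<close> and the node on the other. The three points on the first
  component are distinct because at most \<open>p\<close> among these labels lies in
  \<open>S1\<close>.\<close>

lemma stratum_in_image:
  assumes "r \<in> open_stratum n S1 S2"
  obtains y where "y \<in> V" "y 0 = 0" "\<psi> y = r"
proof -
  obtain a s b' t where r: "r = nodal_point n S1 a s b' t"
    and a: "inj_on a S1" "s \<notin> a ` S1" and b': "inj_on b' S2" "t \<notin> b' ` S2"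
    using assms unfolding open_stratum_def by blast
  define w where "w k = (if k \<in> S1 then t else b' k)" for k
  have w: "w i \<noteq> w j" if "i \<in> {1..n}" "j \<in> {1..n}" "i \<noteq> j" "i \<notin> S1 \<or> j \<notin> S1" for i j
  proof -
    have S2: "k \<in> S2" if "k \<notin> S1" "k \<in> {1..n}" for k using S(1) that by blast
    show ?thesis
    proof (cases "i \<in> S1 \<or> j \<in> S1")
      case True
      then show ?thesis using S2 that(1,2,4) b'(2) unfolding w_def by (metis imageI)
    next
      case False
      then show ?thesis using S2 that(1-3) inj_onD[OF b'(1)] unfolding w_def by metis
    qed
  qed
  have "w p \<noteq> w b" "w p \<noteq> w q" "w b \<noteq> w q"
    using w[OF labels(2,1)] w[OF labels(2,3)] w[OF labels(1,3)] ne bpq(3) labels(6,7) by blast+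
  then obtain A B C E where AE: "A * E - B * C \<noteq> 0"
    and mh: "moebius_map A B C E (w p) = Some 0" "moebius_map A B C E (w b) = None"
      "moebius_map A B C E (w q) = Some 1"
    by (metis cross_ratio_third_moebius)
  have "a a1 \<noteq> s" "s \<noteq> a a2" using a(2) a1 a2 by blast+
  moreover have "a a1 \<noteq> a a2" using inj_onD[OF a(1) _ a1 a2] a12 by blast
  ultimately obtain A' B' C' E' where AE': "A' * E' - B' * C' \<noteq> 0"
    and mg: "moebius_map A' B' C' E' (a a1) = Some 0" "moebius_map A' B' C' E' s = None"
      "moebius_map A' B' C' E' (a a2) = Some 1"
    by (metis cross_ratio_third_moebius)
  define g where "g = moebius_map A' B' C' E'"
  define h where "h = moebius_map A B C E"
  have g_inj: "g x = g x' \<longleftrightarrow> x = x'" for x x' unfolding g_def by (rule moebius_eq_iff[OF AE'])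
  have h_inj: "h x = h x' \<longleftrightarrow> x = x'" for x x' unfolding h_def by (rule moebius_eq_iff[OF AE])
  \<comment> \<open>Coordinate 0 vanishes. Labels of \<open>S1\<close> other than \<open>a1\<close>
    take their position on their own component; all others take it on the component of
    \<open>S2\<close>, where \<open>a1\<close> stands for the node.\<close>
  define y where "y = from_labels (\<lambda>k. if k = a2 then 0
    else if k \<in> S1 \<and> k \<noteq> a1 then the (g (a k)) else the (h (w k)))"
  have y0: "y 0 = 0" by (simp add: y_def from_labels_0)
  have ht: "h t = Some (node y)"
  proof -
    have "w a1 = t" using a1 by (simp add: w_def)
    moreover have "h (w a1) \<noteq> h (w b)"
      unfolding h_inj using w[OF labels(4) labels(1)] labels by auto
    ultimately have "h t \<noteq> None" using mh(2) by (simp add: h_def)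
    moreover have "node y = the (h t)"
    proof (cases "a1 = p")
      case True
      then have "node y = 0" unfolding node_def by simp
      then show ?thesis using True mh(1) \<open>w a1 = t\<close> by (simp add: h_def)
    next
      case False
      then show ?thesis
        using a1_range[OF False] a12 \<open>w a1 = t\<close> by (simp add: node_def y_def coord_from_labels)
    qed
    ultimately show ?thesis by simp
  qed
  have e: "Some (ecoord y k) = g (a k)" if k: "k \<in> S1" for k
  proof -
    consider "k = a1" | "k = a2" | "k \<noteq> a1" "k \<noteq> a2" by blast
    then show ?thesis
    proof cases
      case 3
      have "g (a k) \<noteq> g s" unfolding g_inj using a k by auto
      then have "g (a k) \<noteq> None" using mg(2) by (simp add: g_def)
      then show ?thesis
        using 3 k S1_range[OF k] by (auto simp: ecoord_def y_def coord_from_labels)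
    qed (use mg a12 in \<open>auto simp: ecoord_def g_def\<close>)
  qed
  have pt: "pt y k = h (w k)" if k: "k \<in> {1..n}" for k
  proof -
    consider "k \<in> S1" | "k = b" | "k = p" | "k = q" | "k \<notin> S1" "k \<in> {4..n}"
      using special_iff[OF k] by blast
    then show ?thesis
    proof cases
      case 1
      then show ?thesis using y0 ht S1_ne_b by (simp add: pt_def fin_S1 w_def)
    next
      case 5
      have "k \<noteq> b" using 5(2) special_iff[OF k] by blast
      then have "h (w k) \<noteq> h (w b)" unfolding h_inj using w[OF k labels(1)] labels by auto
      then have "h (w k) \<noteq> None" using mh(2) by (simp add: h_def)
      then show ?thesis
        using 5 \<open>k \<noteq> b\<close> a2 by (auto simp: pt_def fin_coord y_def coord_from_labels)
    qed (use mh pt_special in \<open>auto simp: h_def\<close>)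
  qed
  have n1: "node y \<noteq> 1"
  proof -
    have "h (w a1) \<noteq> h (w q)"
      unfolding h_inj using w[OF labels(4) labels(3)] labels by auto
    then show ?thesis using a1 ht mh(3) by (auto simp: w_def h_def)
  qed
  have "R y i j \<noteq> 0" if ij: "i \<in> {1..n}" "j \<in> {1..n}" "i \<noteq> j" for i j
  proof (cases "i \<in> S1 \<and> j \<in> S1")
    case True
    then have "a i \<noteq> a j" using a(1) ij by (auto simp: inj_on_eq_iff)
    then have "g (a i) \<noteq> g (a j)" using g_inj by blast
    then have "ecoord y i \<noteq> ecoord y j" using e True by metis
    then show ?thesis using n1 True by (simp add: R_def)
  next
    case False
    then have "w i \<noteq> w j" using w ij by blast
    then have "P y i j \<noteq> 0"
      unfolding P_def pdiff_eq_0_iff pt[OF ij(1)] pt[OF ij(2)] h_inj .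
    then show ?thesis using False by (auto simp: R_def)
  qed
  then have V: "y \<in> V" unfolding V_def y_def using from_labels_ext by blast
  have "\<psi> y = nodal_point n S1 (\<lambda>k. Some (ecoord y k)) None (pt y) (Some (node y))"
    by (rule \<psi>_nodal[OF V y0])
  also have "\<dots> = nodal_point n S1 (\<lambda>k. g (a k)) (g s) (\<lambda>k. h (b' k)) (h t)"
    using e pt mg(2) by (subst nodal_point_cong[of n S1 _ "\<lambda>k. g (a k)" "pt y" "\<lambda>k. h (b' k)"])
      (auto simp: w_def ht g_def)
  also have "\<dots> = r"
    unfolding g_def h_def r by (rule nodal_point_moebius[OF AE' AE])
  finally show thesis using that V y0 by blast
qed

lemma \<psi>_stratum:
  assumes y: "y \<in> V" and y0: "y 0 = 0"
  shows "\<psi> y \<in> open_stratum n S1 S2"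
proof -
  have S12: "i \<in> {1..n}" "i \<notin> S2" if "i \<in> S1" for i using S that by auto
  have S2: "i \<in> {1..n}" "i \<notin> S1" if "i \<in> S2" for i using S that by auto
  have n1: "1 - node y \<noteq> 0" using node_ne_1[OF y] by simp
  have ptS1: "pt y a1 = Some (node y)"
    using y0 a1 labels by (simp add: pt_def fin_S1)
  have "inj_on (\<lambda>k. Some (ecoord y k)) S1"
  proof (rule inj_onI)
    fix i j assume ij: "i \<in> S1" "j \<in> S1" "Some (ecoord y i) = Some (ecoord y j)"
    then have "R y i j = 0" by (simp add: R_def)
    then show "i = j" using V_nz[OF y, of i j] S12 ij by blast
  qed
  moreover have "inj_on (pt y) S2"
  proof (rule inj_onI)
    fix i j assume ij: "i \<in> S2" "j \<in> S2" "pt y i = pt y j"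
    then have "R y i j = 0" using S2 by (simp add: R_def P_def pdiff_eq_0_iff)
    then show "i = j" using V_nz[OF y, of i j] S2 ij by blast
  qed
  moreover have "Some (node y) \<noteq> pt y k" if k: "k \<in> S2" for k
  proof -
    have "R y a1 k \<noteq> 0" using V_nz[OF y, of a1 k] S2[OF k] labels a1 by auto
    then show ?thesis using S2[OF k] by (auto simp: R_def P_def pdiff_eq_0_iff ptS1)
  qed
  ultimately show ?thesis
    unfolding open_stratum_def \<psi>_nodal[OF assms] by blast
qed

text \<open>The witness is a nodal curve with its marked points at integers and both nodes at
  infinity. An adapted chart is required to meet its divisor.\<close>

lemma V_meets_stratum: "\<exists>y\<in>V. y 0 = 0"
proof -
  have "inj_on (\<lambda>k. Some (of_nat k :: complex)) S1" "inj_on (\<lambda>k. Some (of_nat k :: complex)) S2"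
    by (auto simp: inj_on_def)
  then have "nodal_point n S1 (\<lambda>k. Some (of_nat k)) None (\<lambda>k. Some (of_nat k)) None \<in> open_stratum n S1 S2"
    unfolding open_stratum_def by blast
  then show ?thesis using stratum_in_image by blast
qed

section \<open>Holomorphy of the smoothing chart\<close>

lemma holo_coord_label: "openin (Cn l) U \<Longrightarrow> k \<in> {4..n} \<Longrightarrow> holo l U (\<lambda>y. coord y k)"
  using \<sigma>_surj[of k] coord_\<sigma> holo_coord by (metis (no_types, lifting) holo_cong_on)

lemma holo_node: "openin (Cn l) U \<Longrightarrow> holo l U node"
proof -
  assume U: "openin (Cn l) U"
  show ?thesis
  proof (cases "a1 = p")
    case True
    then have "node = (\<lambda>y. 0)" unfolding node_def[abs_def] by simp
    then show ?thesis using holo_const[OF U] by simp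
  next
    case False
    then have "node = (\<lambda>y. coord y a1)" unfolding node_def[abs_def] by simp
    then show ?thesis using holo_coord_label[OF U a1_range[OF False]] by simp
  qed
qed

lemma holo_ecoord: "openin (Cn l) U \<Longrightarrow> k \<in> S1 \<Longrightarrow> holo l U (\<lambda>y. ecoord y k)"
  unfolding ecoord_def using S1_range[of k]
  by (cases "k = a1"; cases "k = a2") (simp_all add: holo_coord_label holo_const)

lemma holo_fin:
  assumes U: "openin (Cn l) U" and k: "k \<in> {1..n}" "k \<noteq> b"
  shows "holo l U (\<lambda>y. fin y k)"
proof (cases "k \<in> S1")
  case True
  then show ?thesis
    unfolding fin_S1[OF True]
    by (intro holo_add holo_mult holo_diff holo_const holo_node holo_ecoord holo_coord U l)
next
  case False
  then consider "k = p" | "k = q" | "k \<in> {4..n}" using special_iff[OF k(1)] k(2) by blast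
  then show ?thesis
  proof cases
    case 3
    then show ?thesis using fin_coord[OF False 3] holo_coord_label[OF U 3] by simp
  qed (use fin_p fin_q U in auto)
qed

lemma holo_P:
  assumes U: "openin (Cn l) U" and ij: "i \<in> {1..n}" "j \<in> {1..n}" "i \<noteq> j"
  shows "holo l U (\<lambda>y. P y i j)"
proof -
  consider "i = b" "j \<noteq> b" | "j = b" "i \<noteq> b" | "i \<noteq> b" "j \<noteq> b" using ij by auto
  then show ?thesis
    using holo_fin[OF U ij(1)] holo_fin[OF U ij(2)] U
    by cases (auto simp: P_b P_fin)
qed

lemma holo_R:
  assumes U: "openin (Cn l) U" and ij: "i \<in> {1..n}" "j \<in> {1..n}" "i \<noteq> j"
  shows "holo l U (\<lambda>y. R y i j)"
proof (cases "i \<in> S1 \<and> j \<in> S1")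
  case True
  then show ?thesis
    using U holo_ecoord holo_node by (simp add: R_def holo_mult holo_diff holo_const)
next
  case False
  then have "R y i j = P y i j" for y by (auto simp: R_def)
  then show ?thesis using holo_P[OF assms] by simp
qed

text \<open>Finitely many non-vanishing conditions are a single one for the product of the
  \<open>R y i j\<close>.\<close>

lemma openin_V: "openin (Cn l) V"
proof -
  let ?I = "{(i, j) \<in> {1..n} \<times> {1..n}. i \<noteq> j}"
  have fin: "finite ?I" by (rule finite_subset[of _ "{1..n} \<times> {1..n}"]) auto
  have "openin (Cn l) (extensional {..<l})" using openin_topspace[of "Cn l"] by (simp add: topspace_Cn)
  then have "holo l (extensional {..<l}) (\<lambda>y. \<Prod>x\<in>?I. R y (fst x) (snd x))"
    by (intro holo_prod holo_R) auto
  then have "openin (Cn l) {y \<in> extensional {..<l}. (\<Prod>x\<in>?I. R y (fst x) (snd x)) \<noteq> 0}"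
    by (rule openin_holo_nonzero)
  moreover have "{y \<in> extensional {..<l}. (\<Prod>x\<in>?I. R y (fst x) (snd x)) \<noteq> 0} = V"
  proof -
    have "(\<Prod>x\<in>?I. R y (fst x) (snd x)) \<noteq> 0 \<longleftrightarrow> (\<forall>i\<in>{1..n}. \<forall>j\<in>{1..n}. i \<noteq> j \<longrightarrow> R y i j \<noteq> 0)" for y
      unfolding prod_zero_iff[OF fin] by fastforce
    then show ?thesis by (simp add: V_def)
  qed
  ultimately show ?thesis by simp
qed

lemma holo_num:
  assumes "(i, j, k, m) \<in> quads n"
  shows "holo l V (\<lambda>y. num y i j k m)" "holo l V (\<lambda>y. num y i j m k)"
  unfolding num_def using quadsD[OF assms] openin_V l
  by (intro holo_mult holo_power holo_coord holo_R; simp)+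

lemma num_nonzero:
  assumes "y \<in> V" "(i, j, k, m) \<in> quads n"
  shows "num y i j k m \<noteq> 0 \<or> num y i j m k \<noteq> 0"
proof -
  have "R y i k \<noteq> 0" "R y j m \<noteq> 0" "R y i m \<noteq> 0" "R y j k \<noteq> 0"
    using quadsD[OF assms(2)] V_nz[OF assms(1)] by auto
  then show ?thesis
    using nat_le_linear[of "in1 i * in1 k + in1 j * in1 m" "in1 i * in1 m + in1 j * in1 k"]
    by (auto simp: num_def)
qed

lemma holo_P1_\<psi>:
  assumes "r \<in> quads n"
  shows "holo_P1 l V (\<lambda>y. \<psi> y r)"
proof -
  obtain i j k m where r: "r = (i, j, k, m)" by (cases r)
  then have q: "(i, j, k, m) \<in> quads n" using assms by simp
  show ?thesis
    unfolding r \<psi>_quad[OF q] using holo_num[OF q] num_nonzero[OF _ q] by (rule holo_P1_proj_pt)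
qed

section \<open>The smoothing chart as a homeomorphism onto an open subset of
  \<open>M0bar\<close>\<close>

lemma topspace_ambient: "topspace (M0_ambient n) = extensional (quads n)"
  by (simp add: M0_ambient_def PiE_def)

lemma \<psi>_ext: "\<psi> y \<in> extensional (quads n)"
  by (simp add: \<psi>_def)

lemma continuous_\<psi>: "continuous_map (subtopology (Cn l) V) (M0_ambient n) \<psi>"
  unfolding M0_ambient_def continuous_map_componentwise
  using \<psi>_ext holo_P1_\<psi> by (auto simp: holo_P1_def)

lemma V_ext: "V \<subseteq> extensional {..<l}"
  by (auto simp: V_def)

lemma topspace_M0bar: "topspace (M0bar n) = M0_ambient n closure_of M0 n"
  unfolding M0bar_def using closure_of_subset_topspace[of "M0_ambient n" "M0 n"] by auto

text \<open>A slight move of coordinate 0 alone away from zero leads into \<open>M0\<close>, so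
  points with \<open>y 0 = 0\<close> are limits of points of \<open>M0\<close>.\<close>

lemma \<psi>_in_M0bar:
  assumes y: "y \<in> V"
  shows "\<psi> y \<in> topspace (M0bar n)"
  unfolding topspace_M0bar in_closure_of
proof (intro conjI allI impI)
  show "\<psi> y \<in> topspace (M0_ambient n)" using \<psi>_ext topspace_ambient by simp
  fix W assume W: "\<psi> y \<in> W \<and> openin (M0_ambient n) W"
  have "openin (subtopology (Cn l) V) {x \<in> topspace (subtopology (Cn l) V). \<psi> x \<in> W}"
    using continuous_\<psi> W openin_continuous_map_preimage by blast
  then have "openin (Cn l) {x \<in> topspace (subtopology (Cn l) V). \<psi> x \<in> W}"
    using openin_V openin_trans_full by blast
  moreover have "y \<in> {x \<in> topspace (subtopology (Cn l) V). \<psi> x \<in> W}"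
    using y W V_ext by (auto simp: topspace_Cn)
  ultimately obtain r where r: "r > 0" "box_Cn l y r \<subseteq> {x \<in> topspace (subtopology (Cn l) V). \<psi> x \<in> W}"
    by (meson openin_Cn_iff)
  define t where "t = (if y 0 = 0 then of_real (r / 2) else y 0)"
  have t: "t \<noteq> 0" "dist t (y 0) < r" using r(1) by (auto simp: t_def)
  have "y(0 := t) \<in> box_Cn l y r"
    using y V_ext r(1) by (intro box_Cn_fun_upd' box_Cn_self l t(2)) auto
  then have "y(0 := t) \<in> V" "\<psi> (y(0 := t)) \<in> W" using r(2) by auto
  then show "\<exists>x. x \<in> M0 n \<and> x \<in> W" using \<psi>_M0[of "y(0 := t)"] t(1) by auto
qed

text \<open>The inverse of the chart, written down on the whole ambient product: a projection, hence
  continuous wherever the chosen cross-ratios are finite.\<close>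

definition \<pi> :: "mpoint \<Rightarrow> nat \<Rightarrow> complex" where
  "\<pi> x = (\<lambda>j\<in>{..<l}. the (x (Q j)))"

lemma \<pi>_\<psi>: "y \<in> V \<Longrightarrow> \<pi> (\<psi> y) = y"
  using \<psi>_Q V_ext by (intro HOL.ext) (auto simp: \<pi>_def extensional_def)

definition dom_\<pi> :: "mpoint set" where
  "dom_\<pi> = {x \<in> topspace (M0_ambient n). \<forall>j<l. x (Q j) \<noteq> None}"

lemma continuous_proj: "r \<in> quads n \<Longrightarrow> continuous_map (M0_ambient n) P1 (\<lambda>x. x r)"
  unfolding M0_ambient_def by (rule continuous_map_product_projection)

lemma openin_dom_\<pi>: "openin (M0_ambient n) dom_\<pi>"
proof -
  have "openin (M0_ambient n) {x \<in> topspace (M0_ambient n). x (Q j) \<in> {p. p \<noteq> None}}" if "j < l" for j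
    using openin_continuous_map_preimage[OF continuous_proj[OF Q_quads[OF that]] openin_P1_not_None] .
  then have "openin (M0_ambient n) (\<Inter>j\<in>{..<l}. {x \<in> topspace (M0_ambient n). x (Q j) \<in> {p. p \<noteq> None}})"
    using l by (intro openin_INT2) auto
  moreover have "(\<Inter>j\<in>{..<l}. {x \<in> topspace (M0_ambient n). x (Q j) \<in> {p. p \<noteq> None}}) = dom_\<pi>"
    using l by (auto simp: dom_\<pi>_def)
  ultimately show ?thesis by simp
qed

lemma continuous_\<pi>: "continuous_map (subtopology (M0_ambient n) dom_\<pi>) (Cn l) \<pi>"
  unfolding Cn_def continuous_map_componentwise
proof (intro conjI ballI)
  show "\<pi> ` topspace (subtopology (M0_ambient n) dom_\<pi>) \<subseteq> extensional {..<l}"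
    by (auto simp: \<pi>_def)
  fix j assume "j \<in> {..<l}"
  then have j: "j < l" by simp
  have "continuous_map (subtopology (M0_ambient n) dom_\<pi>) P1 (\<lambda>x. x (Q j))"
    using continuous_proj[OF Q_quads[OF j]] by (rule continuous_map_from_subtopology)
  then have "continuous_map (subtopology (M0_ambient n) dom_\<pi>) euclidean (\<lambda>x. the (x (Q j)))"
    by (rule continuous_map_the_P1) (use j in \<open>auto simp: dom_\<pi>_def\<close>)
  then show "continuous_map (subtopology (M0_ambient n) dom_\<pi>) euclidean (\<lambda>x. \<pi> x j)"
    using j by (simp add: \<pi>_def)
qed

definition nbh :: "mpoint set" where
  "nbh = {x \<in> dom_\<pi>. \<pi> x \<in> V}"

lemma openin_nbh: "openin (M0_ambient n) nbh"
proof -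
  have "openin (subtopology (M0_ambient n) dom_\<pi>) {x \<in> topspace (subtopology (M0_ambient n) dom_\<pi>). \<pi> x \<in> V}"
    using continuous_\<pi> openin_V openin_continuous_map_preimage by blast
  then have "openin (M0_ambient n) {x \<in> topspace (subtopology (M0_ambient n) dom_\<pi>). \<pi> x \<in> V}"
    using openin_dom_\<pi> openin_trans_full by blast
  moreover have "{x \<in> topspace (subtopology (M0_ambient n) dom_\<pi>). \<pi> x \<in> V} = nbh"
    by (auto simp: nbh_def dom_\<pi>_def)
  ultimately show ?thesis by simp
qed

lemma \<psi>_nbh: "y \<in> V \<Longrightarrow> \<psi> y \<in> nbh"
  using \<psi>_ext \<pi>_\<psi> \<psi>_Q topspace_ambient by (auto simp: nbh_def dom_\<pi>_def)

text \<open>Both sides are continuous in \<open>x\<close>, and agree on the dense subset \<open>M0 n\<close>.\<close>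

lemma \<psi>_\<pi>:
  assumes x: "x \<in> nbh" "x \<in> topspace (M0bar n)"
  shows "\<psi> (\<pi> x) = x"
proof -
  let ?X = "subtopology (M0_ambient n) nbh"
  have "x \<in> M0_ambient n closure_of (nbh \<inter> M0 n)"
    using openin_Int_closure_of_subset[OF openin_nbh, of "M0 n"] x topspace_M0bar by blast
  then have cl: "x \<in> ?X closure_of (nbh \<inter> M0 n)"
    using x(1) by (simp add: closure_of_subtopology_subset closure_of_subtopology)
  have "continuous_map ?X (subtopology (Cn l) V) \<pi>"
    unfolding continuous_map_in_subtopology
    using continuous_map_from_subtopology_mono[OF continuous_\<pi>, of nbh] by (auto simp: nbh_def)
  then have "continuous_map ?X (M0_ambient n) (\<psi> \<circ> \<pi>)"
    using continuous_\<psi> continuous_map_compose by blast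
  then have "(\<psi> \<circ> \<pi>) x = id x"
  proof (rule forall_in_closure_of_eq[OF cl, rotated])
    show "continuous_map ?X (M0_ambient n) id"
      by (simp add: continuous_map_from_subtopology)
    show "Hausdorff_space (M0_ambient n)"
      unfolding M0_ambient_def by (simp add: Hausdorff_space_product_topology Hausdorff_space_P1)
    show "(\<psi> \<circ> \<pi>) z = id z" if z: "z \<in> nbh \<inter> M0 n" for z
    proof -
      obtain y where "y \<in> V" "\<psi> y = z" using M0_in_image z by blast
      then show ?thesis using \<pi>_\<psi> by auto
    qed
  qed
  then show ?thesis by simp
qed

text \<open>The image is thereby the trace on \<open>M0bar\<close> of an open subset of the product,
  which is how its openness is obtained.\<close>

lemma image_\<psi>: "\<psi> ` V = topspace (M0bar n) \<inter> nbh"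
proof
  show "\<psi> ` V \<subseteq> topspace (M0bar n) \<inter> nbh" using \<psi>_nbh \<psi>_in_M0bar by blast
  show "topspace (M0bar n) \<inter> nbh \<subseteq> \<psi> ` V"
  proof
    fix x assume "x \<in> topspace (M0bar n) \<inter> nbh"
    then have "x = \<psi> (\<pi> x)" "\<pi> x \<in> V" using \<psi>_\<pi> by (auto simp: nbh_def)
    then show "x \<in> \<psi> ` V" by blast
  qed
qed

lemma openin_image_\<psi>: "openin (M0bar n) (\<psi> ` V)"
  unfolding image_\<psi> using openin_nbh
  by (metis M0bar_def openin_subtopology topspace_M0bar inf_commute)

lemma M0bar_sub: "subtopology (M0bar n) (\<psi> ` V) = subtopology (M0_ambient n) (\<psi> ` V)"
  unfolding M0bar_def subtopology_subtopology
  using image_\<psi> topspace_M0bar by (metis inf.absorb2 inf_le1)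

lemma homeo_\<psi>: "homeomorphic_map (subtopology (Cn l) V) (subtopology (M0bar n) (\<psi> ` V)) \<psi>"
proof -
  have "homeomorphic_maps (subtopology (Cn l) V) (subtopology (M0bar n) (\<psi> ` V)) \<psi> \<pi>"
    unfolding homeomorphic_maps_def M0bar_sub
  proof (intro conjI ballI)
    show "continuous_map (subtopology (Cn l) V) (subtopology (M0_ambient n) (\<psi> ` V)) \<psi>"
      using continuous_\<psi> by (auto simp: continuous_map_in_subtopology)
    have "\<psi> ` V \<subseteq> dom_\<pi>" using \<psi>_nbh by (auto simp: nbh_def)
    then have "continuous_map (subtopology (M0_ambient n) (\<psi> ` V)) (Cn l) \<pi>"
      using continuous_\<pi> continuous_map_from_subtopology_mono by blast
    then show "continuous_map (subtopology (M0_ambient n) (\<psi> ` V)) (subtopology (Cn l) V) \<pi>"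
      using \<pi>_\<psi> by (auto simp: continuous_map_in_subtopology)
  qed (use \<pi>_\<psi> in auto)
  then show ?thesis using homeomorphic_maps_map by blast
qed

lemma chart_\<psi>: "chart l V \<psi>"
  unfolding chart_def n[symmetric]
proof (intro conjI ballI allI impI)
  show "openin (Cn l) V" by (rule openin_V)
  show "openin (M0bar n) (\<psi> ` V)" by (rule openin_image_\<psi>)
  show "homeomorphic_map (subtopology (Cn l) V) (subtopology (M0bar n) (\<psi> ` V)) \<psi>" by (rule homeo_\<psi>)
  show "holo_P1 l V (\<lambda>y. \<psi> y r)" if "r \<in> quads n" for r using that by (rule holo_P1_\<psi>)
  fix y v j
  assume y: "y \<in> V" and j: "j < l"
    and v: "\<forall>r\<in>quads n. (\<Sum>j<l. v j * partial j (\<lambda>y'. affine_coord (\<psi> y r) (\<psi> y' r)) y) = 0"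
  \<comment> \<open>The immersion condition is tested on the quadruple \<open>Q j\<close>, whose
    cross-ratio is coordinate \<open>j\<close> itself; its differential isolates
    \<open>v j\<close>.\<close>
  have "partial i (\<lambda>y'. affine_coord (\<psi> y (Q j)) (\<psi> y' (Q j))) y = (if i = j then 1 else 0)"
    if i: "i < l" for i
  proof -
    have "partial i (\<lambda>y'. affine_coord (\<psi> y (Q j)) (\<psi> y' (Q j))) y = partial i (\<lambda>y'. y' j) y"
      by (rule partial_cong[OF openin_V y i]) (simp add: affine_coord_def \<psi>_Q[OF j y] \<psi>_Q[OF j])
    also have "\<dots> = (if i = j then 1 else 0)"
      by (cases "i = j") (simp_all add: partial_def)
    finally show ?thesis .
  qed
  then have "(\<Sum>i<l. v i * partial i (\<lambda>y'. affine_coord (\<psi> y (Q j)) (\<psi> y' (Q j))) y) =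
      (\<Sum>i<l. if i = j then v i else 0)"
    by (intro sum.cong) auto
  also have "\<dots> = v j" using j by simp
  finally show "v j = 0" using v Q_quads[OF j] by simp
qed

section \<open>The divisor inside the smoothing chart\<close>

lemma stratum_subset: "open_stratum n S1 S2 \<subseteq> \<psi> ` V"
  using stratum_in_image by blast

lemma open_meets_stratum:
  assumes x: "x \<in> boundary_divisor n S1 S2" "x \<in> W" and W: "openin (M0bar n) W"
  obtains r where "r \<in> open_stratum n S1 S2" "r \<in> W"
proof -
  have "\<forall>T. x \<in> T \<and> openin (M0bar n) T \<longrightarrow> (\<exists>r. r \<in> open_stratum n S1 S2 \<and> r \<in> T)"
    using x(1) unfolding boundary_divisor_def in_closure_of by (rule conjunct2)
  from this[rule_format, OF conjI, OF x(2) W] show thesis using that by auto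
qed

text \<open>The cross-ratio at \<open>Q 0\<close> is continuous on the product, equals
  \<open>y 0\<close> on the chart and vanishes on the open stratum; so it vanishes wherever the
  chart meets the closure.\<close>

lemma \<psi>_divisor_iff:
  assumes y: "y \<in> V"
  shows "\<psi> y \<in> boundary_divisor n S1 S2 \<longleftrightarrow> y 0 = 0"
proof
  assume "y 0 = 0"
  then have "\<psi> y \<in> open_stratum n S1 S2" by (rule \<psi>_stratum[OF y])
  moreover have "open_stratum n S1 S2 \<subseteq> topspace (M0bar n)"
    using stratum_subset image_\<psi> by blast
  ultimately show "\<psi> y \<in> boundary_divisor n S1 S2"
    unfolding boundary_divisor_def using closure_of_subset by blast
next
  assume D: "\<psi> y \<in> boundary_divisor n S1 S2"
  show "y 0 = 0"
  proof (rule ccontr)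
    assume nz: "y 0 \<noteq> 0"
    have "closedin P1 {Some 0}"
      using Hausdorff_space_P1 by (simp add: closedin_Hausdorff_sing_eq)
    then have "openin P1 (- {Some 0})" by (simp add: closedin_def Compl_eq_Diff_UNIV)
    then have "openin (M0_ambient n) {x \<in> topspace (M0_ambient n). x (Q 0) \<in> - {Some 0}}"
      using continuous_proj[OF Q_quads[OF l]] openin_continuous_map_preimage by blast
    then have o: "openin (M0bar n) ({x \<in> topspace (M0_ambient n). x (Q 0) \<in> - {Some 0}} \<inter> topspace (M0bar n))"
      unfolding topspace_M0bar by (auto simp: M0bar_def openin_subtopology)
    have "\<psi> y \<in> {x \<in> topspace (M0_ambient n). x (Q 0) \<in> - {Some 0}} \<inter> topspace (M0bar n)"
      using \<psi>_in_M0bar[OF y] \<psi>_Q[OF l y] nz \<psi>_ext topspace_ambient by auto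
    from open_meets_stratum[OF D this o]
    obtain x where x: "x \<in> open_stratum n S1 S2" "x (Q 0) \<noteq> Some 0" by auto
    obtain w where "w \<in> V" "w 0 = 0" "\<psi> w = x" using stratum_in_image[OF x(1)] by blast
    then show False using x(2) \<psi>_Q[OF l] by force
  qed
qed

lemma adapted_chart_\<psi>: "adapted_chart l (boundary_divisor n S1 S2) V \<psi>"
  unfolding adapted_chart_def n[symmetric]
  using chart_\<psi> V_meets_stratum \<psi>_divisor_iff \<psi>_M0 by blast

text \<open>The open stratum is dense in the divisor, so every adapted chart meets it, hence also \<open>\<psi> ` V\<close>.\<close>

lemma adapted_chart_meets:
  assumes "adapted_chart l (boundary_divisor n S1 S2) U \<phi>"
  obtains r where "r \<in> boundary_divisor n S1 S2" "r \<in> \<phi> ` U" "r \<in> \<psi> ` V"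
proof -
  have "\<exists>y\<in>U. y 0 = 0" "\<forall>y\<in>U. \<phi> y \<in> boundary_divisor n S1 S2 \<longleftrightarrow> y 0 = 0"
    and o: "openin (M0bar n) (\<phi> ` U)"
    using assms unfolding adapted_chart_def chart_def n by auto
  then obtain x where x: "\<phi> x \<in> boundary_divisor n S1 S2" "\<phi> x \<in> \<phi> ` U" by blast
  from open_meets_stratum[OF x o]
  obtain r where r: "r \<in> open_stratum n S1 S2" "r \<in> \<phi> ` U" .
  obtain y where y: "y \<in> V" "y 0 = 0" "\<psi> y = r" using stratum_in_image[OF r(1)] by blast
  then have "r \<in> boundary_divisor n S1 S2" using \<psi>_divisor_iff[OF y(1)] by simp
  moreover have "r \<in> \<psi> ` V" using y(1,3) by (metis imageI)
  ultimately show thesis using that r(2) by simp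
qed

text \<open>The smoothing chart witnesses the order, and any other adapted chart is compared with it
  at a common point of the divisor.\<close>

lemma ord_along_eq:
  assumes H: "holo l V H" "\<And>y. y \<in> V \<Longrightarrow> H y \<noteq> 0"
    and pb: "\<And>y. y \<in> V \<Longrightarrow> y 0 \<noteq> 0 \<Longrightarrow> pullback_coeff l \<psi> \<eta> y = y 0 powi m * H y"
    and g: "\<And>i. i < l \<Longrightarrow> holo l {y \<in> V. y 0 \<noteq> 0} (\<lambda>w. snd \<eta> (Suc i) (\<psi> w))"
  shows "ord_along l (boundary_divisor n S1 S2) \<eta> = m"
  unfolding ord_along_def
proof (rule the_equality)
  show "has_order_along l (boundary_divisor n S1 S2) \<eta> m"
    unfolding has_order_along_def
    by (intro exI[of _ V] exI[of _ \<psi>] exI[of _ H] conjI adapted_chart_\<psi> H(1)) (use H(2) pb in simp_all)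
  fix m' assume "has_order_along l (boundary_divisor n S1 S2) \<eta> m'"
  then obtain U \<phi> h where \<phi>: "adapted_chart l (boundary_divisor n S1 S2) U \<phi>" "holo l U h"
    "\<And>y. y \<in> U \<Longrightarrow> h y \<noteq> 0" "\<And>y. y \<in> U \<Longrightarrow> y 0 \<noteq> 0 \<Longrightarrow> pullback_coeff l \<phi> \<eta> y = y 0 powi m' * h y"
    unfolding has_order_along_def by blast
  from adapted_chart_meets[OF \<phi>(1)]
  obtain r where r: "r \<in> boundary_divisor n S1 S2" "r \<in> \<phi> ` U" "r \<in> \<psi> ` V" .
  show "m' = m"
    by (rule order_unique[OF l adapted_chart_\<psi> H pb _ \<psi>_Q g \<phi> r]) (use Q_quads n in auto)
qed

end

section \<open>The Jacobian of the cubical coordinates\<close>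

text \<open>The total weight \<open>\<rho>\<close> of the columns picked by a permutation is the
  same for all permutations, while a non-zero Leibniz term of a permutation other than
  \<open>\<pi>\<close> would make it strictly larger. This treats matrices that are triangular only
  after reordering rows and columns.\<close>

lemma det_dominant_permutation:
  fixes M :: "complex mat" and \<rho> :: "nat \<Rightarrow> nat"
  assumes M: "M \<in> carrier_mat l l" and \<pi>: "\<pi> permutes {0..<l}"
    and nz: "\<And>i j. i < l \<Longrightarrow> j < l \<Longrightarrow> M $$ (i, j) \<noteq> 0 \<Longrightarrow> j = \<pi> i \<or> \<rho> (\<pi> i) < \<rho> j"
  shows "Determinant.det M = signof \<pi> * (\<Prod>i = 0..<l. M $$ (i, \<pi> i))"
proof -
  have "(\<Prod>i = 0..<l. M $$ (i, s i)) = 0" if s: "s permutes {0..<l}" "s \<noteq> \<pi>" for s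
  proof (rule ccontr)
    assume "\<not> ?thesis"
    then have e: "s i = \<pi> i \<or> \<rho> (\<pi> i) < \<rho> (s i)" if "i < l" for i
      using nz[of i "s i"] that permutes_in_image[OF s(1), of i] by auto
    obtain i where i: "s i \<noteq> \<pi> i" using s(2) by blast
    then have "i < l" using s(1) \<pi> unfolding permutes_def by (metis atLeastLessThan_iff zero_le)
    have "(\<Sum>i\<in>{0..<l}. \<rho> (\<pi> i)) < (\<Sum>i\<in>{0..<l}. \<rho> (s i))"
    proof (rule sum_strict_mono_ex1)
      show "\<forall>i\<in>{0..<l}. \<rho> (\<pi> i) \<le> \<rho> (s i)" using e by fastforce
      show "\<exists>i\<in>{0..<l}. \<rho> (\<pi> i) < \<rho> (s i)" using e[OF \<open>i < l\<close>] i \<open>i < l\<close> by auto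
    qed simp
    moreover have "(\<Sum>i\<in>{0..<l}. \<rho> (r i)) = (\<Sum>i\<in>{0..<l}. \<rho> i)" if "r permutes {0..<l}" for r
      using sum.permute[OF that, of \<rho>] by (simp add: o_def)
    ultimately show False using s(1) \<pi> by simp
  qed
  then have "Determinant.det M = (\<Sum>s\<in>{\<pi>}. signof s * (\<Prod>i = 0..<l. M $$ (i, s i)))"
    unfolding det_def'[OF M] by (intro sum.mono_neutral_right) (auto simp: \<pi> finite_permutations)
  then show ?thesis by simp
qed

context gauge
begin

section \<open>Functions that are a power of \<open>y 0\<close> times a unit\<close>

text \<open>The unit has no zeros on all of \<open>V\<close>, so orders add under products and
  change sign under inversion. Values of \<open>F\<close> at \<open>y 0 = 0\<close> are left free,
  as they may be arbitrary where \<open>F\<close> has a pole.\<close>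

definition vord :: "((nat \<Rightarrow> complex) \<Rightarrow> complex) \<Rightarrow> int \<Rightarrow> bool" where
  "vord F m \<longleftrightarrow> (\<exists>h. holo l V h \<and> (\<forall>y\<in>V. h y \<noteq> 0) \<and> (\<forall>y\<in>V. y 0 \<noteq> 0 \<longrightarrow> F y = y 0 powi m * h y))"

lemma vord_const: "c \<noteq> 0 \<Longrightarrow> vord (\<lambda>y. c) 0"
  unfolding vord_def using openin_V by (intro exI[of _ "\<lambda>y. c"]) auto

lemma vord_t: "vord (\<lambda>y. y 0) 1"
  unfolding vord_def using openin_V by (intro exI[of _ "\<lambda>y. 1"]) auto

lemma vord_mult:
  assumes "vord F m" "vord G k"
  shows "vord (\<lambda>y. F y * G y) (m + k)"
proof -
  obtain f g where "holo l V f" "\<forall>y\<in>V. f y \<noteq> 0" "\<forall>y\<in>V. y 0 \<noteq> 0 \<longrightarrow> F y = y 0 powi m * f y"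
    "holo l V g" "\<forall>y\<in>V. g y \<noteq> 0" "\<forall>y\<in>V. y 0 \<noteq> 0 \<longrightarrow> G y = y 0 powi k * g y"
    using assms unfolding vord_def by blast
  then show ?thesis
    unfolding vord_def
    by (intro exI[of _ "\<lambda>y. f y * g y"]) (auto simp: power_int_add)
qed

lemma vord_inverse:
  assumes "vord F m"
  shows "vord (\<lambda>y. inverse (F y)) (- m)"
proof -
  obtain f where "holo l V f" "\<forall>y\<in>V. f y \<noteq> 0" "\<forall>y\<in>V. y 0 \<noteq> 0 \<longrightarrow> F y = y 0 powi m * f y"
    using assms unfolding vord_def by blast
  then show ?thesis
    unfolding vord_def
    by (intro exI[of _ "\<lambda>y. inverse (f y)"]) (auto simp: power_int_minus)
qed

lemma vord_divide: "vord F m \<Longrightarrow> vord G k \<Longrightarrow> vord (\<lambda>y. F y / G y) (m - k)"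
  using vord_mult[OF _ vord_inverse, of F m G k] by (simp add: divide_inverse)

lemma vord_power: "vord F m \<Longrightarrow> vord (\<lambda>y. F y ^ k) (int k * m)"
proof (induction k)
  case 0
  then show ?case using vord_const[of 1] by simp
next
  case (Suc k)
  then show ?case using vord_mult[OF Suc.prems Suc.IH] by (simp add: algebra_simps)
qed

lemma vord_powi: "vord F m \<Longrightarrow> vord (\<lambda>y. F y powi k) (k * m)"
  using vord_power[of F m "nat k"] vord_inverse[OF vord_power[of F m "nat (- k)"]]
  by (cases "k \<ge> 0") (simp_all add: power_int_def power_inverse)

lemma vord_prod:
  assumes "finite I" "\<And>i. i \<in> I \<Longrightarrow> vord (F i) (m i)"
  shows "vord (\<lambda>y. \<Prod>i\<in>I. F i y) (\<Sum>i\<in>I. m i)"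
  using assms by (induction I rule: finite_induct) (auto intro: vord_mult vord_const[of 1, simplified])

lemma vord_cong: "vord F m \<Longrightarrow> (\<And>y. y \<in> V \<Longrightarrow> y 0 \<noteq> 0 \<Longrightarrow> F y = G y) \<Longrightarrow> m = k \<Longrightarrow> vord G k"
  unfolding vord_def by (metis (no_types, lifting))

abbreviation c :: "nat \<Rightarrow> int" where
  "c k \<equiv> int (in1 k)"

text \<open>Two points collide, and then to first order, exactly when both labels lie in
  \<open>S1\<close>; the product of the indicators is 1 in that case only.\<close>

lemma vord_P:
  assumes "i \<in> {1..n}" "j \<in> {1..n}" "i \<noteq> j"
  shows "vord (\<lambda>y. P y i j) (c i * c j)"
  unfolding vord_def
  using holo_R[OF openin_V assms] V_nz[OF _ assms]
  by (intro exI[of _ "\<lambda>y. R y i j"]) (auto simp: P_eq_R simp flip: of_nat_mult)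

lemma nxt_range: "nxt n i \<in> {1..n}"
  using n by (auto simp: nxt_def Suc_le_eq)

lemma nxt_lt: "i < n \<Longrightarrow> nxt n i = i + 1" and nxt_n: "nxt n n = 1"
  by (auto simp: nxt_def)

lemma u_coord_\<psi>:
  assumes "(i, nxt n i, nxt n j, j) \<in> quads n" "y \<in> V" "y 0 \<noteq> 0"
  shows "u_coord n i j (\<psi> y) =
    P y i (nxt n j) * P y (nxt n i) j / (P y i j * P y (nxt n i) (nxt n j))"
  using \<psi>_cross_ratio[of y, OF assms(3,1)] quadsD[OF assms(1)] P_nz[OF assms(2,3)]
  by (simp add: u_coord_def cross_ratio_def proj_pt_def P_def)

lemma vord_u_coord:
  assumes q: "(i, nxt n i, nxt n j, j) \<in> quads n"
  shows "vord (\<lambda>y. u_coord n i j (\<psi> y))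
    (c i * c (nxt n j) + c (nxt n i) * c j - c i * c j - c (nxt n i) * c (nxt n j))"
proof -
  note d = quadsD[OF q]
  have "vord (\<lambda>y. P y i (nxt n j) * P y (nxt n i) j / (P y i j * P y (nxt n i) (nxt n j)))
    ((c i * c (nxt n j) + c (nxt n i) * c j) - (c i * c j + c (nxt n i) * c (nxt n j)))"
    using d by (intro vord_divide vord_mult vord_P) auto
  then show ?thesis
    by (rule vord_cong) (use u_coord_\<psi>[OF q] in auto)
qed

lemma vord_u_monomial:
  "vord (\<lambda>y. u_monomial n \<alpha> (\<psi> y)) (\<Sum>(i, j)\<in>chi n. \<alpha> i j *
    (c i * c (nxt n j) + c (nxt n i) * c j - c i * c j - c (nxt n i) * c (nxt n j)))"
proof -
  have fin: "finite (chi n)"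
    by (rule finite_subset[of _ "{1..n} \<times> {1..n}"]) (auto simp: chi_def)
  have "vord (\<lambda>y. u_coord n (fst x) (snd x) (\<psi> y) powi \<alpha> (fst x) (snd x))
     (\<alpha> (fst x) (snd x) * (c (fst x) * c (nxt n (snd x)) + c (nxt n (fst x)) * c (snd x)
        - c (fst x) * c (snd x) - c (nxt n (fst x)) * c (nxt n (snd x))))" if x: "x \<in> chi n" for x
  proof (rule vord_powi, rule vord_u_coord)
    show "(fst x, nxt n (fst x), nxt n (snd x), snd x) \<in> quads n"
      using x nxt_range by (auto simp: chi_def quads_def)
  qed
  from vord_prod[OF fin this] show ?thesis
    unfolding u_monomial_def by (simp add: case_prod_unfold)
qed

section \<open>Cubical coordinates in the smoothing chart\<close>

text \<open>The position of \<open>z\<^sub>k\<close> in the coordinate with \<open>z\<^sub>3\<close>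
  at 0 and \<open>z\<^sub>2\<close> at infinity. Cubical coordinates are quotients of its values at
  neighbouring labels, so their products telescope.\<close>

definition w :: "(nat \<Rightarrow> complex) \<Rightarrow> nat \<Rightarrow> complex" where
  "w y k = P y 3 k / P y 2 k"

lemma nxt_2: "nxt n 2 = 3"
  using n l by (simp add: nxt_def)

lemma nxt_free: "i < l \<Longrightarrow> nxt n (i + 4) = (if i + 4 = n then 1 else i + 5)"
proof (cases "i + 4 = n")
  case True
  then show ?thesis using nxt_n by metis
next
  case False
  moreover assume "i < l"
  ultimately have "i + 4 < n" using n by simp
  then show ?thesis using nxt_lt[of "i + 4"] False by simp
qed

lemma free_le: "i < l \<Longrightarrow> i + 4 \<le> n" "4 \<le> n"
  using n l by auto

lemma cubical_quad: "i < l \<Longrightarrow> (2, nxt n 2, nxt n (i + 4), i + 4) \<in> quads n"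
  using free_le(1)[of i] by (auto simp: quads_def nxt_2 nxt_free)

lemma cubical_\<psi>:
  assumes i: "i < l" and y: "y \<in> V" "y 0 \<noteq> 0"
  shows "cubical l (Suc i) (\<psi> y) = w y (i + 4) / w y (nxt n (i + 4))"
proof -
  have "cubical l (Suc i) = u_coord n 2 (i + 4)" by (simp add: cubical_def n numeral_eq_Suc)
  then show ?thesis using u_coord_\<psi>[OF cubical_quad[OF i] y] by (simp add: w_def nxt_2)
qed

lemma w_range: "i < l \<Longrightarrow> nxt n (i + 4) \<noteq> 2" "i < l \<Longrightarrow> nxt n (i + 4) \<noteq> 3" "i < l \<Longrightarrow> nxt n (i + 4) \<noteq> i + 4"
  "i < l \<Longrightarrow> i + 4 \<in> {4..n}"
  using free_le by (auto simp: nxt_free)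

lemma w_nz:
  assumes "y \<in> V" "y 0 \<noteq> 0" "k \<in> {1..n}" "k \<noteq> 2" "k \<noteq> 3"
  shows "w y k \<noteq> 0" "P y 2 k \<noteq> 0" "P y 3 k \<noteq> 0"
  using assms P_nz[OF assms(1,2), of 2 k] P_nz[OF assms(1,2), of 3 k] n l by (auto simp: w_def)

lemma vord_w:
  assumes "k \<in> {1..n}" "k \<noteq> 2" "k \<noteq> 3"
  shows "vord (\<lambda>y. w y k) (c 3 * c k - c 2 * c k)"
  unfolding w_def using assms n l by (intro vord_divide vord_P) auto

text \<open>The middle value of \<open>w\<close> cancels in the product of two neighbouring cubical
  coordinates. By the three-term Pluecker relation, 1 minus the remaining quotient is again a
  quotient of products of differences.\<close>

lemma vord_one_minus_product:
  assumes i: "i \<in> {1..<l}"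
  shows "vord (\<lambda>y. 1 - cubical l i (\<psi> y) * cubical l (i + 1) (\<psi> y))
    (c 3 * c 2 + c (nxt n (i + 4)) * c (i + 3) - c 3 * c (nxt n (i + 4)) - c 2 * c (i + 3))"
proof -
  let ?r = "i + 3" and ?s = "nxt n (i + 4)"
  have r: "?r \<in> {1..n}" "?r \<noteq> 2" "?r \<noteq> 3" and s: "?s \<in> {1..n}" "?s \<noteq> 2" "?s \<noteq> 3" and rs: "?s \<noteq> ?r"
    using i free_le(1)[of i] by (auto simp: nxt_free)
  have "vord (\<lambda>y. P y 3 2 * P y ?s ?r / (P y 3 ?s * P y 2 ?r))
      ((c 3 * c 2 + c ?s * c ?r) - (c 3 * c ?s + c 2 * c ?r))"
    using r s rs n l by (intro vord_divide vord_mult vord_P) auto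
  then show ?thesis
  proof (rule vord_cong)
    fix y assume y: "y \<in> V" "y 0 \<noteq> 0"
    obtain i' where i': "i = Suc i'" using i by (cases i) auto
    have "cubical l i (\<psi> y) = w y (i + 3) / w y (i + 4)"
    proof -
      have "i' + 4 = i + 3" "nxt n (i + 3) = i + 4" "i' < l" using nxt_lt[of "i + 3"] i i' n by auto
      then show ?thesis using cubical_\<psi>[of i' y, OF _ y, folded i'] by metis
    qed
    moreover have "cubical l (i + 1) (\<psi> y) = w y (i + 4) / w y ?s"
      using cubical_\<psi>[of i y] i y by simp
    moreover have "w y (i + 4) \<noteq> 0"
      using w_nz(1)[OF y, of "i + 4"] i n by simp
    ultimately have "1 - cubical l i (\<psi> y) * cubical l (i + 1) (\<psi> y) = 1 - w y ?r / w y ?s"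
      by simp
    also have "\<dots> = (P y 3 ?s * P y 2 ?r - P y 3 ?r * P y 2 ?s) / (P y 3 ?s * P y 2 ?r)"
      using w_nz[OF y r] w_nz[OF y s] by (simp add: w_def field_simps)
    also have "P y 3 ?s * P y 2 ?r - P y 3 ?r * P y 2 ?s = P y 3 2 * P y ?s ?r"
      by (simp add: P_def pdiff_def algebra_simps)
    finally show "P y 3 2 * P y ?s ?r / (P y 3 ?s * P y 2 ?r) =
        1 - cubical l i (\<psi> y) * cubical l (i + 1) (\<psi> y)" by simp
  qed simp
qed

section \<open>Affine positions as functions of the chart coordinates\<close>

lemma coord_upd: "j < l \<Longrightarrow> k \<in> {4..n} \<Longrightarrow> coord (y(j := t)) k = (if \<sigma> j = k then t else coord y k)"
  using \<sigma>_surj[of k] coord_\<sigma> \<sigma>_eq_iff by (metis fun_upd_apply)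

lemma node_upd: "j < l \<Longrightarrow> \<sigma> j \<noteq> a1 \<Longrightarrow> node (y(j := t)) = node y"
  using a1_range coord_upd by (simp add: node_def)

text \<open>The derivative of a position with respect to its own coordinate. The labels of
  \<open>S1\<close> other than \<open>a1\<close> and \<open>a2\<close> each contribute a factor
  \<open>y 0\<close>, which is the origin of the exponent \<open>card S1 - 2\<close>.\<close>

definition speed :: "(nat \<Rightarrow> complex) \<Rightarrow> nat \<Rightarrow> complex" where
  "speed y k = (if k \<notin> S1 \<or> k = a1 then 1 else if k = a2 then 1 - node y else y 0 * (1 - node y))"

lemma \<sigma>_a2_iff: "j < l \<Longrightarrow> \<sigma> j = a2 \<longleftrightarrow> j = 0"
  using \<sigma>_eq_iff[of j 0] \<sigma>0 l by simp

lemma partial_fin_self: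
  assumes j: "j < l"
  shows "partial j (\<lambda>y. fin y (\<sigma> j)) y = speed y (\<sigma> j)"
proof -
  let ?k = "\<sigma> j"
  have k: "?k \<in> {4..n}" using \<sigma>_range j by simp
  consider "?k \<notin> S1" | "?k = a1" | "?k = a2" | "?k \<in> S1" "?k \<noteq> a1" "?k \<noteq> a2" by blast
  then show ?thesis
  proof cases
    case 1
    then show ?thesis
      by (simp add: partial_def fin_coord[OF 1 k] coord_upd[OF j k] speed_def)
  next
    case 2
    then have "fin z ?k = coord z ?k" for z
      using \<sigma>_ne(2)[OF j] fin_a1[of z] by (simp add: node_def)
    then have "fin (y(j := t)) ?k = t" for t using coord_upd[OF j k, of y t] by simp
    then have "partial j (\<lambda>y. fin y ?k) y = 1" by (simp add: partial_def)
    then show ?thesis using 2 by (simp add: speed_def)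
  next
    case 3
    then have "fin (y(j := t)) ?k = node y + t * (1 - node y)" for t
      using node_upd[OF j, of y t] \<sigma>_a2_iff[OF j] a12 a2 by (simp add: fin_S1 ecoord_def)
    moreover have "((\<lambda>t. node y + t * (1 - node y)) has_field_derivative 1 - node y) (at (y j))"
      by (auto intro!: derivative_eq_intros)
    ultimately show ?thesis
      using 3 a2 a12 by (simp add: partial_def DERIV_imp_deriv speed_def)
  next
    case 4
    then have "fin (y(j := t)) ?k = node y + y 0 * (1 - node y) * t" for t
      using node_upd[OF j, of y t] \<sigma>_a2_iff[OF j] coord_upd[OF j k, of y t] by (simp add: fin_S1 ecoord_def)
    moreover have "((\<lambda>t. node y + y 0 * (1 - node y) * t) has_field_derivative y 0 * (1 - node y)) (at (y j))"
      by (auto intro!: derivative_eq_intros)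
    ultimately show ?thesis
      using 4 by (simp add: partial_def DERIV_imp_deriv speed_def)
  qed
qed

text \<open>Besides its own coordinate, a position involves at most those of \<open>a1\<close> and
  \<open>a2\<close>, which carry the node and the collision parameter. The resulting triangular
  shape gives the determinant.\<close>

lemma partial_fin_zero:
  assumes j: "j < l" and k: "k \<in> {4..n}" "\<sigma> j \<noteq> k"
    and nz: "partial j (\<lambda>y. fin y k) y \<noteq> 0"
  shows "k \<in> S1 \<and> k \<noteq> a1 \<and> (\<sigma> j = a1 \<or> \<sigma> j = a2 \<and> k \<noteq> a2)"
proof (rule ccontr)
  assume neg: "\<not> ?thesis"
  have "fin (y(j := t)) k = fin y k" for t
  proof (cases "k \<in> S1")
    case False
    then show ?thesis using fin_coord[OF False k(1)] coord_upd[OF j k(1)] k(2) by simp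
  next
    case True
    show ?thesis
    proof (cases "k = a1")
      case True
      then show ?thesis using fin_a1 node_upd[OF j] k(2) by simp
    next
      case False
      then have "\<sigma> j \<noteq> a1" "\<sigma> j \<noteq> a2" using neg True k(2) by auto
      then show ?thesis
        using True node_upd[OF j] \<sigma>_a2_iff[OF j] coord_upd[OF j k(1)] k(2)
        by (simp add: fin_S1 ecoord_def)
    qed
  qed
  then have "partial j (\<lambda>y. fin y k) y = 0" by (simp add: partial_def)
  then show False using nz by simp
qed

lemma det_fin:
  "Determinant.det (Matrix.mat l l (\<lambda>(j', j). partial j (\<lambda>y. fin y (\<sigma> j')) y)) = (\<Prod>j<l. speed y (\<sigma> j))"
proof -
  \<comment> \<open>The weights rank coordinates by influence: the node acts on all of
    \<open>S1\<close>, the collision parameter on \<open>S1\<close> without \<open>a1\<close>, any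
    other coordinate on its own label only.\<close>
  define \<rho> where "\<rho> j = (if \<sigma> j = a1 then 2 else if \<sigma> j = a2 then 1 else 0 :: nat)" for j
  let ?M = "Matrix.mat l l (\<lambda>(j', j). partial j (\<lambda>y. fin y (\<sigma> j')) y)"
  have "Determinant.det ?M = signof id * (\<Prod>i = 0..<l. ?M $$ (i, id i))"
  proof (rule det_dominant_permutation)
    fix i j assume ij: "i < l" "j < l" "?M $$ (i, j) \<noteq> 0"
    show "j = id i \<or> \<rho> (id i) < \<rho> j"
    proof (cases "j = i")
      case False
      then have "\<sigma> j \<noteq> \<sigma> i" using \<sigma>_eq_iff ij by simp
      then show ?thesis
        using partial_fin_zero[OF ij(2) \<sigma>_range[OF ij(1)]] ij by (auto simp: \<rho>_def)
    qed simp
  qed (auto simp: permutes_id)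
  also have "\<dots> = (\<Prod>j<l. speed y (\<sigma> j))"
    by (simp add: partial_fin_self atLeast0LessThan)
  finally show ?thesis .
qed

lemma vord_speed: "vord (\<lambda>y. speed y k) (if k \<in> S1 - {a1, a2} then 1 else 0)"
proof -
  have "vord (\<lambda>y. 1 - node y) 0"
    unfolding vord_def
    using node_ne_1 holo_diff[OF holo_const holo_node, OF openin_V openin_V]
    by (intro exI[of _ "\<lambda>y. 1 - node y"]) auto
  moreover have "vord (\<lambda>y. y 0 * (1 - node y)) 1"
    using vord_mult[OF vord_t calculation] by simp
  moreover have "vord (\<lambda>y. 1) 0" by (rule vord_const) simp
  ultimately show ?thesis
    unfolding speed_def[abs_def] by (cases "k \<in> S1"; cases "k = a1"; cases "k = a2") simp_all
qed

end

text \<open>The first sum holds the exponents from the Jacobian, the second those from the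
  denominators of the form; what remains is the inverse product of the differences of labels two
  apart. Pairs among 1, 2, 3 drop out by \<open>z\<close>, since at most one of these labels lies in
  \<open>S1\<close>.\<close>

lemma cyclic_pair_sum:
  fixes c :: "nat \<Rightarrow> int" and k :: nat
  assumes n: "n = k + 4" and z: "c 1 * c 2 = 0" "c 1 * c 3 = 0" "c 2 * c 3 = 0"
  shows "(\<Sum>i<Suc k. c 3 * c 2 - 2 * (c 2 * c (i + 4)) - (c 3 * c (nxt n (i + 4)) - c 2 * c (nxt n (i + 4))))
      - (\<Sum>i\<in>{1..<Suc k}. c 3 * c 2 + c (nxt n (i + 4)) * c (i + 3) - c 3 * c (nxt n (i + 4)) - c 2 * c (i + 3))
    = - (\<Sum>i\<in>{1..n}. c i * c (nxt n (nxt n i)))"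
proof -
  have nxt: "nxt n i = i + 1" if "i < n" for i using that by (simp add: nxt_def)
  have nn: "nxt n n = 1" by (simp add: nxt_def)
  have z': "c 3 * c 2 = 0" using z(3) by (simp add: mult.commute)
  define s where "s i = c (nxt n (i + 4))" for i
  \<comment> \<open>Splitting the same range at either end gives relations between the shifted sums;
    modulo these the claim is linear in the products.\<close>
  define X where "X = (\<Sum>i<k. c (i + 5))"
  define Y where "Y = (\<Sum>i<k. c (i + 4))"
  define Z where "Z = (\<Sum>i<k. s (Suc i))"
  define W where "W = (\<Sum>i<k. c (i + 4) * s (Suc i))"
  have "(\<Sum>i<Suc k. c (i + 4)) = c 4 + X"
    unfolding sum.lessThan_Suc_shift by (simp add: X_def numeral_eq_Suc)
  moreover have "(\<Sum>i<Suc k. c (i + 4)) = Y + c n" by (simp add: Y_def n)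
  ultimately have S1: "(\<Sum>i<Suc k. c (i + 4)) = c 4 + X" "(\<Sum>i<Suc k. c (i + 4)) = Y + c n" .
  have S2: "(\<Sum>i<Suc k. s i) = s 0 + Z"
    unfolding sum.lessThan_Suc_shift by (simp add: Z_def)
  have S3: "(\<Sum>i<Suc k. s i) = X + c 1"
  proof -
    have "nxt n (i + 4) = i + 5" if "i < k" for i using nxt[of "i + 4"] that n by simp
    then have "s i = c (i + 5)" if "i < k" for i using that by (simp only: s_def)
    moreover have "s k = c 1" using nn n by (simp add: s_def)
    ultimately show ?thesis by (simp add: X_def)
  qed
  have A: "(\<Sum>i<Suc k. c 3 * c 2 - 2 * (c 2 * c (i + 4)) - (c 3 * c (nxt n (i + 4)) - c 2 * c (nxt n (i + 4))))
     = - 2 * (c 2 * (\<Sum>i<Suc k. c (i + 4))) - c 3 * (\<Sum>i<Suc k. s i) + c 2 * (\<Sum>i<Suc k. s i)"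
    unfolding s_def[symmetric] z'
    by (simp add: sum_subtractf sum_distrib_left sum.distrib sum_negf del: sum.lessThan_Suc)
  have B: "(\<Sum>i\<in>{1..<Suc k}. c 3 * c 2 + c (nxt n (i + 4)) * c (i + 3) - c 3 * c (nxt n (i + 4)) - c 2 * c (i + 3))
     = W - c 3 * Z - c 2 * Y"
  proof -
    have "(\<Sum>i\<in>{1..<Suc k}. c 3 * c 2 + c (nxt n (i + 4)) * c (i + 3) - c 3 * c (nxt n (i + 4)) - c 2 * c (i + 3))
      = (\<Sum>i<k. c (i + 4) * s (Suc i) - c 3 * s (Suc i) - c 2 * c (i + 4))"
      by (rule sum.reindex_bij_witness[of _ Suc "\<lambda>i. i - 1"]) (auto simp: s_def add.commute[of 3] z' z(3))
    also have "\<dots> = W - c 3 * Z - c 2 * Y"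
      by (simp add: W_def Y_def Z_def sum_distrib_left sum_subtractf)
    finally show ?thesis .
  qed
  have C: "(\<Sum>i\<in>{1..n}. c i * c (nxt n (nxt n i))) = c 2 * c 4 + c 3 * s 0 + W + c n * c 2"
  proof -
    let ?f = "\<lambda>i. c i * c (nxt n (nxt n i))"
    \<comment> \<open>The labels at which the cyclic sum meets 1, 2 or 3 are split off: 1 is paired
      with 3, and \<open>n\<close> with 2.\<close>
    have "{1..n} = insert 1 (insert 2 (insert 3 ({4..<n} \<union> {n})))" using n by auto
    then have "sum ?f {1..n} = ?f 1 + (?f 2 + (?f 3 + (sum ?f {4..<n} + ?f n)))"
      using n by (simp add: sum.union_disjoint)
    moreover have "sum ?f {4..<n} = W"
      unfolding W_def
      by (rule sum.reindex_bij_witness[of _ "\<lambda>i. i + 4" "\<lambda>i. i - 4"]) (auto simp: n s_def nxt_def)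
    moreover have "?f 1 = 0" "?f 2 = c 2 * c 4" "?f 3 = c 3 * s 0" "?f n = c n * c 2"
    proof -
      have "nxt n 1 = 2" "nxt n 2 = 3" "nxt n 3 = 4"
        using nxt[of 1] nxt[of 2] nxt[of 3] n by simp_all
      then show "?f 1 = 0" "?f 2 = c 2 * c 4" "?f 3 = c 3 * s 0" "?f n = c n * c 2"
        using z(2) by (simp_all only: nn) (simp_all add: s_def)
    qed
    ultimately show ?thesis by simp
  qed
  have "c 2 * (\<Sum>i<Suc k. c (i + 4)) = c 2 * c 4 + c 2 * X"
    by (simp only: S1(1) distrib_left)
  moreover have "c 2 * (\<Sum>i<Suc k. c (i + 4)) = c 2 * Y + c n * c 2"
    by (simp only: S1(2) distrib_left mult.commute[of "c n"])
  moreover have "c 3 * (\<Sum>i<Suc k. s i) = c 3 * s 0 + c 3 * Z"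
    by (simp only: S2 distrib_left)
  moreover have "c 2 * (\<Sum>i<Suc k. s i) = c 2 * X + c 1 * c 2"
    by (simp only: S3 distrib_left mult.commute[of "c 1"])
  ultimately show ?thesis using A B C z(1) by linarith
qed

context gauge
begin

section \<open>The Jacobian, factored through the affine positions\<close>

text \<open>\<open>w\<close> is a Moebius function of the position of \<open>k\<close>, with
  determinant \<open>P y 3 2\<close>. Label 1 is among the three normalised points, so there
  \<open>w\<close> is constant.\<close>

lemma partial_w:
  assumes y: "y \<in> V" "y 0 \<noteq> 0" and j: "j < l" and k: "k \<in> {1..n}" "k \<noteq> 2" "k \<noteq> 3"
  shows "((\<lambda>t. w (y(j := t)) k) has_field_derivative
    (if k \<in> {4..n} then P y 3 2 / (P y 2 k)\<^sup>2 * partial j (\<lambda>y. fin y k) y else 0)) (at (y j))"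
proof (cases "k \<in> {4..n}")
  case True
  have spec: "pt z i = pt y i" if "i \<in> {1,2,3}" for z i
  proof -
    have "i \<in> {b, p, q}" using bpq(1) that by simp
    then show ?thesis using pt_special by auto
  qed
  have kb: "k \<noteq> b" using special_iff[OF k(1)] True by blast
  define A where "A i = hcoord1 (pt y i)" for i
  define B where "B i = hcoord2 (pt y i)" for i
  have P: "P z i k = A i - fin z k * B i" if "i \<in> {1,2,3}" for z i
    unfolding P_def spec[OF that, of z] by (simp add: pt_def[of z k] kb pdiff_def A_def B_def)
  have w: "w z k = (A 3 - fin z k * B 3) / (A 2 - fin z k * B 2)" for z
    unfolding w_def by (simp add: P)
  have nz: "A 2 - fin y k * B 2 \<noteq> 0" using w_nz(2)[OF y k] by (simp add: P)
  have "holo l V (\<lambda>y. fin y k)" using holo_fin[OF openin_V k(1) kb] .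
  then have "((\<lambda>t. fin (y(j := t)) k) has_field_derivative partial j (\<lambda>y. fin y k) y) (at (y j))"
    using holo_has_partial[of l V "\<lambda>y. fin y k" y j "y j"] y(1) j by simp
  then have "((\<lambda>t. (A 3 - fin (y(j := t)) k * B 3) / (A 2 - fin (y(j := t)) k * B 2)) has_field_derivative
     ((- (partial j (\<lambda>y. fin y k) y * B 3)) * (A 2 - fin y k * B 2) -
      (A 3 - fin y k * B 3) * (- (partial j (\<lambda>y. fin y k) y * B 2))) / (A 2 - fin y k * B 2)\<^sup>2) (at (y j))"
    using nz by (auto intro!: derivative_eq_intros simp: power2_eq_square)
  moreover have "((- (partial j (\<lambda>y. fin y k) y * B 3)) * (A 2 - fin y k * B 2) -
      (A 3 - fin y k * B 3) * (- (partial j (\<lambda>y. fin y k) y * B 2))) =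
      P y 3 2 * partial j (\<lambda>y. fin y k) y"
    by (simp add: P_def pdiff_def A_def B_def algebra_simps)
  ultimately show ?thesis
    unfolding w using True P[of 2 y] by simp
next
  case False
  then have k1: "k = 1" using k by auto
  have "w z 1 = w y 1" for z
  proof -
    have "pt z i = pt y i" if "i \<in> {1,2,3}" for i
    proof -
      have "i \<in> {b, p, q}" using bpq(1) that by simp
      then show ?thesis using pt_special by auto
    qed
    then show ?thesis by (simp add: w_def P_def)
  qed
  then have "w (y(j := t)) k = w y k" for t unfolding k1 by blast
  then show ?thesis unfolding if_not_P[OF False] by simp
qed

text \<open>The derivative of the cubical coordinate with index \<open>Suc i\<close> by the position
  of label \<open>k\<close>; only label \<open>i + 4\<close> and its cyclic successor enter.\<close>

definition jac :: "(nat \<Rightarrow> complex) \<Rightarrow> nat \<Rightarrow> nat \<Rightarrow> complex" where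
  "jac y i k = (let r = i + 4; s = nxt n (i + 4) in
     (if k = r then P y 3 2 / ((P y 2 r)\<^sup>2 * w y s) else 0) -
     (if k = s then w y r * P y 3 2 / ((w y s)\<^sup>2 * (P y 2 s)\<^sup>2) else 0))"

text \<open>With the positions as intermediate variables, the Jacobian is the product of two
  matrices, each triangular up to reordering.\<close>

lemma partial_cubical:
  assumes y: "y \<in> V" "y 0 \<noteq> 0" and i: "i < l" and j: "j < l"
  shows "partial j (\<lambda>y'. cubical l (Suc i) (\<psi> y')) y =
    (\<Sum>j'<l. jac y i (\<sigma> j') * partial j (\<lambda>y. fin y (\<sigma> j')) y)"
proof -
  let ?r = "i + 4" and ?s = "nxt n (i + 4)"
  define D where "D k = partial j (\<lambda>y. fin y k) y" for k
  have r: "?r \<in> {1..n}" "?r \<noteq> 2" "?r \<noteq> 3" "?r \<in> {4..n}" and s: "?s \<in> {1..n}" "?s \<noteq> 2" "?s \<noteq> 3"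
    using w_range[OF i] nxt_range by auto
  have wnz: "w y ?s \<noteq> 0" by (rule w_nz[OF y s])
  have o: "openin (Cn l) {y \<in> V. y 0 \<noteq> 0}"
    using openin_holo_nonzero[OF holo_coord[OF openin_V l]] .
  have "partial j (\<lambda>y'. cubical l (Suc i) (\<psi> y')) y = partial j (\<lambda>y'. w y' ?r / w y' ?s) y"
    by (rule partial_cong[OF o _ j]) (use y cubical_\<psi>[OF i] in auto)
  also have "\<dots> = (P y 3 2 / (P y 2 ?r)\<^sup>2 * D ?r * w y ?s -
      w y ?r * (if ?s \<in> {4..n} then P y 3 2 / (P y 2 ?s)\<^sup>2 * D ?s else 0)) / (w y ?s * w y ?s)"
    unfolding partial_def[of j "\<lambda>y'. w y' ?r / w y' ?s"] D_def
    using DERIV_divide[OF partial_w[OF y j r(1-3)] partial_w[OF y j s]] wnz r(4)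
    by (intro DERIV_imp_deriv) simp
  also have "\<dots> = (\<Sum>k\<in>{4..n}. jac y i k * D k)"
  proof -
    have "(\<Sum>k\<in>{4..n}. jac y i k * D k) =
      (\<Sum>k\<in>{4..n}. if k = ?r then P y 3 2 / ((P y 2 ?r)\<^sup>2 * w y ?s) * D ?r else 0) -
      (\<Sum>k\<in>{4..n}. if k = ?s then w y ?r * P y 3 2 / ((w y ?s)\<^sup>2 * (P y 2 ?s)\<^sup>2) * D ?s else 0)"
      unfolding sum_subtractf[symmetric]
      by (intro sum.cong) (auto simp: jac_def Let_def algebra_simps)
    also have "\<dots> = P y 3 2 / ((P y 2 ?r)\<^sup>2 * w y ?s) * D ?r -
      (if ?s \<in> {4..n} then w y ?r * P y 3 2 / ((w y ?s)\<^sup>2 * (P y 2 ?s)\<^sup>2) * D ?s else 0)"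
      using r(4) by (simp only: sum.delta finite_atLeastAtMost if_True)
    finally show ?thesis
      using wnz by (simp add: diff_divide_distrib power2_eq_square mult_ac del: atLeastAtMost_iff)
  qed
  also have "\<dots> = (\<Sum>j'<l. jac y i (\<sigma> j') * D (\<sigma> j'))"
    using sum.reindex_bij_betw[OF \<sigma>, of "\<lambda>k. jac y i k * D k"] by simp
  finally show ?thesis by (simp add: D_def)
qed

text \<open>The column belonging to label \<open>i + 4\<close>, as columns are numbered by
  \<open>\<sigma>\<close>; it is continued by the identity to be a permutation of all
  naturals.\<close>

definition inv\<sigma> :: "nat \<Rightarrow> nat" where
  "inv\<sigma> i = (if i < l then inv_into {..<l} \<sigma> (i + 4) else i)"

lemma inv\<sigma>: "i < l \<Longrightarrow> inv\<sigma> i < l" "i < l \<Longrightarrow> \<sigma> (inv\<sigma> i) = i + 4"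
proof -
  assume i: "i < l"
  then have "i + 4 \<in> \<sigma> ` {..<l}" using w_range(4) \<sigma> by (simp add: bij_betw_def)
  then show "inv\<sigma> i < l" "\<sigma> (inv\<sigma> i) = i + 4"
    using i inv_into_into[of "i + 4" \<sigma> "{..<l}"] f_inv_into_f[of "i + 4" \<sigma> "{..<l}"]
    by (simp_all add: inv\<sigma>_def)
qed

lemma inv\<sigma>_permutes: "inv\<sigma> permutes {0..<l}"
proof (rule bij_imp_permutes)
  have "inj_on inv\<sigma> {0..<l}"
    by (rule inj_onI) (metis inv\<sigma>(2) atLeastLessThan_iff add_right_cancel)
  moreover have "inv\<sigma> ` {0..<l} \<subseteq> {0..<l}" using inv\<sigma>(1) by auto
  ultimately show "bij_betw inv\<sigma> {0..<l} {0..<l}"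
    by (simp add: bij_betw_def endo_inj_surj)
qed (simp add: inv\<sigma>_def)

text \<open>The second entry of a row belongs to the next label, which is larger, or to label 1,
  which has no column. With labels as weights only the first entries survive.\<close>

lemma det_jac:
  "Determinant.det (Matrix.mat l l (\<lambda>(i, j). jac y i (\<sigma> j))) =
    signof inv\<sigma> * (\<Prod>i<l. P y 3 2 / ((P y 2 (i + 4))\<^sup>2 * w y (nxt n (i + 4))))"
proof -
  let ?M = "Matrix.mat l l (\<lambda>(i, j). jac y i (\<sigma> j))"
  have "Determinant.det ?M = signof inv\<sigma> * (\<Prod>i = 0..<l. ?M $$ (i, inv\<sigma> i))"
  proof (rule det_dominant_permutation[where \<rho> = \<sigma>])
    fix i j assume ij: "i < l" "j < l" "?M $$ (i, j) \<noteq> 0"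
    then have "\<sigma> j = i + 4 \<or> \<sigma> j = nxt n (i + 4)"
      by (auto simp: jac_def Let_def split: if_splits)
    then show "j = inv\<sigma> i \<or> \<sigma> (inv\<sigma> i) < \<sigma> j"
      using \<sigma>_eq_iff[OF ij(2) inv\<sigma>(1)[OF ij(1)]] inv\<sigma>(2)[OF ij(1)] \<sigma>_range[OF ij(2)] nxt_free[OF ij(1)]
      by (auto split: if_splits)
  qed (auto simp: inv\<sigma>_permutes)
  also have "\<dots> = signof inv\<sigma> * (\<Prod>i<l. P y 3 2 / ((P y 2 (i + 4))\<^sup>2 * w y (nxt n (i + 4))))"
    unfolding atLeast0LessThan
    using inv\<sigma> w_range(3)[THEN not_sym] by (intro arg_cong2[where f = "(*)"] prod.cong) (auto simp: jac_def Let_def)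
  finally show ?thesis .
qed

lemma jacobian:
  assumes y: "y \<in> V" "y 0 \<noteq> 0"
  shows "Determinant.det (Matrix.mat l l (\<lambda>(i, j). partial j (\<lambda>y'. cubical l (Suc i) (\<psi> y')) y)) =
    signof inv\<sigma> * (\<Prod>i<l. P y 3 2 / ((P y 2 (i + 4))\<^sup>2 * w y (nxt n (i + 4)))) * (\<Prod>j<l. speed y (\<sigma> j))"
proof -
  let ?A = "Matrix.mat l l (\<lambda>(i, j). jac y i (\<sigma> j))"
  let ?B = "Matrix.mat l l (\<lambda>(j', j). partial j (\<lambda>y. fin y (\<sigma> j')) y)"
  have "Matrix.mat l l (\<lambda>(i, j). partial j (\<lambda>y'. cubical l (Suc i) (\<psi> y')) y) = ?A * ?B"
    by (intro eq_matI) (auto simp: partial_cubical[OF y] scalar_prod_def atLeast0LessThan)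
  then show ?thesis
    using det_mult[of ?A l ?B] by (simp add: det_jac det_fin)
qed

section \<open>Assembling the exponents\<close>

lemma sum_speed: "(\<Sum>j<l. if \<sigma> j \<in> S1 - {a1, a2} then 1 else 0) = int (card S1) - 2"
proof -
  have fin: "finite S1" using S(1) finite_subset[of S1 "{1..n}"] by auto
  have "(\<Sum>j<l. if \<sigma> j \<in> S1 - {a1, a2} then 1 else 0) = (\<Sum>k\<in>{4..n}. if k \<in> S1 - {a1, a2} then 1 else (0::int))"
    by (rule sum.reindex_bij_betw[OF \<sigma>, of "\<lambda>k. if k \<in> S1 - {a1, a2} then 1 else 0"])
  also have "\<dots> = int (card (S1 - {a1, a2}))"
  proof -
    have "{4..n} \<inter> (S1 - {a1, a2}) = S1 - {a1, a2}" using S1_range by blast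
    then show ?thesis
      using sum.inter_restrict[of "{4..n}" "\<lambda>_. 1 :: int" "S1 - {a1, a2}"] by simp
  qed
  also have "\<dots> = int (card S1) - 2"
  proof -
    have sub: "{a1, a2} \<subseteq> S1" using a1 a2 by simp
    have "card {a1, a2} \<le> card S1" by (rule card_mono[OF fin sub])
    then show ?thesis using card_Diff_subset[of "{a1, a2}" S1] sub a12 by simp
  qed
  finally show ?thesis .
qed

text \<open>\<open>b\<close> and \<open>q\<close> lie in \<open>S2\<close>, so \<open>p\<close>
  alone among the labels 1, 2, 3 may lie in \<open>S1\<close>.\<close>

lemma special_products: "c 1 * c 2 = 0" "c 1 * c 3 = 0" "c 2 * c 3 = 0"
proof -
  have sp: "i = p" if "i \<in> {1, 2, 3}" "i \<in> S1" for i
  proof -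
    have "i \<in> {b, p, q}" using bpq(1) that by simp
    then show ?thesis using labels(6,7) that(2) by blast
  qed
  show "c 1 * c 2 = 0" "c 1 * c 3 = 0" "c 2 * c 3 = 0"
    using sp[of 1] sp[of 2] sp[of 3] by (auto simp: in1_def split: if_splits)
qed

lemma ord_along_formula:
  fixes \<alpha> :: "nat \<Rightarrow> nat \<Rightarrow> int" and r :: rat
  assumes r: "r \<noteq> 0"
  shows "ord_along l (boundary_divisor n S1 S2) (scale_form (u_monomial n \<alpha>) (canonical_form l r)) =
    (\<Sum>(i, j)\<in>chi n. \<alpha> i j *
      (c i * c (nxt n j) + c (nxt n i) * c j - c i * c j - c (nxt n i) * c (nxt n j)))
    + (int (card S1) - 2) - (\<Sum>i\<in>{1..n}. c i * c (nxt n (nxt n i)))"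
    (is "_ = ?m")
proof -
  let ?\<eta> = "scale_form (u_monomial n \<alpha>) (canonical_form l r)"
  let ?F = "\<lambda>y. u_monomial n \<alpha> (\<psi> y) *
      (of_rat r / (\<Prod>i\<in>{1..<l}. 1 - cubical l i (\<psi> y) * cubical l (i + 1) (\<psi> y))) *
      (signof inv\<sigma> * (\<Prod>i<l. P y 3 2 / ((P y 2 (i + 4))\<^sup>2 * w y (nxt n (i + 4)))) * (\<Prod>j<l. speed y (\<sigma> j)))"
  \<comment> \<open>The exponent in the shape in which the product and quotient rules assemble it,
    with the zeros contributed by constants.\<close>
  let ?M = "(\<Sum>(i, j)\<in>chi n. \<alpha> i j *
        (c i * c (nxt n j) + c (nxt n i) * c j - c i * c j - c (nxt n i) * c (nxt n j))) +
     (0 - (\<Sum>i\<in>{1..<l}. c 3 * c 2 + c (nxt n (i + 4)) * c (i + 3) - c 3 * c (nxt n (i + 4)) - c 2 * c (i + 3))) +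
     (0 + (\<Sum>i<l. c 3 * c 2 - (int 2 * (c 2 * c (i + 4)) + (c 3 * c (nxt n (i + 4)) - c 2 * c (nxt n (i + 4))))) +
       (\<Sum>j<l. if \<sigma> j \<in> S1 - {a1, a2} then 1 else 0))"
  have "vord ?F ?M"
  proof (intro vord_mult vord_divide vord_u_monomial vord_const vord_prod vord_one_minus_product vord_speed
      vord_power vord_w vord_P finite_lessThan finite_atLeastLessThan)
    show "of_int (sign inv\<sigma>) \<noteq> (0::complex)" by (simp add: sign_def)
  qed (use r w_range nxt_range free_le in auto)
  moreover have "?M = ?m"
  proof -
    obtain k where k: "l = Suc k" using l by (cases l) auto
    have nk: "n = k + 4" using n k by simp
    show ?thesis
      using cyclic_pair_sum[where c = c, OF nk special_products, folded k]
      unfolding sum_speed by (simp add: diff_diff_eq)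
  qed
  ultimately have "vord ?F ?m" by (simp only:)
  then obtain H where H: "holo l V H" "\<forall>y\<in>V. H y \<noteq> 0" "\<forall>y\<in>V. y 0 \<noteq> 0 \<longrightarrow> ?F y = y 0 powi ?m * H y"
    unfolding vord_def by (elim exE conjE)
  show ?thesis
  proof (rule ord_along_eq[OF H(1)])
    show "H y \<noteq> 0" if "y \<in> V" for y using H(2) that by blast
    show "pullback_coeff l \<psi> ?\<eta> y = y 0 powi ?m * H y" if "y \<in> V" "y 0 \<noteq> 0" for y
    proof -
      have "pullback_coeff l \<psi> ?\<eta> y = ?F y"
        unfolding pullback_coeff_def scale_form_def canonical_form_def fst_conv snd_conv jacobian[OF that] ..
      then show ?thesis using H(3) that by simp
    qed
    fix i assume i: "i < l"
    have o: "openin (Cn l) {y \<in> V. y 0 \<noteq> 0}"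
      using openin_holo_nonzero[OF holo_coord[OF openin_V l]] .
    have r: "i + 4 \<in> {1..n}" "i + 4 \<noteq> 2" "i + 4 \<noteq> 3" using free_le(1)[OF i] by auto
    have "holo l {y \<in> V. y 0 \<noteq> 0} (\<lambda>y. w y k)" if k: "k \<in> {1..n}" "k \<noteq> 2" "k \<noteq> 3" for k
      unfolding w_def
    proof (rule holo_divide)
      show "holo l {y \<in> V. y 0 \<noteq> 0} (\<lambda>y. P y 3 k)" "holo l {y \<in> V. y 0 \<noteq> 0} (\<lambda>y. P y 2 k)"
        using k free_le(2) by (intro holo_P[OF o]; simp)+
      show "P y 2 k \<noteq> 0" if "y \<in> {y \<in> V. y 0 \<noteq> 0}" for y using w_nz(2)[OF _ _ k] that by simp
    qed
    then have "holo l {y \<in> V. y 0 \<noteq> 0} (\<lambda>y. w y (i + 4) / w y (nxt n (i + 4)))"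
      using r w_range[OF i] nxt_range w_nz(1) by (intro holo_divide) auto
    then have "holo l {y \<in> V. y 0 \<noteq> 0} (\<lambda>y. cubical l (Suc i) (\<psi> y))"
      by (rule holo_cong_on) (simp add: cubical_\<psi>[OF i])
    then show "holo l {y \<in> V. y 0 \<noteq> 0} (\<lambda>y. snd ?\<eta> (Suc i) (\<psi> y))"
      by (simp add: scale_form_def canonical_form_def)
  qed
qed

end

section \<open>The order along the divisor\<close>

text \<open>When two labels lie on each side, the definition gives precedence to the first
  component. The other one yields the same value because no marked point sits at the node: the way
  the labels are paired decides between 0, 1 and infinity.\<close>

lemma nodal_point_swap:
  assumes S: "S1 \<union> S2 = {1..n}" "S1 \<inter> S2 = {}"
    and st: "s \<notin> a ` S1" "t \<notin> b ` S2"
  shows "nodal_point n S1 a s b t = nodal_point n S2 b t a s"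
proof (rule HOL.ext, clarify)
  fix i j k m
  define zz where "zz i = (if i \<in> S1 then a i else s)" for i
  define ww where "ww i = (if i \<in> S1 then t else b i)" for i
  define e where "e i = (if i \<in> S1 then 1 else 0 :: nat)" for i
  show "nodal_point n S1 a s b t (i, j, k, m) = nodal_point n S2 b t a s (i, j, k, m)"
  proof (cases "(i, j, k, m) \<in> quads n")
    case False
    then show ?thesis by (simp add: nodal_point_def)
  next
    case True
    then have d: "i \<noteq> j" "i \<noteq> k" "i \<noteq> m" "j \<noteq> k" "j \<noteq> m" "k \<noteq> m"
      and r: "i \<in> {1..n}" "j \<in> {1..n}" "k \<in> {1..n}" "m \<in> {1..n}"
      by (auto simp: quads_def)
    have S2: "x \<in> S2 \<longleftrightarrow> x \<notin> S1" if "x \<in> {1..n}" for x using that S by blast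
    note S2' = S2[OF r(1)] S2[OF r(2)] S2[OF r(3)] S2[OF r(4)]
    have z0: "pdiff (zz x) (zz y) = 0" if "x \<notin> S1" "y \<notin> S1" for x y
      using that by (simp add: zz_def pdiff_eq_0_iff)
    have w0: "pdiff (ww x) (ww y) = 0" if "x \<in> S1" "y \<in> S1" for x y
      using that by (simp add: ww_def pdiff_eq_0_iff)
    have zn: "pdiff (zz x) (zz y) \<noteq> 0" "pdiff (zz y) (zz x) \<noteq> 0" if "x \<in> S1" "y \<notin> S1" for x y
    proof -
      have "a x \<noteq> s" using st(1) that(1) by blast
      then show "pdiff (zz x) (zz y) \<noteq> 0" "pdiff (zz y) (zz x) \<noteq> 0"
        using that by (auto simp: zz_def pdiff_eq_0_iff)
    qed
    have wn: "pdiff (ww x) (ww y) \<noteq> 0" "pdiff (ww y) (ww x) \<noteq> 0" if "x \<in> S1" "y \<notin> S1" "y \<in> {1..n}" for x y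
    proof -
      have "b y \<noteq> t" using st(2) S2[OF that(3)] that(2) by blast
      then show "pdiff (ww x) (ww y) \<noteq> 0" "pdiff (ww y) (ww x) \<noteq> 0"
        using that by (auto simp: ww_def pdiff_eq_0_iff)
    qed
    have eqz: "zz x = s" "ww x = b x" if "x \<notin> S1" for x using that by (auto simp: zz_def ww_def)
    have eqw: "ww x = t" if "x \<in> S1" for x using that by (auto simp: ww_def)
    have c1: "2 \<le> card ({i, j, k, m} \<inter> S1) \<longleftrightarrow> 2 \<le> e i + e j + e k + e m"
      using d by (auto simp: e_def card_insert_if)
    have c2: "2 \<le> card ({i, j, k, m} \<inter> S2) \<longleftrightarrow> e i + e j + e k + e m \<le> 2"
      using d S2' by (auto simp: e_def card_insert_if)
    have bal: "cross_ratio (zz i) (zz j) (zz k) (zz m) = cross_ratio (ww i) (ww j) (ww k) (ww m)"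
      if two: "e i + e j + e k + e m = 2"
    proof -
      \<comment> \<open>If the pair in \<open>S1\<close> is \<open>{i, j}\<close> or
        \<open>{k, m}\<close>, the cross-ratio is 1 by cancellation; in the other four cases exactly
        one of numerator and denominator vanishes, on both components alike.\<close>
      consider "i \<in> S1" "j \<in> S1" "k \<notin> S1" "m \<notin> S1" | "i \<in> S1" "j \<notin> S1" "k \<in> S1" "m \<notin> S1"
        | "i \<in> S1" "j \<notin> S1" "k \<notin> S1" "m \<in> S1" | "i \<notin> S1" "j \<in> S1" "k \<in> S1" "m \<notin> S1"
        | "i \<notin> S1" "j \<in> S1" "k \<notin> S1" "m \<in> S1" | "i \<notin> S1" "j \<notin> S1" "k \<in> S1" "m \<in> S1"
        using two by (auto simp: e_def split: if_splits)
      then show ?thesis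
      proof cases
        case 1
        have "zz m = zz k" "ww j = ww i" using 1 eqz eqw by auto
        moreover have "pdiff (zz i) (zz k) \<noteq> 0" "pdiff (zz j) (zz k) \<noteq> 0"
          "pdiff (ww i) (ww k) \<noteq> 0" "pdiff (ww i) (ww m) \<noteq> 0"
          using 1 zn wn r by blast+
        ultimately show ?thesis by (simp add: cross_ratio_def proj_pt_def)
      next
        case 6
        have "zz j = zz i" "ww m = ww k" using 6 eqz eqw by auto
        moreover have "pdiff (zz i) (zz k) \<noteq> 0" "pdiff (zz i) (zz m) \<noteq> 0"
          "pdiff (ww i) (ww k) \<noteq> 0" "pdiff (ww j) (ww k) \<noteq> 0"
          using 6 zn wn r by blast+
        ultimately show ?thesis by (simp add: cross_ratio_def proj_pt_def)
      qed (use r zn wn in \<open>simp_all add: cross_ratio_def proj_pt_def z0 w0\<close>)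
    qed
    have 1: "nodal_point n S1 a s b t (i, j, k, m) = (if 2 \<le> e i + e j + e k + e m
        then cross_ratio (zz i) (zz j) (zz k) (zz m) else cross_ratio (ww i) (ww j) (ww k) (ww m))"
      unfolding nodal_point_def Let_def using True by (simp add: c1 zz_def ww_def)
    have 2: "nodal_point n S2 b t a s (i, j, k, m) = (if e i + e j + e k + e m \<le> 2
        then cross_ratio (ww i) (ww j) (ww k) (ww m) else cross_ratio (zz i) (zz j) (zz k) (zz m))"
      unfolding nodal_point_def Let_def using True by (simp add: c2 S2' zz_def ww_def)
    show ?thesis
      unfolding 1 2 using bal by (cases "e i + e j + e k + e m" "2 :: nat" rule: linorder_cases) auto
  qed
qed

lemma boundary_divisor_swap:
  assumes S: "S1 \<union> S2 = {1..n}" "S1 \<inter> S2 = {}"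
  shows "boundary_divisor n S1 S2 = boundary_divisor n S2 S1"
proof -
  have sub: "open_stratum n A B \<subseteq> open_stratum n B A" if AB: "A \<union> B = {1..n}" "A \<inter> B = {}" for A B
  proof
    fix r assume "r \<in> open_stratum n A B"
    then obtain a s b t where r: "r = nodal_point n A a s b t"
      and *: "inj_on a A" "s \<notin> a ` A" "inj_on b B" "t \<notin> b ` B"
      unfolding open_stratum_def by blast
    have "r = nodal_point n B b t a s" unfolding r by (rule nodal_point_swap[OF AB *(2,4)])
    then show "r \<in> open_stratum n B A" unfolding open_stratum_def using * by blast
  qed
  have "open_stratum n S1 S2 = open_stratum n S2 S1"
    using sub[OF S] sub[of S2 S1] S by (simp add: Un_commute Int_commute subset_antisym)
  then show ?thesis by (simp add: boundary_divisor_def)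
qed

lemma same_side_swap: "same_side S1 S2 i j = same_side S2 S1 i j"
  by (auto simp: same_side_def)

lemma gauge_exists:
  assumes n: "n = l + 3" "4 \<le> n" and S: "stable_partition n S1 S2"
    and bq: "b \<in> S2" "q \<in> S2" and bpq: "{b, p, q} = {1, 2, 3}" "b \<noteq> p" "b \<noteq> q" "p \<noteq> q"
  shows "\<exists>a1 a2 \<sigma>. gauge l n S1 S2 b p q a1 a2 \<sigma>"
proof -
  have S': "S1 \<union> S2 = {1..n}" "S1 \<inter> S2 = {}" "2 \<le> card S1"
    using S by (auto simp: stable_partition_def)
  obtain x y where xy: "x \<in> S1" "y \<in> S1" "x \<noteq> y"
  proof -
    have "finite S1" using S'(1) finite_subset[of S1 "{1..n}"] by auto
    then show ?thesis using that S'(3) card_le_Suc0_iff_eq[of S1] by force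
  qed
  obtain a1 a2 where a: "a1 \<in> S1" "a2 \<in> S1" "a1 \<noteq> a2" "p \<in> S1 \<Longrightarrow> a1 = p"
  proof (cases "p \<in> S1")
    case True
    obtain z where "z \<in> S1" "z \<noteq> p" using xy by (cases "x = p") auto
    then show ?thesis using that[of p z] True by simp
  next
    case False
    then show ?thesis using that[of x y] xy by simp
  qed
  \<comment> \<open>If \<open>p\<close> lies in \<open>S1\<close> then \<open>a1\<close> is
    \<open>p\<close>, so \<open>a2\<close> is never one of the three normalised labels.\<close>
  have "a2 \<noteq> b" "a2 \<noteq> q" "a2 \<noteq> p" using a bq S'(2) by auto
  then have "a2 \<notin> {1, 2, 3}" unfolding bpq(1)[symmetric] by blast
  moreover have "a2 \<in> {1..n}" using a(2) S'(1) by blast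
  ultimately have a2: "a2 \<in> {4..n}" by auto
  \<comment> \<open>The shift by 4 enumerates the free labels; exchanging 4 and \<open>a2\<close>
    puts \<open>a2\<close> in place 0.\<close>
  define \<sigma> where "\<sigma> = Transposition.transpose 4 a2 \<circ> (\<lambda>i. i + 4)"
  have "bij_betw (\<lambda>i. i + 4) {..<l} {4..n}"
    by (rule bij_betwI[where g = "\<lambda>i. i - 4"]) (use n in auto)
  moreover have "bij_betw (Transposition.transpose 4 a2) {4..n} {4..n}"
    by (rule permutes_imp_bij, rule permutes_swap_id) (use a2 n in auto)
  ultimately have bij: "bij_betw \<sigma> {..<l} {4..n}" unfolding \<sigma>_def by (rule bij_betw_trans)
  have \<sigma>0: "\<sigma> 0 = a2" by (simp add: \<sigma>_def)
  have l: "0 < l" using n by simp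
  show ?thesis
    by (intro exI gauge.intro) (rule n(1) l S'(1,2) bpq bq a(1-3) bij \<sigma>0 | erule a(4))+
qed

text \<open>\<open>same_side\<close> is \<open>1 - c i - c j + 2 * (c i * c j)\<close>. In the sum
  over \<open>chi n\<close> each of the four labels occurs once with either sign, so constant and
  linear terms cancel. In the cyclic sum they add up to \<open>n - 2 * card S1\<close>, and
  \<open>2 * (card S1 - 2) + n - 2 * card S1\<close> is \<open>l - 1\<close>.\<close>

lemma (in gauge) ord_along_same_side:
  fixes \<alpha> :: "nat \<Rightarrow> nat \<Rightarrow> int" and r :: rat
  assumes r: "r \<noteq> 0"
  shows "2 * ord_along l (boundary_divisor n S1 S2)
               (scale_form (u_monomial n \<alpha>) (canonical_form l r)) =
           (\<Sum>(i, j)\<in>chi n. \<alpha> i j *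
              (same_side S1 S2 i (nxt n j) + same_side S1 S2 (nxt n i) j
               - same_side S1 S2 i j - same_side S1 S2 (nxt n i) (nxt n j)))
           + (int l - 1)
           - (\<Sum>i\<in>{1..n}. same_side S1 S2 i (nxt n (nxt n i)))"
proof -
  have ss: "same_side S1 S2 i j = 1 - c i - c j + 2 * (c i * c j)" if "i \<in> {1..n}" "j \<in> {1..n}" for i j
  proof -
    have "i \<in> S2 \<longleftrightarrow> i \<notin> S1" "j \<in> S2 \<longleftrightarrow> j \<notin> S1" using that S by blast+
    then show ?thesis by (auto simp: same_side_def in1_def)
  qed
  have "(\<Sum>(i, j)\<in>chi n. \<alpha> i j *
              (same_side S1 S2 i (nxt n j) + same_side S1 S2 (nxt n i) j
               - same_side S1 S2 i j - same_side S1 S2 (nxt n i) (nxt n j)))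
     = 2 * (\<Sum>(i, j)\<in>chi n. \<alpha> i j *
      (c i * c (nxt n j) + c (nxt n i) * c j - c i * c j - c (nxt n i) * c (nxt n j)))"
    unfolding sum_distrib_left
  proof (rule sum.cong, simp, clarify)
    fix i j assume "(i, j) \<in> chi n"
    then have "i \<in> {1..n}" "j \<in> {1..n}" by (auto simp: chi_def)
    then show "\<alpha> i j * (same_side S1 S2 i (nxt n j) + same_side S1 S2 (nxt n i) j
               - same_side S1 S2 i j - same_side S1 S2 (nxt n i) (nxt n j)) =
        2 * (\<alpha> i j * (c i * c (nxt n j) + c (nxt n i) * c j - c i * c j - c (nxt n i) * c (nxt n j)))"
      by (simp only: ss nxt_range) (simp add: algebra_simps)
  qed
  moreover have "(\<Sum>i\<in>{1..n}. same_side S1 S2 i (nxt n (nxt n i))) =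
      int n - 2 * int (card S1) + 2 * (\<Sum>i\<in>{1..n}. c i * c (nxt n (nxt n i)))"
  proof -
    have "inj_on (nxt n) {1..n}"
      by (rule inj_onI) (auto simp: nxt_def mod_if split: if_splits)
    moreover have "nxt n ` {1..n} \<subseteq> {1..n}" using nxt_range by blast
    ultimately have bij: "bij_betw (nxt n) {1..n} {1..n}"
      by (simp add: bij_betw_def endo_inj_surj)
    have c1: "(\<Sum>i\<in>{1..n}. c i) = int (card S1)"
    proof -
      have "{1..n} \<inter> S1 = S1" using S(1) by blast
      then show ?thesis
        using sum.inter_restrict[of "{1..n}" "\<lambda>_. 1 :: int" S1] by (simp add: in1_def if_distrib cong: if_cong)
    qed
    have c2: "(\<Sum>i\<in>{1..n}. c (nxt n (nxt n i))) = int (card S1)"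
      using sum.reindex_bij_betw[OF bij_betw_trans[OF bij bij], of c] c1 by simp
    have "(\<Sum>i\<in>{1..n}. same_side S1 S2 i (nxt n (nxt n i))) =
      (\<Sum>i\<in>{1..n}. 1 - c i - c (nxt n (nxt n i)) + 2 * (c i * c (nxt n (nxt n i))))"
      by (intro sum.cong ss nxt_range refl)
    also have "\<dots> = int n - (\<Sum>i\<in>{1..n}. c i) - (\<Sum>i\<in>{1..n}. c (nxt n (nxt n i))) +
        2 * (\<Sum>i\<in>{1..n}. c i * c (nxt n (nxt n i)))"
      by (simp add: sum.distrib sum_subtractf sum_distrib_left)
    finally show ?thesis using c1 c2 by simp
  qed
  ultimately show ?thesis
    using ord_along_formula[OF r, of \<alpha>] n by simp
qed

theorem corollary7p6:
  fixes l n :: nat and S1 S2 :: "nat set" and \<alpha> :: "nat \<Rightarrow> nat \<Rightarrow> int" and c :: rat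
  assumes "n = l + 3" and "4 \<le> n" and "stable_partition n S1 S2" and "c \<noteq> 0"
  shows "2 * ord_along l (boundary_divisor n S1 S2)
               (scale_form (u_monomial n \<alpha>) (canonical_form l c)) =
           (\<Sum>(i, j)\<in>chi n. \<alpha> i j *
              (same_side S1 S2 i (nxt n j) + same_side S1 S2 (nxt n i) j
               - same_side S1 S2 i j - same_side S1 S2 (nxt n i) (nxt n j)))
           + (int l - 1)
           - (\<Sum>i\<in>{1..n}. same_side S1 S2 i (nxt n (nxt n i)))"
    (is "?L S1 S2 = ?R S1 S2")
proof -
  have main: "?L A B = ?R A B"
    if AB: "stable_partition n A B" and bq: "b \<in> B" "q \<in> B"
      and bpq: "{b, p, q} = {1, 2, 3}" "b \<noteq> p" "b \<noteq> q" "p \<noteq> q" for A B b p q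
  proof -
    obtain a1 a2 \<sigma> where "gauge l n A B b p q a1 a2 \<sigma>"
      using gauge_exists[OF assms(1,2) AB bq bpq] by blast
    then show ?thesis by (rule gauge.ord_along_same_side) (rule assms(4))
  qed
  \<comment> \<open>The two labels known to lie in \<open>B\<close> become \<open>b\<close> and
    \<open>q\<close>; the third becomes \<open>p\<close>, whose side is left open.\<close>
  have two: "?L A B = ?R A B" if AB: "stable_partition n A B"
    and two: "1 \<in> B \<and> 2 \<in> B \<or> 1 \<in> B \<and> 3 \<in> B \<or> 2 \<in> B \<and> 3 \<in> B" for A B
    using main[OF AB, of 1 2 3] main[OF AB, of 1 3 2] main[OF AB, of 2 3 1] two by force
  have S: "S1 \<union> S2 = {1..n}" "S1 \<inter> S2 = {}" using assms(3) by (auto simp: stable_partition_def)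
  have "stable_partition n S2 S1" using assms(3) by (auto simp: stable_partition_def)
  moreover have "{1, 2, 3} \<subseteq> S1 \<union> S2" unfolding S(1) using assms(2) by auto
  \<comment> \<open>If it is \<open>S1\<close> that contains two of the labels, the sides are
    exchanged; divisor and indicator are symmetric in them.\<close>
  ultimately consider "?L S1 S2 = ?R S1 S2" | "?L S2 S1 = ?R S2 S1"
    using two[OF assms(3)] two[of S2 S1] by blast
  then show ?thesis
  proof cases
    case 2
    then show ?thesis
      unfolding boundary_divisor_swap[OF S] same_side_swap[of S1 S2] .
  qed
qed

end
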